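(* Let $m\ge 4$ and let $C=C_1\cup\dots\cup C_m\subset\mathbb{P}^2$ be a normal crossing divisor whose irreducible components $C_j:f_j=0$ are smooth curves of degree $e_j$; let $f=f_1\cdots f_m$ and $d=\deg f=e_1+\dots+e_m$. Assume that no component $C_j$ is a line, i.e. $e_j\ge 2$ for all $j$. Then the minimal graded free resolution of the graded $S$-module $D_0(f)$ has the shape $$0\to\bigoplus_{j=1}^{m}S(-d+2-e_j)\to S(-d+2)^{m-1}\oplus S(-d+1)^3\ (\to D_0(f)\to 0),$$ and hence the minimal graded free resolution of the Jacobian algebra $M(f)$ has the shape $$0\to\bigoplus_{j=1}^{m}S(-2d+3-e_j)\to S(-2d+3)^{m-1}\oplus S(-2d+2)^3\to S(-d+1)^3\to S\ (\to M(f)\to 0).$$ Moreover, the $m$ generating syzygies $\rho_1,\dots,\rho_m$ of $D_0(f)$ (i.e. the generators of the module of relations among the generators of $D_0(f)$, given by the first map of the first resolution) correspond to the following relations among the 2-forms $\omega_1,\dots,\omega_{m-1},\omega^x,\omega^y,\omega^z$ that generate $D_0(f)$: $$\rho_j:\quad f_j\omega_j-(f_{j,x}\,\omega^x+f_{j,y}\,\omega^y+f_{j,z}\,\omega^z)=0,\qquad j=1,\dots,m,$$ where for $j=m$ the form $\omega_m$ has to be replaced by $-\sum_{i=1}^{m-1}\omega_i$.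
   Context: $S=\mathbb{C}[x,y,z]$ with its standard grading, and $\mathbb{P}^2$ is the complex projective plane. For $f\in S$ homogeneous with partial derivatives $f_x,f_y,f_z$, the Jacobian ideal is $J_f=(f_x,f_y,f_z)$, the Jacobian (Milnor) algebra is $M(f)=S/J_f$, and the graded module of Jacobian syzygies is $D_0(f)=\{(a,b,c)\in S^3: af_x+bf_y+cf_z=0\}$; a homogeneous syzygy $(a,b,c)$ has degree equal to the common degree of $a,b,c$. $f_{j,x},f_{j,y},f_{j,z}$ denote the partial derivatives of $f_j$. $\Omega^j$ is the $S$-module of polynomial differential $j$-forms on $\mathbb{C}^3$. A triple $(a,b,c)\in S^3$ is identified with the 2-form $a\,dy\wedge dz-b\,dx\wedge dz+c\,dx\wedge dy$; under this identification $D_0(f)$ corresponds to the 2-forms $\omega$ with $df\wedge\omega=0$. Define $\omega^x=df\wedge dx$, $\omega^y=df\wedge dy$, $\omega^z=df\wedge dz$, and for $j=1,\dots,m$ $$\omega_j=df\wedge\frac{df_j}{f_j}=\sum_{1\le i\le m,\ i\ne j}\frac{f}{f_if_j}\,df_i\wedge df_j\in\Omega^2 .$$ These satisfy $\sum_{j=1}^m\omega_j=0$. *)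

theory Defs
  imports
    "HOL-Analysis.Analysis"
    "HOL-Library.Poly_Mapping"
    "HOL-Algebra.QuotRing"
    "HOL-Algebra.Module"
begin

section \<open>The polynomial ring $S = C[x,y,z]$\<close>

text \<open>The variables $x, y, z$ are indexed by \<open>1, 2, 3 :: 3\<close>; a monomial is its exponent vector
  and a polynomial is a finitely supported coefficient function on monomials.\<close>

type_synonym cpoly = "(3 \<Rightarrow>\<^sub>0 nat) \<Rightarrow>\<^sub>0 complex"

definition var :: "3 \<Rightarrow> cpoly" where
  "var i = Poly_Mapping.single (Poly_Mapping.single i 1) 1"

definition peval :: "cpoly \<Rightarrow> complex ^ 3 \<Rightarrow> complex" where
  "peval g p = (\<Sum>\<mu>\<in>Poly_Mapping.keys g.
     Poly_Mapping.lookup g \<mu> * (\<Prod>i\<in>UNIV. (p $ i) ^ Poly_Mapping.lookup \<mu> i))"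

definition pdiff :: "3 \<Rightarrow> cpoly \<Rightarrow> cpoly" where
  "pdiff i g = (\<Sum>\<mu>\<in>Poly_Mapping.keys g.
     Poly_Mapping.single (\<mu> - Poly_Mapping.single i 1)
       (of_nat (Poly_Mapping.lookup \<mu> i) * Poly_Mapping.lookup g \<mu>))"

text \<open>Degrees are integers, so that twists need no truncated subtraction. The zero polynomial is
  homogeneous of every degree, and is the only polynomial homogeneous of a negative degree.\<close>

definition homogeneous :: "int \<Rightarrow> cpoly \<Rightarrow> bool" where
  "homogeneous k g \<longleftrightarrow>
     (\<forall>\<mu>\<in>Poly_Mapping.keys g. int (\<Sum>i\<in>UNIV. Poly_Mapping.lookup \<mu> i) = k)"

definition Sring :: "cpoly ring" where
  "Sring = \<lparr>carrier = UNIV, mult = (*), one = 1, zero = 0, add = (+)\<rparr>"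

definition irrelevant_ideal :: "cpoly set" where
  "irrelevant_ideal = genideal Sring {var 1, var 2, var 3}"

section \<open>Curves in the projective plane\<close>

text \<open>A point of the projective plane is given by any of its homogeneous coordinate vectors
  $p \neq 0$. For homogeneous \<open>g\<close>, \<open>curve g\<close> is the set of all coordinate vectors of points of
  the curve $g = 0$.\<close>

definition curve :: "cpoly \<Rightarrow> (complex ^ 3) set" where
  "curve g = {p. p \<noteq> 0 \<and> peval g p = 0}"

definition grad_at :: "cpoly \<Rightarrow> complex ^ 3 \<Rightarrow> complex ^ 3" where
  "grad_at g p = (\<chi> i. peval (pdiff i g) p)"

definition smooth_curve :: "cpoly \<Rightarrow> bool" where
  "smooth_curve g \<longleftrightarrow> (\<forall>p\<in>curve g. grad_at g p \<noteq> 0)"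

text \<open>Normal crossings of a family of curves: at each point, the local equations of the members
  passing through it are linearly independent modulo the square of the maximal ideal, that is, they
  are part of a regular system of parameters. In particular at most two members pass through
  a point, and two that do are transversal there. In homogeneous coordinates the differential at
  $[p]$ of a local equation of $f_j = 0$ is the gradient of $f_j$ at $p$ up to a nonzero factor:
  by Euler's relation that gradient vanishes on $p$, so it is a covector on the tangent space of the
  plane at $[p]$.\<close>

definition normal_crossing :: "nat set \<Rightarrow> (nat \<Rightarrow> cpoly) \<Rightarrow> bool" where
  "normal_crossing I f \<longleftrightarrow>
     (\<forall>p c. p \<noteq> 0 \<longrightarrow>
        (\<Sum>j\<in>{j \<in> I. p \<in> curve (f j)}. c j *s grad_at (f j) p) = 0 \<longrightarrow>
        (\<forall>j\<in>I. p \<in> curve (f j) \<longrightarrow> c j = 0))"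

section \<open>Graded modules and graded free resolutions\<close>

text \<open>\<open>grade M k\<close> is the homogeneous component of degree \<open>k\<close>. The ring fields \<open>mult\<close> and \<open>one\<close>
  of the underlying record play no role for modules.\<close>

record ('a, 'b) graded_module = "('a, 'b) module" +
  grade :: "int \<Rightarrow> 'b set"

definition graded_hom ::
  "(cpoly, 'b) graded_module \<Rightarrow> (cpoly, 'c) graded_module \<Rightarrow> ('b \<Rightarrow> 'c) \<Rightarrow> bool" where
  "graded_hom M N \<phi> \<longleftrightarrow>
     \<phi> \<in> carrier M \<rightarrow> carrier N \<and>
     (\<forall>u\<in>carrier M. \<forall>v\<in>carrier M. \<phi> (u \<oplus>\<^bsub>M\<^esub> v) = \<phi> u \<oplus>\<^bsub>N\<^esub> \<phi> v) \<and>
     (\<forall>s. \<forall>u\<in>carrier M. \<phi> (s \<odot>\<^bsub>M\<^esub> u) = s \<odot>\<^bsub>N\<^esub> \<phi> u) \<and>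
     (\<forall>k. \<phi> ` grade M k \<subseteq> grade N k)"

text \<open>\<open>free_module [a\<^sub>0, \<dots>, a\<^sub>n]\<close> is $S(a_0) \oplus \dots \oplus S(a_n)$, where $S(a)_k = S_{a+k}$.
  Its elements are coordinate vectors, indexed from 0, and \<open>basis i\<close> is the \<open>i\<close>-th standard
  generator, which has degree $-a_i$.\<close>

type_synonym fvec = "nat \<Rightarrow>\<^sub>0 cpoly"

definition fscale :: "cpoly \<Rightarrow> fvec \<Rightarrow> fvec" where
  "fscale s u = Poly_Mapping.map (\<lambda>c. s * c) u"

definition basis :: "nat \<Rightarrow> fvec" where
  "basis i = Poly_Mapping.single i 1"

definition free_module :: "int list \<Rightarrow> (cpoly, fvec) graded_module" where
  "free_module as =
     \<lparr>carrier = {u. Poly_Mapping.keys u \<subseteq> {..<length as}},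
      mult = undefined, one = undefined, zero = 0, add = (+), smult = fscale,
      grade = (\<lambda>k. {u. Poly_Mapping.keys u \<subseteq> {..<length as} \<and>
        (\<forall>i<length as. homogeneous (as ! i + k) (Poly_Mapping.lookup u i))})\<rparr>"

text \<open>\<open>minimal_graded_free_resolution [A\<^sub>0, \<dots>, A\<^sub>n] \<epsilon> \<delta> M\<close>: with $F_k$ the free module with
  twists $A_k$ for $k \le n$, and $F_k = 0$ for $k > n$,
  \[ 0 \to F_n \to \dots \to F_1 \to F_0 \to M \to 0 \]
  is a minimal graded free resolution, where $\epsilon : F_0 \to M$ and
  $\delta_k : F_{k+1} \to F_k$. Minimality says that the image of $\delta_k$ lies in
  $(x,y,z) F_k$.\<close>

definition res_term :: "int list list \<Rightarrow> nat \<Rightarrow> (cpoly, fvec) graded_module" where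
  "res_term As k = free_module (if k < length As then As ! k else [])"

definition minimal_graded_free_resolution ::
  "int list list \<Rightarrow> (fvec \<Rightarrow> 'b) \<Rightarrow> (nat \<Rightarrow> fvec \<Rightarrow> fvec) \<Rightarrow> (cpoly, 'b) graded_module \<Rightarrow> bool"
  where
  "minimal_graded_free_resolution As \<epsilon> \<delta> M \<longleftrightarrow>
     graded_hom (res_term As 0) M \<epsilon> \<and>
     (\<forall>k. graded_hom (res_term As (Suc k)) (res_term As k) (\<delta> k)) \<and>
     \<epsilon> ` carrier (res_term As 0) = carrier M \<and>
     a_kernel (res_term As 0) M \<epsilon> = \<delta> 0 ` carrier (res_term As 1) \<and>
     (\<forall>k. a_kernel (res_term As (Suc k)) (res_term As k) (\<delta> k) =
        \<delta> (Suc k) ` carrier (res_term As (Suc (Suc k)))) \<and>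
     (\<forall>k. \<forall>u\<in>carrier (res_term As (Suc k)). \<forall>i.
        Poly_Mapping.lookup (\<delta> k u) i \<in> irrelevant_ideal)"

section \<open>Jacobian syzygies and the Jacobian algebra\<close>

definition D0 :: "cpoly \<Rightarrow> (cpoly, cpoly ^ 3) graded_module" where
  "D0 f =
     \<lparr>carrier = {v. v $ 1 * pdiff 1 f + v $ 2 * pdiff 2 f + v $ 3 * pdiff 3 f = 0},
      mult = undefined, one = undefined, zero = 0, add = (+), smult = (*s),
      grade = (\<lambda>k. {v. v $ 1 * pdiff 1 f + v $ 2 * pdiff 2 f + v $ 3 * pdiff 3 f = 0 \<and>
        (\<forall>i. homogeneous k (v $ i))})\<rparr>"

definition jacobian_ideal :: "cpoly \<Rightarrow> cpoly set" where
  "jacobian_ideal f = genideal Sring {pdiff 1 f, pdiff 2 f, pdiff 3 f}"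

text \<open>The quotient ring \<open>Sring Quot jacobian_ideal f\<close>, viewed as a graded module over $S$ through
  the canonical projection.\<close>

definition jacobian_algebra :: "cpoly \<Rightarrow> (cpoly, cpoly set) graded_module" where
  "jacobian_algebra f = (let J = jacobian_ideal f; Q = Sring Quot J in
     \<lparr>carrier = carrier Q, mult = mult Q, one = one Q, zero = zero Q, add = add Q,
      smult = (\<lambda>s A. (J +>\<^bsub>Sring\<^esub> s) \<otimes>\<^bsub>Q\<^esub> A),
      grade = (\<lambda>k. {J +>\<^bsub>Sring\<^esub> g | g. homogeneous k g})\<rparr>)"

section \<open>Differential forms\<close>

text \<open>A 1-form $p\,dx + q\,dy + r\,dz$ is the vector $(p,q,r)$, and a 2-form
  $a\,dy\wedge dz - b\,dx\wedge dz + c\,dx\wedge dy$ is the vector $(a,b,c)$. With this identification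
  the wedge product of two 1-forms is given by the cross product formula, and
  $df\wedge\omega = (a f_x + b f_y + c f_z)\,dx\wedge dy\wedge dz$.\<close>

definition dform :: "cpoly \<Rightarrow> cpoly ^ 3" where
  "dform g = (\<chi> i. pdiff i g)"

definition wedge :: "cpoly ^ 3 \<Rightarrow> cpoly ^ 3 \<Rightarrow> cpoly ^ 3" where
  "wedge \<alpha> \<beta> = vector
     [\<alpha> $ 2 * \<beta> $ 3 - \<alpha> $ 3 * \<beta> $ 2,
      \<alpha> $ 3 * \<beta> $ 1 - \<alpha> $ 1 * \<beta> $ 3,
      \<alpha> $ 1 * \<beta> $ 2 - \<alpha> $ 2 * \<beta> $ 1]"

text \<open>\<open>omega_var f 1\<close>, \<open>omega_var f 2\<close>, \<open>omega_var f 3\<close> are $\omega^x, \omega^y, \omega^z$.\<close>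

definition omega_var :: "cpoly \<Rightarrow> 3 \<Rightarrow> cpoly ^ 3" where
  "omega_var f i = wedge (dform f) (dform (var i))"

text \<open>The form $\omega_j$ for $f = f_1 \cdots f_m$; the coefficient $f/(f_i f_j)$ is written as the
  product of the remaining factors.\<close>

definition omega :: "nat \<Rightarrow> (nat \<Rightarrow> cpoly) \<Rightarrow> nat \<Rightarrow> cpoly ^ 3" where
  "omega m f j = (\<Sum>i\<in>{1..m} - {j}.
     (\<Prod>k\<in>{1..m} - {i, j}. f k) *s wedge (dform (f i)) (dform (f j)))"

text \<open>The relations $\rho_j$ as elements of the free module on the generators
  $\omega_1,\dots,\omega_{m-1},\omega^x,\omega^y,\omega^z$, in this order. Thus \<open>basis (i - 1)\<close>
  stands for $\omega_i$ when $1 \le i < m$, and \<open>basis (m - 1)\<close>, \<open>basis m\<close>, \<open>basis (m + 1)\<close> stand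
  for $\omega^x, \omega^y, \omega^z$. \<open>omega_sym m m\<close> is the element replacing $\omega_m$.\<close>

definition omega_sym :: "nat \<Rightarrow> nat \<Rightarrow> fvec" where
  "omega_sym m j = (if j = m then - (\<Sum>i=1..<m. basis (i - 1)) else basis (j - 1))"

definition rho :: "nat \<Rightarrow> (nat \<Rightarrow> cpoly) \<Rightarrow> nat \<Rightarrow> fvec" where
  "rho m f j = fscale (f j) (omega_sym m j) -
     (fscale (pdiff 1 (f j)) (basis (m - 1)) +
      fscale (pdiff 2 (f j)) (basis m) +
      fscale (pdiff 3 (f j)) (basis (m + 1)))"

section \<open>The records above are modules over $S$\<close>

lemma cring_Sring: "cring Sring"
proof (rule cringI)
  show "abelian_group Sring"
    by (rule abelian_groupI) (auto simp: Sring_def algebra_simps intro: exI[of _ "- _"] ab_left_minus)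
  show "Group.comm_monoid Sring"
    by (rule comm_monoidI) (auto simp: Sring_def algebra_simps)
qed (auto simp: Sring_def algebra_simps)

lemma lookup_fscale [simp]: "Poly_Mapping.lookup (fscale s u) i = s * Poly_Mapping.lookup u i"
  by (simp add: fscale_def Poly_Mapping.map.rep_eq when_def)

lemma module_D0: "Module.module Sring (D0 f)"
proof -
  define L where "L v = v $ 1 * pdiff 1 f + v $ 2 * pdiff 2 f + v $ 3 * pdiff 3 f" for v :: "cpoly ^ 3"
  have D0: "D0 f = \<lparr>carrier = {v. L v = 0}, mult = undefined, one = undefined, zero = 0,
      add = (+), smult = (*s), grade = (\<lambda>k. {v. L v = 0 \<and> (\<forall>i. homogeneous k (v $ i))})\<rparr>"
    by (simp add: D0_def L_def)
  have L: "L 0 = 0" "L (u + v) = L u + L v" "L (s *s u) = s * L u" "L (- u) = - L u" for u v s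
    by (simp_all add: L_def algebra_simps)
  have ab: "abelian_group (D0 f)"
  proof (rule abelian_groupI)
    fix v assume "v \<in> carrier (D0 f)"
    then show "\<exists>y\<in>carrier (D0 f). y \<oplus>\<^bsub>D0 f\<^esub> v = \<zero>\<^bsub>D0 f\<^esub>"
      by (intro bexI[of _ "- v"]) (simp_all add: D0 L)
  qed (simp_all add: D0 L add_ac)
  show ?thesis
    by (rule moduleI[OF cring_Sring ab]) (simp_all add: D0 L Sring_def vec_eq_iff distrib_left distrib_right mult.assoc)
qed

lemma module_jac: "Module.module Sring (jacobian_algebra f)"
proof -
  interpret S: cring Sring by (rule cring_Sring)
  have id: "ideal (jacobian_ideal f) Sring"
    unfolding jacobian_ideal_def by (rule S.genideal_ideal) (simp add: Sring_def)
  interpret I: ideal "jacobian_ideal f" Sring by (rule id)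
  interpret Q: cring "Sring Quot jacobian_ideal f"
    by (rule I.quotient_is_cring[OF cring_Sring])
  interpret h: ring_hom_ring Sring "Sring Quot jacobian_ideal f" "(+>\<^bsub>Sring\<^esub>) (jacobian_ideal f)"
    by (rule I.rcos_ring_hom_ring)
  let ?Q = "Sring Quot jacobian_ideal f"
  have ab: "abelian_group (jacobian_algebra f)"
    by (rule abelian_groupI)
       (auto simp: jacobian_algebra_def Let_def Q.a_assoc Q.a_comm Q.a_lcomm intro: Q.l_neg Q.a_inv_closed)
  show ?thesis
    by (rule moduleI[OF cring_Sring ab])
       (auto simp: jacobian_algebra_def Let_def Q.l_distr Q.r_distr Q.m_assoc h.hom_closed h.hom_add h.hom_mult h.hom_one)
qed

lemma module_free: "Module.module Sring (free_module as)"
proof (rule moduleI[OF cring_Sring])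
  show "abelian_group (free_module as)"
  proof (rule abelian_groupI)
    fix u assume "u \<in> carrier (free_module as)"
    then show "\<exists>y\<in>carrier (free_module as). y \<oplus>\<^bsub>free_module as\<^esub> u = \<zero>\<^bsub>free_module as\<^esub>"
      by (intro bexI[of _ "- u"]) (auto simp: free_module_def)
  next
    fix u v assume "u \<in> carrier (free_module as)" "v \<in> carrier (free_module as)"
    then show "u \<oplus>\<^bsub>free_module as\<^esub> v \<in> carrier (free_module as)"
      using Poly_Mapping.keys_add[of u v] by (auto simp: free_module_def)
  qed (auto simp: free_module_def algebra_simps)
next
  fix a u assume "a \<in> carrier Sring" "u \<in> carrier (free_module as)"
  then show "a \<odot>\<^bsub>free_module as\<^esub> u \<in> carrier (free_module as)"
    by (auto simp: free_module_def in_keys_iff subset_iff)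
qed (auto simp: free_module_def Sring_def poly_mapping_eq_iff fun_eq_iff lookup_add algebra_simps)

end

theory Submission
  imports
    Defs
    "HOL-Computational_Algebra.Fundamental_Theorem_Algebra"
    "HOL-Computational_Algebra.Polynomial_Factorial"
    "HOL-Computational_Algebra.Field_as_Ring"
begin

text \<open>Write $E = (x,y,z)$ for the position vector and $F_j = f/f_j$. A syzygy of the partial derivatives
of $f$ is a 2-form $\theta$ with $df \wedge \theta = 0$, and also a vector field that annihilates
$f$. The proof goes back and forth between $\theta$ and the 1-form $\alpha = E \times \theta$.
Wedging with $df$ recovers $\theta$: by Euler's identity $df \wedge \alpha = -\deg(f)\, f\, \theta$.

Generators: from $\sum_j F_j\, \theta(f_j) = \theta(f) = 0$ it follows that $f_j$ divides
$\theta(f_j)$, and then that $f_j$ divides $df_j \wedge \alpha$, so that $\alpha / f$ is a logarithmic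
form. The partial derivatives of $f_j$ have no common zero, hence their Koszul complex is exact and
$\alpha = r_j\, df_j + f_j \beta_j$; the class of $r_j$ modulo $f_j$ is the residue along $C_j$
(lemma \<open>residue\<close>). At a point of $C_i \cap C_j$ the covectors $r_i\, df_i$ and $r_j\, df_j$ agree
while $df_i$, $df_j$ are independent, so $r_j$ vanishes there and lies in the ideal $(f_i, f_j)$.
No three curves meet, hence $r_j$ is $g_j F_j$ modulo $f_j$. So $\alpha - \sum_j g_j F_j\, df_j$ is
divisible by every $f_j$ and therefore by $f$ (lemma \<open>log_form_decomposition\<close>). Wedging
$\alpha = \sum_j g_j F_j\, df_j + f \beta$ with $df$ and cancelling $f$ gives
$-\deg(f)\, \theta = \sum_j g_j \omega_j + df \wedge \beta$ (theorem \<open>omega_generate\<close>).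

Relations: if $\sum_{j<m} g_j \omega_j + df \wedge \beta = 0$, then
$\alpha = \sum_j g_j F_j\, df_j + f \beta$ (with $g_m = 0$) satisfies $df \wedge \alpha = 0$, and
Euler's identity makes it a multiple $s\, df$. Modulo $f_j$ this says that $f_j$ divides $g_j - s$.
The quotients $t_j$ are the coefficients of the given relation with respect to
$\rho_1, \dots, \rho_m$ (theorem \<open>omega_relations\<close>). The $\rho_j$ are independent because pairing
with $E$ turns $\sum_j t_j\, df_j = 0$ into $\sum_j e_j t_j f_j = 0$, where all $t_j f_j$ agree
(theorem \<open>rho_independent\<close>).

Commutative algebra: two facts replace the general theory of depth. If $F, G$ form a regular
pair, then $(F,G)$ has no component supported at the origin; with the projective Nullstellensatz
this says that $a \in (F,G)$ as soon as $h a \in (F,G)$ for all $h$ in a family of homogeneous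
polynomials without common zero (lemma \<open>saturated_wrt_no_common_zero\<close>). And two homogeneous
polynomials form a regular pair if together with some third form of positive degree they have no
common zero (theorem \<open>regular_pair_of_no_common_zero\<close>).

The resolution of the Jacobian algebra is obtained by splicing the resolution of $D_0(f)$ with the
map $S^3 \to S$ given by the partial derivatives of $f$, whose kernel is $D_0(f)$.\<close>

section \<open>Substitution into polynomials\<close>

abbreviation Const :: "complex \<Rightarrow> cpoly" where
  "Const c \<equiv> Poly_Mapping.single 0 c"

text \<open>A common form for evaluation at a point, setting a variable to zero, splitting into homogeneous
components, and the passage to iterated univariate polynomials: each is the ring homomorphism
determined by a homomorphism on the coefficients and the values of the variables.\<close>

definition subst :: "(complex \<Rightarrow> 'a::comm_ring_1) \<Rightarrow> (3 \<Rightarrow> 'a) \<Rightarrow> cpoly \<Rightarrow> 'a" where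
  "subst \<iota> v g = (\<Sum>\<mu>\<in>Poly_Mapping.keys g.
     \<iota> (Poly_Mapping.lookup g \<mu>) * (\<Prod>i\<in>UNIV. v i ^ Poly_Mapping.lookup \<mu> i))"

lemma peval_eq_subst: "peval g p = subst (\<lambda>c. c) (($) p) g"
  by (simp add: peval_def subst_def)

lemma cpoly_sum_singles:
  "(g::cpoly) = (\<Sum>\<mu>\<in>Poly_Mapping.keys g. Poly_Mapping.single \<mu> (Poly_Mapping.lookup g \<mu>))"
proof (rule poly_mapping_eqI)
  fix \<nu>
  have "Poly_Mapping.lookup (\<Sum>\<mu>\<in>Poly_Mapping.keys g. Poly_Mapping.single \<mu> (Poly_Mapping.lookup g \<mu>)) \<nu>
      = (\<Sum>\<mu>\<in>Poly_Mapping.keys g. if \<mu> = \<nu> then Poly_Mapping.lookup g \<mu> else 0)"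
    by (simp add: lookup_sum lookup_single when_def)
  also have "\<dots> = Poly_Mapping.lookup g \<nu>"
    by (auto simp: in_keys_iff)
  finally show "Poly_Mapping.lookup g \<nu>
      = Poly_Mapping.lookup (\<Sum>\<mu>\<in>Poly_Mapping.keys g. Poly_Mapping.single \<mu> (Poly_Mapping.lookup g \<mu>)) \<nu>" ..
qed

lemma cpoly_induct [case_names monomial add]:
  fixes g :: cpoly
  assumes m: "\<And>\<mu> c. P (Poly_Mapping.single \<mu> c)" and a: "\<And>g h. P g \<Longrightarrow> P h \<Longrightarrow> P (g + h)"
  shows "P g"
proof -
  have "P (\<Sum>\<mu>\<in>A. Poly_Mapping.single \<mu> (Poly_Mapping.lookup g \<mu>))" if "finite A" for A
    using that by (induction A) (auto intro: a m simp: m[of 0 0, simplified])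
  from this[of "Poly_Mapping.keys g"] show ?thesis
    using cpoly_sum_singles[of g] by simp
qed

locale coeff_hom =
  fixes \<iota> :: "complex \<Rightarrow> 'a::comm_ring_1"
  assumes hom_zero: "\<iota> 0 = 0" and hom_one: "\<iota> 1 = 1"
    and hom_add: "\<iota> (a + b) = \<iota> a + \<iota> b" and hom_mult: "\<iota> (a * b) = \<iota> a * \<iota> b"
begin

lemma subst_superset:
  assumes "finite A" "Poly_Mapping.keys g \<subseteq> A"
  shows "subst \<iota> v g = (\<Sum>\<mu>\<in>A. \<iota> (Poly_Mapping.lookup g \<mu>) * (\<Prod>i\<in>UNIV. v i ^ Poly_Mapping.lookup \<mu> i))"
  unfolding subst_def using assms
  by (intro sum.mono_neutral_left) (auto simp: in_keys_iff hom_zero)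

lemma subst_single [simp]:
  "subst \<iota> v (Poly_Mapping.single \<mu> c) = \<iota> c * (\<Prod>i\<in>UNIV. v i ^ Poly_Mapping.lookup \<mu> i)"
  by (subst subst_superset[of "{\<mu>}"]) auto

lemma subst_add [simp]: "subst \<iota> v (g + h) = subst \<iota> v g + subst \<iota> v h"
proof -
  let ?A = "Poly_Mapping.keys g \<union> Poly_Mapping.keys h"
  have "Poly_Mapping.keys (g + h) \<subseteq> ?A" by (rule Poly_Mapping.keys_add)
  then show ?thesis
    by (simp add: subst_superset[of ?A] lookup_add hom_add sum.distrib distrib_right)
qed

lemma subst_0 [simp]: "subst \<iota> v 0 = 0" by (simp add: subst_def)

lemma subst_1 [simp]: "subst \<iota> v 1 = 1"
proof -
  have "subst \<iota> v (Poly_Mapping.single 0 1) = 1"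
    by (simp only: subst_single) (simp add: hom_one)
  then show ?thesis by simp
qed

lemma subst_mult [simp]: "subst \<iota> v (g * h) = subst \<iota> v g * subst \<iota> v h"
proof (induction g rule: cpoly_induct)
  case (monomial \<mu> c)
  show ?case
    by (induction h rule: cpoly_induct)
       (auto simp: mult_single hom_mult lookup_add power_add prod.distrib algebra_simps)
qed (auto simp: algebra_simps)

lemma subst_uminus [simp]: "subst \<iota> v (- g) = - subst \<iota> v g"
  using subst_add[of v g "- g"] by (simp add: eq_neg_iff_add_eq_0 add.commute del: subst_add)

lemma subst_diff [simp]: "subst \<iota> v (g - h) = subst \<iota> v g - subst \<iota> v h"
  using subst_add[of v g "- h"] by (simp del: subst_add)

lemma subst_sum [simp]: "subst \<iota> v (\<Sum>x\<in>A. G x) = (\<Sum>x\<in>A. subst \<iota> v (G x))"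
  by (induction A rule: infinite_finite_induct) auto

lemma subst_var [simp]: "subst \<iota> v (var i) = v i"
proof -
  have "(\<Prod>j\<in>UNIV. v j ^ Poly_Mapping.lookup (Poly_Mapping.single i (1::nat)) j)
      = (\<Prod>j\<in>UNIV. if j = i then v i else 1)"
    by (intro prod.cong) (auto simp: lookup_single when_def)
  then show ?thesis by (simp add: var_def hom_one)
qed

lemma subst_Const [simp]: "subst \<iota> v (Const c) = \<iota> c"
  by simp

end

interpretation peval: coeff_hom "\<lambda>c. c"
  by standard auto

interpretation const: coeff_hom "Const"
  by standard (auto simp: single_add mult_single)

lemma single_eq_monomial:
  "Poly_Mapping.single \<mu> c = Const c * (\<Prod>i\<in>UNIV. var i ^ Poly_Mapping.lookup \<mu> i)"
proof -
  have p: "var i ^ n = Poly_Mapping.single (Poly_Mapping.single i n) 1" for i n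
    by (induction n) (auto simp: var_def mult_single simp flip: single_add)
  have "(\<Prod>i\<in>A. Poly_Mapping.single (\<nu> i) 1) = (Poly_Mapping.single (\<Sum>i\<in>A. \<nu> i) 1 :: cpoly)"
    for A :: "3 set" and \<nu>
    by (induction A rule: infinite_finite_induct) (auto simp: mult_single)
  moreover have "(\<Sum>i\<in>UNIV. Poly_Mapping.single i (Poly_Mapping.lookup \<mu> i)) = \<mu>"
    by (rule poly_mapping_eqI) (simp add: lookup_sum lookup_single when_def)
  ultimately show ?thesis by (simp add: p mult_single)
qed

lemma cpoly_ring_induct [case_names Const var add mult]:
  fixes g :: cpoly
  assumes C: "\<And>c. P (Const c)" and v: "\<And>i. P (var i)"
    and a: "\<And>g h. P g \<Longrightarrow> P h \<Longrightarrow> P (g + h)" and m: "\<And>g h. P g \<Longrightarrow> P h \<Longrightarrow> P (g * h)"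
  shows "P g"
proof (induction g rule: cpoly_induct)
  case (monomial \<mu> c)
  have 1: "P 1" using C[of 1] by simp
  have p: "P (var i ^ n)" for i n by (induction n) (auto intro: m v 1)
  have "P (\<Prod>i\<in>A. var i ^ Poly_Mapping.lookup \<mu> i)" for A
    by (induction A rule: infinite_finite_induct) (auto intro: m p 1)
  then show ?case by (subst single_eq_monomial) (intro m C)
qed (rule a)

section \<open>Partial derivatives\<close>

lemma pdiff_superset:
  assumes "finite A" "Poly_Mapping.keys g \<subseteq> A"
  shows "pdiff i g = (\<Sum>\<mu>\<in>A.
     Poly_Mapping.single (\<mu> - Poly_Mapping.single i 1)
       (of_nat (Poly_Mapping.lookup \<mu> i) * Poly_Mapping.lookup g \<mu>))"
  unfolding pdiff_def using assms
  by (intro sum.mono_neutral_left) (auto simp: in_keys_iff)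

lemma pdiff_single: "pdiff i (Poly_Mapping.single \<mu> c) =
    Poly_Mapping.single (\<mu> - Poly_Mapping.single i 1) (of_nat (Poly_Mapping.lookup \<mu> i) * c)"
  by (subst pdiff_superset[of "{\<mu>}"]) auto

lemma pdiff_add [simp]: "pdiff i (g + h) = pdiff i g + pdiff i h"
proof -
  let ?A = "Poly_Mapping.keys g \<union> Poly_Mapping.keys h"
  have "Poly_Mapping.keys (g + h) \<subseteq> ?A" by (rule Poly_Mapping.keys_add)
  then show ?thesis
    by (simp add: pdiff_superset[of ?A] lookup_add sum.distrib single_add distrib_left)
qed

lemma pdiff_mult: "pdiff i (g * h) = pdiff i g * h + g * pdiff i h"
proof (induction g rule: cpoly_induct)
  case (monomial \<mu> c)
  show ?case
  proof (induction h rule: cpoly_induct)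
    case (monomial \<nu> b)
    let ?e = "Poly_Mapping.single i (Suc 0)"
    have e: "\<mu> + \<nu> - ?e = (\<mu> - ?e) + \<nu>" if "Poly_Mapping.lookup \<mu> i > 0" for \<mu> \<nu> :: "3 \<Rightarrow>\<^sub>0 nat"
      using that by (intro poly_mapping_eqI) (auto simp: lookup_add lookup_minus lookup_single when_def)
    have 1: "Poly_Mapping.single (\<mu> + \<nu> - ?e) (of_nat (Poly_Mapping.lookup \<mu> i) * (c * b))
        = Poly_Mapping.single (\<mu> - ?e + \<nu>) (of_nat (Poly_Mapping.lookup \<mu> i) * (c * b))"
      by (cases "Poly_Mapping.lookup \<mu> i = 0") (auto simp: e)
    have 2: "Poly_Mapping.single (\<mu> + \<nu> - ?e) (of_nat (Poly_Mapping.lookup \<nu> i) * (c * b))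
        = Poly_Mapping.single (\<mu> + (\<nu> - ?e)) (of_nat (Poly_Mapping.lookup \<nu> i) * (c * b))"
      using e[of \<nu> \<mu>] by (cases "Poly_Mapping.lookup \<nu> i = 0") (auto simp: add.commute)
    show ?case
      using 1 2 by (simp add: pdiff_single mult_single lookup_add distrib_right distrib_left single_add mult.assoc mult.left_commute)
  qed (auto simp: algebra_simps)
qed (auto simp: algebra_simps)

lemma pdiff_Const [simp]: "pdiff i (Const c) = 0"
  by (simp add: pdiff_single)

lemma pdiff_0 [simp]: "pdiff i 0 = 0" and pdiff_1 [simp]: "pdiff i 1 = 0"
  using pdiff_Const[of i 0] pdiff_Const[of i 1] by simp_all

lemma pdiff_var: "pdiff i (var j) = (if i = j then 1 else 0)"
  by (auto simp: var_def pdiff_single lookup_single)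

text \<open>The logarithmic derivative of a product with the denominators cleared.\<close>

lemma pdiff_prod:
  assumes "finite A"
  shows "pdiff i (\<Prod>j\<in>A. g j) = (\<Sum>j\<in>A. (\<Prod>k\<in>A - {j}. g k) * pdiff i (g j))"
  using assms
proof (induction A)
  case (insert a A)
  have "(\<Prod>k\<in>insert a A - {j}. g k) = g a * (\<Prod>k\<in>A - {j}. g k)" if "j \<in> A" for j
  proof -
    have "insert a A - {j} = insert a (A - {j})" using insert that by auto
    then show ?thesis using insert by simp
  qed
  moreover have "insert a A - {a} = A" using insert by auto
  ultimately show ?case
    using insert by (simp add: pdiff_mult sum_distrib_left mult_ac)
qed simp

section \<open>Homogeneous polynomials and the Euler identity\<close>

abbreviation mdeg :: "(3 \<Rightarrow>\<^sub>0 nat) \<Rightarrow> nat" where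
  "mdeg \<mu> \<equiv> (\<Sum>i\<in>UNIV. Poly_Mapping.lookup \<mu> i)"

lemma homogeneous_0 [simp]: "homogeneous k 0"
  by (simp add: homogeneous_def)

lemma homogeneous_single: "int (mdeg \<mu>) = k \<Longrightarrow> homogeneous k (Poly_Mapping.single \<mu> c)"
  by (simp add: homogeneous_def)

lemma homogeneous_Const [simp]: "homogeneous 0 (Const c)"
  by (rule homogeneous_single) simp

lemma homogeneous_1 [simp]: "homogeneous 0 1"
  using homogeneous_Const[of 1] by simp

lemma homogeneous_add: "homogeneous k g \<Longrightarrow> homogeneous k h \<Longrightarrow> homogeneous k (g + h)"
  using Poly_Mapping.keys_add[of g h] by (fastforce simp: homogeneous_def)

lemma homogeneous_uminus: "homogeneous k g \<Longrightarrow> homogeneous k (- g)"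
  by (simp add: homogeneous_def)

lemma homogeneous_diff: "homogeneous k g \<Longrightarrow> homogeneous k h \<Longrightarrow> homogeneous k (g - h)"
  using homogeneous_add[of k g "- h"] by (simp add: homogeneous_uminus)

lemma homogeneous_sum: "(\<And>x. x \<in> A \<Longrightarrow> homogeneous k (g x)) \<Longrightarrow> homogeneous k (\<Sum>x\<in>A. g x)"
  by (induction A rule: infinite_finite_induct) (auto intro: homogeneous_add)

lemma homogeneous_mult: "homogeneous k g \<Longrightarrow> homogeneous l h \<Longrightarrow> homogeneous (k + l) (g * h)"
  using keys_mult[of g h] by (fastforce simp: homogeneous_def lookup_add sum.distrib)

lemma homogeneous_prod:
  "(\<And>x. x \<in> A \<Longrightarrow> homogeneous (k x) (g x)) \<Longrightarrow> homogeneous (\<Sum>x\<in>A. k x) (\<Prod>x\<in>A. g x)"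
  by (induction A rule: infinite_finite_induct) (auto intro: homogeneous_mult)

lemma homogeneous_pdiff:
  assumes "homogeneous k g" shows "homogeneous (k - 1) (pdiff i g)"
  unfolding pdiff_def
proof (rule homogeneous_sum)
  fix \<mu> assume mu: "\<mu> \<in> Poly_Mapping.keys g"
  show "homogeneous (k - 1) (Poly_Mapping.single (\<mu> - Poly_Mapping.single i 1)
       (of_nat (Poly_Mapping.lookup \<mu> i) * Poly_Mapping.lookup g \<mu>))"
  proof (cases "Poly_Mapping.lookup \<mu> i = 0")
    case False
    have "int (mdeg (\<mu> - Poly_Mapping.single i 1))
        = (\<Sum>j\<in>UNIV. int (Poly_Mapping.lookup \<mu> j) - (if j = i then 1 else 0))"
      using False by (auto simp: lookup_minus lookup_single when_def intro!: sum.cong)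
    also have "\<dots> = k - 1"
      using assms mu by (auto simp: homogeneous_def sum_subtractf)
    finally show ?thesis by (rule homogeneous_single)
  qed simp
qed

theorem Euler_identity:
  assumes "homogeneous k g"
  shows "(\<Sum>i\<in>UNIV. var i * pdiff i g) = of_int k * g"
proof -
  have *: "var i * Poly_Mapping.single (\<mu> - Poly_Mapping.single i (Suc 0)) (of_nat (Poly_Mapping.lookup \<mu> i) * c)
      = Poly_Mapping.single \<mu> (of_nat (Poly_Mapping.lookup \<mu> i) * c)" for i \<mu> c
  proof (cases "Poly_Mapping.lookup \<mu> i = 0")
    case False
    then have "Poly_Mapping.single i (Suc 0) + (\<mu> - Poly_Mapping.single i (Suc 0)) = \<mu>"
      by (intro poly_mapping_eqI) (auto simp: lookup_add lookup_minus lookup_single when_def)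
    then show ?thesis by (simp add: var_def mult_single)
  qed simp
  have "(\<Sum>i\<in>UNIV. var i * pdiff i g) =
      (\<Sum>i\<in>UNIV. \<Sum>\<mu>\<in>Poly_Mapping.keys g. Poly_Mapping.single \<mu> (of_nat (Poly_Mapping.lookup \<mu> i) * Poly_Mapping.lookup g \<mu>))"
    by (simp add: pdiff_def sum_distrib_left *)
  also have "\<dots> = (\<Sum>\<mu>\<in>Poly_Mapping.keys g. \<Sum>i\<in>UNIV. Poly_Mapping.single \<mu> (of_nat (Poly_Mapping.lookup \<mu> i) * Poly_Mapping.lookup g \<mu>))"
    by (rule sum.swap)
  also have "\<dots> = (\<Sum>\<mu>\<in>Poly_Mapping.keys g. Const (of_int k) * Poly_Mapping.single \<mu> (Poly_Mapping.lookup g \<mu>))"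
  proof (rule sum.cong[OF refl])
    fix \<mu> assume "\<mu> \<in> Poly_Mapping.keys g"
    then have k: "k = int (mdeg \<mu>)" using assms by (simp add: homogeneous_def)
    have "(\<Sum>i\<in>UNIV. Poly_Mapping.single \<mu> (of_nat (Poly_Mapping.lookup \<mu> i) * Poly_Mapping.lookup g \<mu>))
        = Poly_Mapping.single \<mu> (of_int k * Poly_Mapping.lookup g \<mu>)"
      by (simp add: k sum_3 distrib_right flip: single_add)
    also have "\<dots> = Const (of_int k) * Poly_Mapping.single \<mu> (Poly_Mapping.lookup g \<mu>)"
      by (simp only: mult_single) simp
    finally show "(\<Sum>i\<in>UNIV. Poly_Mapping.single \<mu> (of_nat (Poly_Mapping.lookup \<mu> i) * Poly_Mapping.lookup g \<mu>))
        = Const (of_int k) * Poly_Mapping.single \<mu> (Poly_Mapping.lookup g \<mu>)" .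
  qed
  also have "\<dots> = of_int k * g"
    by (subst (3) cpoly_sum_singles) (simp add: sum_distrib_left)
  finally show ?thesis .
qed

text \<open>Ideals of $S$ are the \<open>pideal.subspace\<close>s, and \<open>pideal.span X\<close> is the ideal generated by \<open>X\<close>.\<close>

interpretation pideal: Modules.module "(*) :: cpoly \<Rightarrow> cpoly \<Rightarrow> cpoly"
  by standard (auto simp: algebra_simps)

(* As a simplification rule it would undo the associativity of multiplication. *)
declare pideal.scale_scale [simp del]

section \<open>Koszul relations in two and three elements\<close>

text \<open>Exactness of the Koszul complex of $F, G$ in the middle: all syzygies of the pair are multiples of
$(G, F)$. Over $S$ this means that $F$ and $G$ are coprime, and it is symmetric in the two entries.\<close>

definition regular_pair :: "cpoly \<Rightarrow> cpoly \<Rightarrow> bool" where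
  "regular_pair F G \<longleftrightarrow> (\<forall>a b. F * a = G * b \<longrightarrow> (\<exists>c. a = G * c \<and> b = F * c))"

lemma regular_pairD: "regular_pair F G \<Longrightarrow> F * a = G * b \<Longrightarrow> \<exists>c. a = G * c \<and> b = F * c"
  by (simp add: regular_pair_def)

lemma regular_pair_sym: "regular_pair F G \<Longrightarrow> regular_pair G F"
  unfolding regular_pair_def by metis

lemma regular_pair_nonzero: "regular_pair F G \<Longrightarrow> F \<noteq> 0 \<or> G \<noteq> 0"
  unfolding regular_pair_def by (elim allE[of _ 1]) auto

lemma span_pair: "a \<in> pideal.span {F, G} \<longleftrightarrow> (\<exists>A B. a = A * F + B * G)"
proof
  assume "a \<in> pideal.span {F, G}"
  then obtain A B where "a - A * F = B * G"
    by (auto simp: pideal.span_insert[of F] pideal.span_singleton)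
  then have "a = A * F + B * G" by (simp add: algebra_simps)
  then show "\<exists>A B. a = A * F + B * G" by blast
qed (auto intro: pideal.span_add pideal.span_scale pideal.span_base)

text \<open>If $p, q$ is a regular pair and $r$ is a nonzerodivisor modulo $(p,q)$, all syzygies of $(p,q,r)$ are
Koszul syzygies. The hypothesis on $r$ expresses $c$ through $p$ and $q$, and what remains is a
syzygy of $p, q$.\<close>

lemma koszul_exact:
  assumes pq: "regular_pair p q" and r: "\<And>c. r * c \<in> pideal.span {p, q} \<Longrightarrow> c \<in> pideal.span {p, q}"
    and 0: "p * a + q * b + r * c = 0"
  shows "\<exists>u v w. a = q * w - r * v \<and> b = r * u - p * w \<and> c = p * v - q * u"
proof -
  have "r * c = (- a) * p + (- b) * q" using 0 by (simp add: algebra_simps eq_neg_iff_add_eq_0)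
  then have "c \<in> pideal.span {p, q}" using span_pair[of "r * c" p q] r by blast
  then obtain v u where c: "c = v * p + u * q" by (auto simp: span_pair)
  have "p * (a + r * v) = q * (- b - r * u)"
    using 0 by (simp add: c algebra_simps eq_neg_iff_add_eq_0)
  then obtain w where w: "a + r * v = q * w" "- b - r * u = p * w"
    using regular_pairD[OF pq] by blast
  have "a = q * w - r * v" using w(1) by (simp add: eq_diff_eq)
  moreover have "b = r * (- u) - p * w" by (simp flip: w(2))
  moreover have "c = p * v - q * (- u)" by (simp add: c algebra_simps)
  ultimately show ?thesis by blast
qed

text \<open>The representative without $x_i$ of the residue class modulo $x_i$.\<close>

definition set_zero :: "3 \<Rightarrow> cpoly \<Rightarrow> cpoly" where
  "set_zero i = subst Const (\<lambda>j. if j = i then 0 else var j)"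

lemma set_zero_hom:
  "set_zero i (g + h) = set_zero i g + set_zero i h" "set_zero i (g * h)
      = set_zero i g * set_zero i h"
  "set_zero i (var j) = (if j = i then 0 else var j)" "set_zero i (Const c) = Const c" "set_zero i 0
      = 0"
  by (simp_all add: set_zero_def del: const.subst_single)

lemma var_dvd_diff_set_zero: "var i dvd g - set_zero i g"
proof (induction g rule: cpoly_ring_induct)
  case (add g h)
  then show ?case using dvd_add[OF add] by (simp add: set_zero_hom algebra_simps)
next
  case (mult g h)
  have "g * h - set_zero i (g * h) = (g - set_zero i g) * h + set_zero i g * (h - set_zero i h)"
    by (simp add: set_zero_hom algebra_simps)
  then show ?case using mult by simp
qed (auto simp: set_zero_hom)

lemma var_nonzero [simp]: "var i \<noteq> 0"
proof
  assume "var i = 0"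
  then have "Poly_Mapping.lookup (var i) (Poly_Mapping.single i 1) = 0" by simp
  then show False by (simp add: var_def)
qed

lemma regular_pair_var:
  assumes "i \<noteq> j" shows "regular_pair (var i) (var j)"
  unfolding regular_pair_def
proof (intro allI impI)
  fix a b assume ab: "var i * a = var j * b"
  have "var j * set_zero i b = 0"
    using arg_cong[OF ab, of "set_zero i"] assms by (simp add: set_zero_hom)
  then have "set_zero i b = 0" by simp
  with var_dvd_diff_set_zero[of i b] obtain c where c: "b = var i * c" by (auto elim: dvdE)
  with ab have "var i * a = var i * (var j * c)" by (simp add: mult_ac)
  then show "\<exists>c. a = var j * c \<and> b = var i * c" using c by auto
qed

lemma koszul_var:
  assumes "var 1 * a + var 2 * b + var 3 * c = 0"
  shows "\<exists>u v w. a = var 2 * w - var 3 * v \<and> b = var 3 * u - var 1 * w \<and> c = var 1 * v - var 2 * u"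
proof (rule koszul_exact[OF regular_pair_var _ assms])
  fix c assume "var 3 * c \<in> pideal.span {var 1, var 2}"
  then obtain A B where AB: "var 3 * c = A * var 1 + B * var 2" by (auto simp: span_pair)
  have "var 3 * set_zero 2 (set_zero 1 c) = 0"
    using arg_cong[OF AB, of "\<lambda>g. set_zero 2 (set_zero 1 g)"] by (simp add: set_zero_hom)
  then have "set_zero 2 (set_zero 1 c) = 0" by simp
  moreover obtain s where "c - set_zero 1 c = var 1 * s"
    using var_dvd_diff_set_zero[of 1 c] by (auto elim: dvdE)
  moreover obtain t where "set_zero 1 c - set_zero 2 (set_zero 1 c) = var 2 * t"
    using var_dvd_diff_set_zero[of 2 "set_zero 1 c"] by (auto elim: dvdE)
  ultimately have "c = s * var 1 + t * var 2" by (simp add: algebra_simps)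
  then show "c \<in> pideal.span {var 1, var 2}" by (auto simp: span_pair)
qed auto

section \<open>Ideals generated by a regular pair have no component at the origin\<close>

text \<open>The step from the maximal ideal $(x,y,z)$ to 1. Write $x_i a = A_i F + B_i G$. Cross multiplication
yields syzygies of $F, G$, so $E \times A = -G c$ and $E \times B = F c$ for one vector $c$. Since
$E \cdot c = 0$, the Koszul complex of $x, y, z$ gives $c = E \times \gamma$. Then $A + G \gamma$ and
$B - F \gamma$ are parallel to $E$, and the factors of proportionality are coefficients that express
$a$ through $F$ and $G$.\<close>

lemma regular_pair_saturated_step:
  assumes FG: "regular_pair F G" and a: "\<And>i. var i * a \<in> pideal.span {F, G}"
  shows "a \<in> pideal.span {F, G}"
proof -
  from a[unfolded span_pair] obtain A B where AB: "\<And>i. var i * a = A i * F + B i * G"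
    by metis
  have *: "\<exists>c. var j * A i - var i * A j = G * c \<and> var i * B j - var j * B i = F * c" for i j
  proof (rule regular_pairD[OF FG])
    have "var j * (A i * F + B i * G) = var i * (A j * F + B j * G)"
      by (simp only: AB[symmetric] mult.left_commute)
    then show "F * (var j * A i - var i * A j) = G * (var i * B j - var j * B i)"
      by (simp add: algebra_simps)
  qed
  obtain c1 where c1: "var 3 * A 2 - var 2 * A 3 = G * c1" "var 2 * B 3 - var 3 * B 2 = F * c1"
    using *[of 3 2] by blast
  obtain c2 where c2: "var 1 * A 3 - var 3 * A 1 = G * c2" "var 3 * B 1 - var 1 * B 3 = F * c2"
    using *[of 1 3] by blast
  obtain c3 where c3: "var 2 * A 1 - var 1 * A 2 = G * c3" "var 1 * B 2 - var 2 * B 1 = F * c3"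
    using *[of 2 1] by blast
  have G0: "G * (var 1 * c1 + var 2 * c2 + var 3 * c3) = 0"
  proof -
    have "G * (var 1 * c1 + var 2 * c2 + var 3 * c3)
        = var 1 * (G * c1) + var 2 * (G * c2) + var 3 * (G * c3)"
      by (simp add: algebra_simps)
    also have "\<dots> = 0" by (simp flip: c1 c2 c3 add: algebra_simps)
    finally show ?thesis .
  qed
  have F0: "F * (var 1 * c1 + var 2 * c2 + var 3 * c3) = 0"
  proof -
    have "F * (var 1 * c1 + var 2 * c2 + var 3 * c3)
        = var 1 * (F * c1) + var 2 * (F * c2) + var 3 * (F * c3)"
      by (simp add: algebra_simps)
    also have "\<dots> = 0" by (simp flip: c1 c2 c3 add: algebra_simps)
    finally show ?thesis .
  qed
  have "var 1 * c1 + var 2 * c2 + var 3 * c3 = 0"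
    using F0 G0 regular_pair_nonzero[OF FG] by auto
  from koszul_var[OF this] obtain u v w where
    c: "c1 = var 2 * w - var 3 * v" "c2 = var 3 * u - var 1 * w" "c3 = var 1 * v - var 2 * u"
      by blast
  have "var 1 * (A 2 + G * v) = var 2 * (A 1 + G * u)"
    using c3(1) by (simp add: c algebra_simps)
  then obtain s where s: "A 2 + G * v = var 2 * s" "A 1 + G * u = var 1 * s"
    using regular_pairD[OF regular_pair_var[of 1 2]] by auto
  have "var 1 * (B 2 - F * v) = var 2 * (B 1 - F * u)"
    using c3(2) by (simp add: c algebra_simps)
  then obtain t where t: "B 2 - F * v = var 2 * t" "B 1 - F * u = var 1 * t"
    using regular_pairD[OF regular_pair_var[of 1 2]] by auto
  have "var 1 * a = (A 1 + G * u) * F + (B 1 - F * u) * G"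
    by (subst AB) (simp add: algebra_simps)
  also have "\<dots> = var 1 * (s * F + t * G)" by (simp add: s t algebra_simps)
  finally have "a = s * F + t * G" by simp
  then show ?thesis by (auto simp: span_pair)
qed

text \<open>Powers of the variables are stripped off one at a time: if $x_i^n a$ is in the ideal, then the
statement for smaller exponents applies to $x_i a$.\<close>

lemma regular_pair_saturated:
  assumes FG: "regular_pair F G" and a: "\<And>i. var i ^ N i * a \<in> pideal.span {F, G}"
  shows "a \<in> pideal.span {F, G}"
  using a
proof (induction "\<Sum>i\<in>UNIV. N i" arbitrary: N a rule: less_induct)
  case less
  show ?case
  proof (cases "\<exists>i. N i = 0")
    case True
    then obtain i where "N i = 0" by blast
    then show ?thesis using less.prems[of i] by simp
  next
    case False
    have "var i * a \<in> pideal.span {F, G}" for i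
    proof (rule less.hyps)
      show "sum (N(i := N i - 1)) UNIV < sum N UNIV"
        using False by (intro sum_strict_mono_ex1) (auto intro!: exI[of _ i])
      fix j
      show "var j ^ (N(i := N i - 1)) j * (var i * a) \<in> pideal.span {F, G}"
      proof (cases "j = i")
        case True
        have "var i ^ (N i - 1) * (var i * a) = var i ^ Suc (N i - 1) * a"
          by (simp only: power_Suc2 mult.assoc)
        also have "\<dots> = var i ^ N i * a" using \<open>\<nexists>i. N i = 0\<close> by simp
        finally have "var i ^ (N i - 1) * (var i * a) = var i ^ N i * a" .
        then show ?thesis using True less.prems[of i] by (simp only: fun_upd_same)
      next
        case False
        then show ?thesis using pideal.span_scale[OF less.prems[of j], of "var i"]
          by (simp add: mult_ac)
      qed
    qed
    then show ?thesis by (rule regular_pair_saturated_step[OF FG])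
  qed
qed

section \<open>Homogeneous components\<close>

text \<open>The image of $g$ under $x_i \mapsto x_i t$; the coefficient of $t^n$ is the component of degree $n$.
In this form the components of a product come from multiplication in \<open>cpoly poly\<close>, which is an
integral domain.\<close>

definition homogeneous_parts :: "cpoly \<Rightarrow> cpoly poly" where
  "homogeneous_parts = subst (\<lambda>c. [:Const c:]) (\<lambda>i. monom (var i) 1)"

interpretation homogeneous_parts: coeff_hom "\<lambda>c. [:Const c:] :: cpoly poly"
  by standard (auto simp: single_add const.hom_mult simp del: const.subst_single)

lemma homogeneous_parts_hom: "homogeneous_parts (g + h) = homogeneous_parts g + homogeneous_parts h"
  "homogeneous_parts (g - h) = homogeneous_parts g - homogeneous_parts h" "homogeneous_parts (g * h)
      = homogeneous_parts g * homogeneous_parts h"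
  "homogeneous_parts (var i) = monom (var i) 1" "homogeneous_parts (Const c)
      = [:Const c:]" "homogeneous_parts 0 = 0" "homogeneous_parts 1 = 1"
  "homogeneous_parts (\<Sum>x\<in>A. G x) = (\<Sum>x\<in>A. homogeneous_parts (G x))"
  by (simp_all add: homogeneous_parts_def del: homogeneous_parts.subst_single)

lemma homogeneous_parts_single:
  "homogeneous_parts (Poly_Mapping.single \<mu> c) = monom (Poly_Mapping.single \<mu> c) (mdeg \<mu>)"
proof -
  have p: "monom (var i) 1 ^ n = monom (var i ^ n) n" for i n
    by (induction n) (auto simp: mult_monom monom_eq_1 one_pCons)
  have q: "(\<Prod>i\<in>A. monom (g i) (n i)) = monom (\<Prod>i\<in>A. g i) (\<Sum>i\<in>A. n i)"
    for A :: "3 set" and g :: "3 \<Rightarrow> cpoly" and n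
    by (induction A rule: infinite_finite_induct) (auto simp: mult_monom monom_eq_1 one_pCons)
  have "homogeneous_parts (Poly_Mapping.single \<mu> c)
      = [:Const c:] * monom (\<Prod>i\<in>UNIV. var i ^ Poly_Mapping.lookup \<mu> i) (mdeg \<mu>)"
    by (simp add: homogeneous_parts_def p[simplified] q)
  also have "\<dots> = monom (Const c * (\<Prod>i\<in>UNIV. var i ^ Poly_Mapping.lookup \<mu> i)) (mdeg \<mu>)"
    by (simp add: smult_monom)
  finally show ?thesis by (simp flip: single_eq_monomial)
qed

lemma homogeneous_parts_homogeneous:
  assumes "homogeneous (int k) g" shows "homogeneous_parts g = monom g k"
proof -
  have "homogeneous_parts g
      = (\<Sum>\<mu>\<in>Poly_Mapping.keys g. monom (Poly_Mapping.single \<mu> (Poly_Mapping.lookup g \<mu>)) (mdeg \<mu>))"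
    by (subst cpoly_sum_singles) (simp add: homogeneous_parts_hom homogeneous_parts_single)
  also have "\<dots> = (\<Sum>\<mu>\<in>Poly_Mapping.keys g. monom (Poly_Mapping.single \<mu> (Poly_Mapping.lookup g \<mu>)) k)"
    using assms by (intro sum.cong) (auto simp: homogeneous_def simp del: of_nat_sum)
  also have "\<dots> = monom (\<Sum>\<mu>\<in>Poly_Mapping.keys g. (Poly_Mapping.single \<mu> (Poly_Mapping.lookup g \<mu>))) k"
    by (simp add: poly_eq_iff coeff_sum)
  finally show ?thesis using cpoly_sum_singles[of g] by simp
qed

lemma homogeneous_cases:
  assumes "homogeneous k g" shows "g = 0 \<or> (\<exists>n. k = int n)"
proof (cases "Poly_Mapping.keys g = {}")
  case False
  then obtain \<mu> where "\<mu> \<in> Poly_Mapping.keys g" by blast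
  then have "k = int (mdeg \<mu>)" using assms by (simp add: homogeneous_def)
  then show ?thesis by blast
qed simp

text \<open>The elements all of whose components lie in the ideal form an ideal that contains the homogeneous
generators.\<close>

lemma homogeneous_parts_in_span:
  assumes H: "\<And>h. h \<in> H \<Longrightarrow> \<exists>k. homogeneous k h" and g: "g \<in> pideal.span H"
  shows "coeff (homogeneous_parts g) n \<in> pideal.span H"
proof -
  let ?T = "{g. \<forall>n. coeff (homogeneous_parts g) n \<in> pideal.span H}"
  have "pideal.subspace ?T"
    by (rule pideal.subspaceI)
       (auto simp: homogeneous_parts_hom coeff_mult intro!: pideal.span_zero pideal.span_add pideal.span_sum pideal.span_scale)
  moreover have "H \<subseteq> ?T"
  proof
    fix h assume h: "h \<in> H"
    with H obtain k where k: "homogeneous k h" by blast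
    from homogeneous_cases[OF k] show "h \<in> ?T"
    proof
      assume "\<exists>n. k = int n"
      with k have "\<exists>n. homogeneous_parts h = monom h n" using homogeneous_parts_homogeneous by blast
      with h show ?thesis by (auto intro: pideal.span_base pideal.span_zero)
    qed (auto simp: homogeneous_parts_hom pideal.span_zero)
  qed
  ultimately have "pideal.span H \<subseteq> ?T" by (rule pideal.span_minimal[rotated])
  with g show ?thesis by auto
qed

section \<open>The projective Nullstellensatz\<close>

text \<open>Maximality is stated as invertibility modulo \<open>M\<close>, which is the form in which it is used.\<close>

locale maximal_ideal_of_polynomials =
  fixes M :: "cpoly set"
  assumes subspace_M: "pideal.subspace M" and one_notin: "1 \<notin> M"
    and invertible: "\<And>a. a \<notin> M \<Longrightarrow> \<exists>b. a * b - 1 \<in> M"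
begin

lemma M_mult: "a \<in> M \<Longrightarrow> b * a \<in> M"
  by (rule pideal.subspace_scale[OF subspace_M])

lemma M_mult_cancel:
  assumes a: "a \<notin> M" and ab: "a * b \<in> M" shows "b \<in> M"
proof -
  obtain c where c: "a * c - 1 \<in> M" using invertible[OF a] by blast
  have "c * (a * b) - b * (a * c - 1) \<in> M"
    by (intro pideal.subspace_diff[OF subspace_M] M_mult c ab)
  then show ?thesis by (simp add: algebra_simps)
qed

lemma Const_in_M: "Const c \<in> M \<Longrightarrow> c = 0"
proof (rule ccontr)
  assume "Const c \<in> M" "c \<noteq> 0"
  then have "Const (1 / c) * Const c \<in> M" by (intro M_mult)
  then show False using \<open>c \<noteq> 0\<close> one_notin by (simp add: mult_single)
qed

definition at_var :: "3 \<Rightarrow> complex poly \<Rightarrow> cpoly" where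
  "at_var i p = poly (map_poly (\<lambda>c. Const c) p) (var i)"

lemma at_var_simps: "at_var i (pCons a p) = Const a + var i * at_var i p" "at_var i 0 = 0"
  by (simp_all add: at_var_def map_poly_pCons)

lemma at_var_add: "at_var i (p + q) = at_var i p + at_var i q"
proof -
  have "map_poly (\<lambda>c. Const c) (p + q) = map_poly (\<lambda>c. Const c) p + map_poly (\<lambda>c. Const c) q"
    by (rule poly_eqI) (simp add: coeff_map_poly single_add)
  then show ?thesis by (simp add: at_var_def)
qed

lemma at_var_smult: "at_var i (Polynomial.smult a p) = Const a * at_var i p"
proof -
  have "map_poly (\<lambda>c. Const c) (Polynomial.smult a p)
      = Polynomial.smult (Const a) (map_poly (\<lambda>c. Const c) p)"
    by (rule poly_eqI) (simp add: coeff_map_poly mult_single)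
  then show ?thesis by (simp add: at_var_def)
qed

lemma at_var_mult: "at_var i (p * q) = at_var i p * at_var i q"
  by (induction p) (auto simp: at_var_simps at_var_add at_var_smult mult_pCons_left algebra_simps)

lemma at_var_sum: "at_var i (\<Sum>x\<in>A. p x) = (\<Sum>x\<in>A. at_var i (p x))"
  by (induction A rule: infinite_finite_induct) (auto simp: at_var_add at_var_simps)

lemma at_var_1: "at_var i 1 = 1"
  by (simp add: one_pCons at_var_simps)

lemma at_var_prod: "at_var i (\<Prod>x\<in>A. p x) = (\<Prod>x\<in>A. at_var i (p x))"
  by (induction A rule: infinite_finite_induct) (auto simp: at_var_mult at_var_1)

text \<open>If $x_i - c$ is outside the maximal ideal for all $c$, then the same is true of every nonzero
polynomial in $x_i$ alone, because it is a product of such factors by the fundamental theorem of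
algebra.\<close>

lemma at_var_notin:
  assumes "\<And>c. var i - Const c \<notin> M" and "p \<noteq> 0"
  shows "at_var i p \<notin> M"
  using assms(2)
proof (induction "degree p" arbitrary: p)
  case 0
  then obtain c where "p = [:c:]" using degree_eq_zeroE[of p] by metis
  then show ?case using 0 Const_in_M[of c] by (auto simp: at_var_simps)
next
  case (Suc n)
  have "\<not> constant (poly p)" using Suc.hyps by (simp add: constant_degree)
  then obtain c where "poly p c = 0" using fundamental_theorem_of_algebra by blast
  then obtain q where q: "p = [:- c, 1:] * q" by (auto simp: poly_eq_0_iff_dvd elim: dvdE)
  with Suc.prems have "q \<noteq> 0" by auto
  then have "degree p = Suc (degree q)"
    unfolding q by (subst degree_mult_eq) auto
  then have "at_var i q \<notin> M" using Suc.hyps \<open>q \<noteq> 0\<close> by simp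
  moreover have "at_var i p = (var i - Const c) * at_var i q"
    by (simp only: q at_var_mult) (simp add: at_var_simps single_uminus)
  ultimately show ?case using M_mult_cancel[OF assms(1)[of c], of "at_var i q"] by auto
qed

text \<open>This is the place where an uncountable field is used. If no $x_i - c$ lies in \<open>M\<close>, each has an
inverse $b_c$ modulo \<open>M\<close>, and these inverses are distinct. There are uncountably many of them,
but the space of polynomials is the countable union of the spaces of polynomials of bounded degree,
so infinitely many of them lie in one space of finite dimension and are linearly dependent. Clearing
denominators in the relation $\sum_c a_c / (x_i - c) = 0$ gives a nonzero polynomial in $x_i$ that
lies in \<open>M\<close>.\<close>

lemma linear_form_in_M: "\<exists>c. var i - Const c \<in> M"
proof (rule ccontr)
  assume "\<nexists>c. var i - Const c \<in> M"
  then have notin: "var i - Const c \<notin> M" for c by blast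
  then have "\<forall>c. \<exists>b. (var i - Const c) * b - 1 \<in> M" using invertible by blast
  then obtain b where b: "\<And>c. (var i - Const c) * b c - 1 \<in> M" by metis
  have "inj b"
  proof (rule injI)
    fix c c' assume eq: "b c = b c'"
    have "((var i - Const c) * b c - 1) - ((var i - Const c') * b c' - 1) \<in> M"
      by (intro pideal.subspace_diff[OF subspace_M] b)
    then have "Const (c' - c) * b c \<in> M"
      by (simp add: eq algebra_simps single_diff)
    moreover have "b c \<notin> M"
    proof
      assume "b c \<in> M"
      then have "(var i - Const c) * b c - ((var i - Const c) * b c - 1) \<in> M"
        by (intro pideal.subspace_diff[OF subspace_M] b M_mult)
      then show False using one_notin by simp
    qed
    ultimately have "Const (c' - c) \<in> M" using M_mult_cancel[of "b c" "Const (c' - c)"]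
      by (simp add: mult.commute)
    then show "c = c'" using Const_in_M by fastforce
  qed
  define K where "K n = {\<mu> :: 3 \<Rightarrow>\<^sub>0 nat. mdeg \<mu> \<le> n}" for n
  have finK: "finite (K n)" for n
  proof (rule finite_subset)
    show "K n \<subseteq> Abs_poly_mapping ` (UNIV \<rightarrow>\<^sub>E {..n})"
    proof
      fix \<mu> assume "\<mu> \<in> K n"
      have "Poly_Mapping.lookup \<mu> i \<le> mdeg \<mu>" for i by (rule member_le_sum) auto
      with \<open>\<mu> \<in> K n\<close> have "Poly_Mapping.lookup \<mu> \<in> (UNIV \<rightarrow>\<^sub>E {..n})"
        by (auto simp: K_def intro: le_trans)
      moreover have "\<mu> = Abs_poly_mapping (Poly_Mapping.lookup \<mu>)" by (simp add: lookup_inverse)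
      ultimately show "\<mu> \<in> Abs_poly_mapping ` (UNIV \<rightarrow>\<^sub>E {..n})" by blast
    qed
  qed (intro finite_imageI finite_PiE; simp)
  \<comment> \<open>Otherwise the real line would be a countable union of finite sets.\<close>
  have "\<exists>n. infinite {r::real. Poly_Mapping.keys (b (of_real r)) \<subseteq> K n}"
  proof (rule ccontr)
    assume "\<nexists>n. infinite {r::real. Poly_Mapping.keys (b (of_real r)) \<subseteq> K n}"
    then have "countable (\<Union>n. {r::real. Poly_Mapping.keys (b (of_real r)) \<subseteq> K n})"
      by (intro countable_UN) (auto intro: countable_finite)
    moreover have "(\<Union>n. {r::real. Poly_Mapping.keys (b (of_real r)) \<subseteq> K n}) = UNIV"
    proof (intro equalityI subsetI)
      fix r :: real assume "r \<in> UNIV"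
      have "Poly_Mapping.keys (b (of_real r)) \<subseteq> K (\<Sum>\<mu>\<in>Poly_Mapping.keys (b (of_real r)). mdeg \<mu>)"
        by (intro subsetI, simp only: K_def mem_Collect_eq, rule member_le_sum) simp_all
      then show "r \<in> (\<Union>n. {r::real. Poly_Mapping.keys (b (of_real r)) \<subseteq> K n})" by blast
    qed simp
    ultimately show False using uncountable_UNIV_real by simp
  qed
  then obtain n where n: "infinite {r::real. Poly_Mapping.keys (b (of_real r)) \<subseteq> K n}" by blast
  then obtain R where R: "finite R" "card R
      = Suc (card (K n))" "R \<subseteq> {r::real. Poly_Mapping.keys (b (of_real r)) \<subseteq> K n}"
    using infinite_arbitrarily_large by blast
  define T where "T = (of_real ` R :: complex set)"
  have T: "finite T" "card T = Suc (card (K n))" "\<And>c. c \<in> T \<Longrightarrow> Poly_Mapping.keys (b c) \<subseteq> K n"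
    using R by (auto simp: T_def card_image inj_on_def)
  interpret V: vector_space "\<lambda>c g. Const c * g"
    by standard (simp_all only: distrib_left distrib_right single_add mult.assoc[symmetric] const.hom_mult, simp_all)
  have "V.dependent (b ` T)"
  proof (rule ccontr)
    assume "V.independent (b ` T)"
    moreover have "b ` T \<subseteq> V.span ((\<lambda>\<mu>. Poly_Mapping.single \<mu> 1) ` K n)"
    proof
      fix g assume "g \<in> b ` T"
      then have g: "Poly_Mapping.keys g \<subseteq> K n" using T by blast
      have "(\<Sum>\<mu>\<in>Poly_Mapping.keys g. Const (Poly_Mapping.lookup g \<mu>) * Poly_Mapping.single \<mu> 1)
          \<in> V.span ((\<lambda>\<mu>. Poly_Mapping.single \<mu> 1) ` K n)"
        using g by (intro V.span_sum V.span_scale V.span_base) auto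
      then show "g \<in> V.span ((\<lambda>\<mu>. Poly_Mapping.single \<mu> 1) ` K n)"
        using cpoly_sum_singles[of g] by (simp add: mult_single)
    qed
    ultimately have "card (b ` T) \<le> card ((\<lambda>\<mu>. Poly_Mapping.single \<mu> (1::complex)) ` K n)"
      using V.independent_span_bound finK by blast
    also have "\<dots> \<le> card (K n)" by (rule card_image_le[OF finK])
    finally show False using T card_image[of b T] \<open>inj b\<close> by (simp add: inj_on_subset)
  qed
  then obtain u where u: "(\<Sum>v\<in>b ` T. Const (u v) * v) = 0" "\<exists>v\<in>b ` T. u v \<noteq> 0"
    using V.dependent_finite[of "b ` T"] T(1) by auto
  define a where "a c = u (b c)" for c
  have a: "(\<Sum>c\<in>T. Const (a c) * b c) = 0" "\<exists>c\<in>T. a c \<noteq> 0"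
    using u \<open>inj b\<close> by (auto simp: a_def sum.reindex inj_on_subset)
  \<comment> \<open>The numerator of $\sum_c a_c / (t - c)$; at a point $c$ of $T$ only one summand survives.\<close>
  define p where "p = (\<Sum>c\<in>T. Polynomial.smult (a c) (\<Prod>c'\<in>T - {c}. [:- c', 1:]))"
  have "p \<noteq> 0"
  proof
    assume "p = 0"
    obtain c where c: "c \<in> T" "a c \<noteq> 0" using a by blast
    have "poly p c = (\<Sum>c0\<in>T. a c0 * (\<Prod>c'\<in>T - {c0}. c - c'))"
      by (simp add: p_def poly_sum poly_prod)
    also have "\<dots> = (\<Sum>c0\<in>T. if c0 = c then a c * (\<Prod>c'\<in>T - {c}. c - c') else 0)"
      using T(1) c by (intro sum.cong) auto
    also have "\<dots> = a c * (\<Prod>c'\<in>T - {c}. c - c')" using T(1) c by simp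
    also have "\<dots> \<noteq> 0" using T(1) c by auto
    finally show False using \<open>p = 0\<close> by simp
  qed
  moreover have "at_var i p \<in> M"
  proof -
    let ?L = "\<lambda>c. var i - Const c"
    have at_var_p: "at_var i p = (\<Sum>c\<in>T. Const (a c) * (\<Prod>c'\<in>T - {c}. ?L c'))"
      by (simp add: p_def at_var_sum at_var_smult at_var_prod at_var_simps single_uminus)
    have ring_identity: "A * X = (L * X) * (A * B) - A * X * (L * B - 1)" for A X L B :: cpoly
      by (simp add: algebra_simps)
    have "(\<Sum>c\<in>T. Const (a c) * (\<Prod>c'\<in>T - {c}. ?L c'))
        = (\<Prod>c'\<in>T. ?L c') * (\<Sum>c\<in>T. Const (a c) * b c) - (\<Sum>c\<in>T. Const (a c) * (\<Prod>c'\<in>T - {c}. ?L c') * (?L c * b c - 1))"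
      unfolding sum_distrib_left sum_subtractf[symmetric]
    proof (rule sum.cong[OF refl])
      fix c assume "c \<in> T"
      then have eq: "(\<Prod>c'\<in>T. ?L c') = ?L c * (\<Prod>c'\<in>T - {c}. ?L c')"
        using T(1) by (rule prod.remove[rotated])
      show "Const (a c) * (\<Prod>c'\<in>T - {c}. ?L c') = (\<Prod>c'\<in>T. ?L c') * (Const (a c) * b c) -
          Const (a c) * (\<Prod>c'\<in>T - {c}. ?L c') * (?L c * b c - 1)"
        unfolding eq by (rule ring_identity)
    qed
    also have "\<dots> \<in> M"
      unfolding a(1)
      by (intro pideal.subspace_diff[OF subspace_M] pideal.subspace_sum[OF subspace_M] M_mult b)
         (simp add: pideal.subspace_0[OF subspace_M])
    finally show ?thesis unfolding at_var_p .
  qed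
  ultimately show False using at_var_notin[OF notin] by blast
qed

text \<open>The residue field of \<open>M\<close> is the field of constants, so reduction modulo \<open>M\<close> is evaluation at the
point whose coordinates are the residues of the variables.\<close>

lemma zero_exists: "\<exists>p. \<forall>g. g - Const (peval g p) \<in> M"
proof -
  obtain q where q: "\<And>i. var i - Const (q i) \<in> M" using linear_form_in_M by metis
  have "g - Const (peval g (\<chi> i. q i)) \<in> M" for g
  proof (induction g rule: cpoly_ring_induct)
    case (add g h)
    then show ?case using pideal.subspace_add[OF subspace_M add]
      by (simp add: peval_eq_subst single_add algebra_simps)
  next
    case (mult g h)
    let ?p = "\<chi> i. q i"
    have "h * (g - Const (peval g ?p)) + Const (peval g ?p) * (h - Const (peval h ?p)) \<in> M"
      by (intro pideal.subspace_add[OF subspace_M] M_mult mult)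
    then show ?case by (simp add: peval_eq_subst algebra_simps const.hom_mult del: peval.subst_single const.subst_single)
  qed (auto simp: peval_eq_subst q pideal.subspace_0[OF subspace_M] simp del: peval.subst_single)
  then show ?thesis by blast
qed

end

lemma maximal_ideal_exists:
  assumes J: "pideal.subspace J" "1 \<notin> J"
  shows "\<exists>M. J \<subseteq> M \<and> maximal_ideal_of_polynomials M"
proof -
  define A where "A = {I. pideal.subspace I \<and> J \<subseteq> I \<and> 1 \<notin> I}"
  have "\<exists>M\<in>A. \<forall>X\<in>A. M \<subseteq> X \<longrightarrow> X = M"
  proof (rule subset_Zorn_nonempty)
    show "A \<noteq> {}" using J by (auto simp: A_def)
    fix \<C> assume C: "\<C> \<noteq> {}" "subset.chain A \<C>"
    have "pideal.subspace (\<Union>\<C>)"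
    proof (rule pideal.subspaceI)
      fix x y assume "x \<in> \<Union>\<C>" "y \<in> \<Union>\<C>"
      then obtain X Y where XY: "X \<in> \<C>" "Y \<in> \<C>" "x \<in> X" "y \<in> Y" by blast
      then have "X \<subseteq> Y \<or> Y \<subseteq> X" using C(2) by (auto simp: subset_chain_def)
      with XY obtain Z where Z: "Z \<in> \<C>" "x \<in> Z" "y \<in> Z" by blast
      then have "pideal.subspace Z" using C(2) by (auto simp: subset_chain_def A_def)
      with Z show "x + y \<in> \<Union>\<C>" using pideal.subspace_add by blast
    next
      obtain X where X: "X \<in> \<C>" using C(1) by blast
      then have "pideal.subspace X" using C(2) by (auto simp: subset_chain_def A_def)
      with X show "0 \<in> \<Union>\<C>" using pideal.subspace_0 by blast
    next
      fix c x assume "x \<in> \<Union>\<C>"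
      then obtain X where X: "X \<in> \<C>" "x \<in> X" by blast
      then have "pideal.subspace X" using C(2) by (auto simp: subset_chain_def A_def)
      with X show "c * x \<in> \<Union>\<C>" using pideal.subspace_scale by blast
    qed
    moreover have "J \<subseteq> \<Union>\<C>" using C unfolding subset_chain_def A_def by blast
    moreover have "1 \<notin> \<Union>\<C>" using C unfolding subset_chain_def A_def by blast
    ultimately show "\<Union>\<C> \<in> A" by (simp add: A_def)
  qed
  then obtain M where "M \<in> A" and max: "\<And>X. X \<in> A \<Longrightarrow> M \<subseteq> X \<Longrightarrow> X = M" by blast
  then have M: "pideal.subspace M" "J \<subseteq> M" "1 \<notin> M" by (simp_all add: A_def)
  have "\<exists>b. a * b - 1 \<in> M" if "a \<notin> M" for a
  proof -
    have "1 \<in> pideal.span (insert a M)"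
    proof (rule ccontr)
      assume "1 \<notin> pideal.span (insert a M)"
      then have "pideal.span (insert a M) \<in> A"
        using M(2) pideal.span_superset[of "insert a M"] by (auto simp: A_def)
      then have "pideal.span (insert a M) = M"
        using pideal.span_superset[of "insert a M"] by (intro max) auto
      with that show False using pideal.span_superset[of "insert a M"] by auto
    qed
    then obtain k where "1 - k * a \<in> pideal.span M" by (auto simp: pideal.span_insert)
    then have "1 - k * a \<in> M" using pideal.span_eq_iff[THEN iffD2, OF M(1)] by simp
    then have "- (1 - k * a) \<in> M" by (rule pideal.subspace_neg[OF M(1)])
    then show ?thesis by (auto simp: mult.commute)
  qed
  with M show ?thesis by (auto simp: maximal_ideal_of_polynomials_def)
qed

text \<open>The chart $x_i = 1$ contains no common zero, so $x_i - 1$ together with \<open>H\<close> generates the unit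
ideal: $1 - x_i$ is invertible modulo the homogeneous ideal $(H)$. In a graded ring the inverse of
$1 - x_i$ can only be the geometric series $\sum_n x_i^n$, and it has finitely many terms only if a
power of $x_i$ is zero.\<close>

theorem projective_Nullstellensatz_var:
  assumes H: "\<And>h. h \<in> H \<Longrightarrow> \<exists>k. homogeneous k h"
    and Z: "\<And>p. p \<noteq> 0 \<Longrightarrow> \<exists>h\<in>H. peval h p \<noteq> 0"
  shows "\<exists>n. var i ^ n \<in> pideal.span H"
proof (rule ccontr)
  assume no: "\<nexists>n. var i ^ n \<in> pideal.span H"
  let ?J = "pideal.span (insert (var i - 1) H)"
  have "1 \<notin> ?J"
  proof
    assume "1 \<in> ?J"
    then obtain k where k: "1 - k * (var i - 1) \<in> pideal.span H" by (auto simp: pideal.span_insert)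
    define c where "c n = coeff (homogeneous_parts k) n" for n
    \<comment> \<open>The part of degree $n$ of $1 - k (x_i - 1)$.\<close>
    have step: "coeff 1 n - coeff (pCons 0 (Polynomial.smult (var i) (homogeneous_parts k))) n + c n
        \<in> pideal.span H"
      for n
      using homogeneous_parts_in_span[OF H k, of n]
      by (simp add: homogeneous_parts_hom c_def algebra_simps monom_Suc monom_0)
    have "c n + var i ^ n \<in> pideal.span H" for n
    proof (induction n)
      case 0
      then show ?case using step[of 0] by (simp add: add.commute)
    next
      case (Suc n)
      have "(coeff 1 (Suc n) - coeff (pCons 0 (Polynomial.smult (var i) (homogeneous_parts k))) (Suc n) + c (Suc n)) + var i * (c n + var i ^ n) \<in> pideal.span H"
        by (intro pideal.span_add pideal.span_scale step Suc)
      then show ?case by (simp add: c_def algebra_simps)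
    qed
    \<comment> \<open>Beyond the degree of $k$ its component is zero and only the power of $x_i$ remains.\<close>
    from this[of "Suc (degree (homogeneous_parts k))"] have "var i ^ Suc (degree (homogeneous_parts k)) \<in> pideal.span H"
      by (simp add: c_def coeff_eq_0)
    with no show False by blast
  qed
  then obtain M where M: "?J \<subseteq> M" "maximal_ideal_of_polynomials M"
    using maximal_ideal_exists pideal.subspace_span by blast
  interpret maximal_ideal_of_polynomials M by (rule M(2))
  obtain p where p: "\<And>g. g - Const (peval g p) \<in> M" using zero_exists by blast
  have zero: "peval g p = 0" if "g \<in> ?J" for g
  proof -
    have "g - (g - Const (peval g p)) \<in> M"
      by (rule pideal.subspace_diff[OF subspace_M subsetD[OF M(1) that] p])
    then show ?thesis by (intro Const_in_M) simp
  qed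
  have "peval (var i - 1) p = 0" by (rule zero) (simp add: pideal.span_base)
  then have "p \<noteq> 0" by (auto simp: peval_eq_subst)
  from Z[OF this] obtain h where "h \<in> H" "peval h p \<noteq> 0" by blast
  with zero[of h] show False by (simp add: pideal.span_base)
qed

text \<open>The elements $h$ with $h a \in (F,G)$ form an ideal; by the Nullstellensatz it contains a power of
each variable.\<close>

lemma saturated_wrt_no_common_zero:
  assumes FG: "regular_pair F G"
    and H: "\<And>h. h \<in> H \<Longrightarrow> \<exists>k. homogeneous k h"
    and Z: "\<And>p. p \<noteq> 0 \<Longrightarrow> \<exists>h\<in>H. peval h p \<noteq> 0"
    and a: "\<And>h. h \<in> H \<Longrightarrow> h * a \<in> pideal.span {F, G}"
  shows "a \<in> pideal.span {F, G}"
proof -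
  let ?T = "{h. h * a \<in> pideal.span {F, G}}"
  have "pideal.subspace ?T"
    by (rule pideal.subspaceI)
       (auto simp: distrib_right mult.assoc intro: pideal.span_zero pideal.span_add pideal.span_scale)
  then have sub: "pideal.span H \<subseteq> ?T" using a by (intro pideal.span_minimal) auto
  obtain N where "\<And>i. var i ^ N i \<in> pideal.span H"
    using projective_Nullstellensatz_var[OF H Z] by metis
  then have "var i ^ N i * a \<in> pideal.span {F, G}" for i using sub by blast
  then show ?thesis by (rule regular_pair_saturated[OF FG])
qed

section \<open>Greatest common divisors of polynomials in three variables\<close>

text \<open>The isomorphism of $C[x,y,z]$ with $C[x][y][z]$, through which greatest common divisors are
available.\<close>

definition nested :: "cpoly \<Rightarrow> complex poly poly poly" where
  "nested = subst (\<lambda>c. [:[:[:c:]:]:]) (\<lambda>i. if i = 1 then [:[:[:0, 1:]:]:] else if i = 2 then [:[:0, 1:]:] else [:0, 1:])"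

interpretation nested: coeff_hom "\<lambda>c. [:[:[:c:]:]:]"
  by standard (auto simp: one_pCons)

lemma nested_hom: "nested (g + h) = nested g + nested h" "nested (g * h) = nested g * nested h"
  "nested (g - h) = nested g - nested h"
  "nested (Const c) = [:[:[:c:]:]:]" "nested (var 1) = [:[:[:0, 1:]:]:]" "nested (var 2)
      = [:[:0, 1:]:]" "nested (var 3) = [:0, 1:]"
  "nested 0 = 0" "nested 1 = 1" "nested (\<Sum>x\<in>A. G x) = (\<Sum>x\<in>A. nested (G x))"
  by (simp_all add: nested_def del: nested.subst_single)

lemma prod_UNIV_3: "(\<Prod>i\<in>UNIV. g i) = g 1 * g 2 * g (3::3)"
  unfolding UNIV_3 by (simp add: mult_ac)

lemma nested_single: "nested (Poly_Mapping.single \<mu> c) =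
  monom (monom (monom c (Poly_Mapping.lookup \<mu> 1)) (Poly_Mapping.lookup \<mu> 2)) (Poly_Mapping.lookup \<mu> 3)"
proof -
  have X: "[:[:[:0, 1:]:]:] ^ n = ([:[:monom 1 n:]:] :: complex poly poly poly)" for n
    by (induction n) (simp add: one_pCons monom_0, simp add: monom_Suc)
  have Y: "[:[:0, 1:]:] ^ n = ([:monom 1 n:] :: complex poly poly poly)" for n
    by (induction n) (simp add: one_pCons monom_0, simp add: monom_Suc)
  have Z: "[:0, 1:] ^ n = (monom 1 n :: complex poly poly poly)" for n
    by (induction n) (simp add: one_pCons monom_0, simp add: monom_Suc)
  show ?thesis
    by (simp add: nested_def prod_UNIV_3 X Y Z smult_monom mult_monom)
qed

lemma coeff_nested:
  "coeff (coeff (coeff (nested g) (Poly_Mapping.lookup \<mu> 3)) (Poly_Mapping.lookup \<mu> 2)) (Poly_Mapping.lookup \<mu> 1) = Poly_Mapping.lookup g \<mu>"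
proof -
  have eq: "\<nu> = \<mu>" if "Poly_Mapping.lookup \<nu> 1 = Poly_Mapping.lookup \<mu> 1" "Poly_Mapping.lookup \<nu> 2
      = Poly_Mapping.lookup \<mu> 2"
    "Poly_Mapping.lookup \<nu> 3 = Poly_Mapping.lookup \<mu> 3" for \<nu> :: "3 \<Rightarrow>\<^sub>0 nat"
    using that by (intro poly_mapping_eqI) (metis exhaust_3)
  show ?thesis
    by (induction g rule: cpoly_induct)
       (auto simp: nested_single nested_hom lookup_add lookup_single when_def dest: eq)
qed

lemma nested_inj: "nested g = nested h \<Longrightarrow> g = h"
  by (metis coeff_nested poly_mapping_eqI)

lemma nested_surj: "\<exists>g. nested g = P"
proof (induction P)
  case (pCons p P)
  have "\<exists>g. nested g = [:p:]"
  proof (induction p)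
    case (pCons q p)
    have "\<exists>g. nested g = [:[:q:]:]"
    proof (induction q)
      case (pCons c q)
      then obtain g where "nested g = [:[:q:]:]" by blast
      then have "nested (Const c + var 1 * g) = [:[:pCons c q:]:]" by (simp only: nested_hom) simp
      then show ?case by blast
    qed (auto intro: exI[of _ 0] simp: nested_hom)
    then obtain h where "nested h = [:[:q:]:]" by blast
    moreover obtain g where "nested g = [:p:]" using pCons by blast
    ultimately have "nested (h + var 2 * g) = [:pCons q p:]" by (simp only: nested_hom) simp
    then show ?case by blast
  qed (auto intro: exI[of _ 0] simp: nested_hom)
  then obtain h where "nested h = [:p:]" by blast
  moreover obtain g where "nested g = P" using pCons by blast
  ultimately have "nested (h + var 3 * g) = pCons p P" by (simp only: nested_hom) simp
  then show ?case by blast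
qed (auto intro: exI[of _ 0] simp: nested_hom)

lemma coprime_koszul:
  fixes F G a b :: "'a :: factorial_ring_gcd"
  assumes "coprime F G" and ab: "F * a = G * b"
  shows "\<exists>c. a = G * c \<and> b = F * c"
proof (cases "G = 0")
  case True
  then have "is_unit F" using assms(1) by simp
  then obtain u where u: "1 = F * u" by (auto elim: dvdE)
  have "F \<noteq> 0" using u by auto
  with ab True have "a = 0" by simp
  moreover have "b = F * (u * b)" using u by (metis mult.assoc mult_1)
  ultimately show ?thesis by (intro exI[of _ "u * b"]) (simp add: True)
next
  case False
  have "G dvd F * a" by (simp add: ab)
  then have "G dvd a" using assms(1) by (simp add: coprime_dvd_mult_right_iff coprime_commute)
  then obtain c where c: "a = G * c" by (auto elim: dvdE)
  have "G * b = F * (G * c)" using ab by (simp only: c)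
  also have "\<dots> = G * (F * c)" by (simp only: mult.left_commute)
  finally have "G * b = G * (F * c)" .
  with False have "b = F * c" by auto
  with c show ?thesis by blast
qed

text \<open>Division by the greatest common divisor of $p$ and $q$. If both are zero the pair $(1,1)$ takes
the place of the cofactors.\<close>

lemma common_factor_decomposition:
  "\<exists>h p' q'. p = h * p' \<and> q = h * q' \<and> regular_pair p' q'"
proof (cases "p = 0 \<and> q = 0")
  case True
  then show ?thesis by (intro exI[of _ 0] exI[of _ 1]) (auto simp: regular_pair_def)
next
  case False
  then have ne: "nested p \<noteq> 0 \<or> nested q \<noteq> 0"
    using nested_inj[of p 0] nested_inj[of q 0] by (auto simp: nested_hom)
  then obtain P Q where PQ: "nested p = gcd (nested p) (nested q) * P" "nested q
      = gcd (nested p) (nested q) * Q" "coprime P Q"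
    by (metis gcd_coprime_exists gcd_eq_0_iff mult.commute)
  obtain h p' q' where n: "nested h = gcd (nested p) (nested q)" "nested p' = P" "nested q' = Q"
    using nested_surj by metis
  have "nested p = nested (h * p')" "nested q = nested (h * q')"
    using PQ by (simp_all only: nested_hom n)
  then have "p = h * p'" "q = h * q'" by (auto dest: nested_inj)
  moreover have "regular_pair p' q'"
    unfolding regular_pair_def
  proof (intro allI impI)
    fix a b assume "p' * a = q' * b"
    then have "P * nested a = Q * nested b" by (metis n nested_hom(2))
    then obtain C where "nested a = Q * C" "nested b = P * C"
      using coprime_koszul[OF PQ(3)] by blast
    moreover obtain c where "nested c = C" using nested_surj by blast
    ultimately have "nested a = nested (q' * c)" "nested b = nested (p' * c)"
      by (simp_all only: nested_hom n)
    then show "\<exists>c. a = q' * c \<and> b = p' * c" by (auto dest: nested_inj)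
  qed
  ultimately show ?thesis by blast
qed

section \<open>Regular pairs from the absence of common zeros\<close>

lemma regular_pair_unit:
  assumes pq: "regular_pair p q" and u: "h * u = 1"
  shows "regular_pair (h * p) (h * q)"
proof -
  have uh: "u * (h * x) = x" for x
  proof -
    have "u * (h * x) = h * u * x" by (simp only: mult_ac)
    then show ?thesis by (simp add: u)
  qed
  show "regular_pair (h * p) (h * q)"
    unfolding regular_pair_def
  proof (intro allI impI)
    fix a b assume "h * p * a = h * q * b"
    then have "u * (h * (p * a)) = u * (h * (q * b))" by (simp only: mult.assoc)
    then have "p * a = q * b" by (simp only: uh)
    then obtain c where c: "a = q * c" "b = p * c" using regular_pairD[OF pq] by blast
    have "h * q * (u * c) = u * (h * (q * c))" "h * p * (u * c) = u * (h * (p * c))"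
      by (simp_all only: mult_ac)
    then have "a = h * q * (u * c) \<and> b = h * p * (u * c)" by (simp only: uh c simp_thms)
    then show "\<exists>c. a = h * q * c \<and> b = h * p * c" by blast
  qed
qed

lemma regular_pair_mult:
  assumes "regular_pair F G" "regular_pair F H" shows "regular_pair F (G * H)"
  unfolding regular_pair_def
proof (intro allI impI)
  fix a b assume "F * a = G * H * b"
  then have "F * a = G * (H * b)" by (simp add: mult_ac)
  then obtain c where c: "a = G * c" "H * b = F * c" using regular_pairD[OF assms(1)] by blast
  then obtain d where "c = H * d" "b = F * d" using regular_pairD[OF assms(2), of c b] by auto
  with c show "\<exists>c. a = G * H * c \<and> b = F * c" by (auto simp: mult.assoc)
qed

lemma regular_pair_1: "regular_pair F 1"
  by (auto simp: regular_pair_def)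

lemma regular_pair_power: "regular_pair F G \<Longrightarrow> regular_pair F (G ^ n)"
  by (induction n) (auto intro: regular_pair_mult regular_pair_1)

lemma regular_pair_prod: "(\<And>x. x \<in> A \<Longrightarrow> regular_pair F (G x)) \<Longrightarrow> regular_pair F (\<Prod>x\<in>A. G x)"
  by (induction A rule: infinite_finite_induct) (auto intro: regular_pair_mult regular_pair_1)

text \<open>The powers $x^n$ and $y^k$ form a regular pair, which forces the cofactors of \<open>h\<close> to be multiples of
these powers.\<close>

lemma var_power_common_divisor:
  assumes "h dvd var 1 ^ n" "h dvd var 2 ^ k"
  shows "h dvd 1"
proof -
  obtain u v where uv: "var 1 ^ n = h * u" "var 2 ^ k = h * v" using assms by (auto elim!: dvdE)
  have "regular_pair (var 1 ^ n) (var 2 ^ k)"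
    by (intro regular_pair_power regular_pair_sym[of "var 2"] regular_pair_sym[of "var 1 ^ n"] regular_pair_var) auto
  moreover have "var 1 ^ n * v = var 2 ^ k * u" by (simp add: uv mult_ac)
  ultimately obtain c where c: "v = var 2 ^ k * c" using regular_pairD by blast
  have "var 2 ^ k * (h * c) = var 2 ^ k * 1" using uv(2) c by (simp add: mult_ac)
  then have "h * c = 1" by (subst (asm) mult_cancel_left) auto
  then show ?thesis by (intro dvdI[of _ _ c]) simp
qed

text \<open>A factor of $c t^k$ with nonzero constant term has degree 0: the other factor vanishes at 0 to the
full order $k$, and this is already the total degree.\<close>

lemma monom_factor_degree_0:
  fixes A B :: "'a::idom poly"
  assumes AB: "A * B = monom c k" and "c \<noteq> 0" "coeff A 0 \<noteq> 0"
  shows "degree A = 0"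
proof -
  have nz: "A * B \<noteq> 0" using assms by simp
  then have "A \<noteq> 0" "B \<noteq> 0" by auto
  have "Polynomial.order 0 A = 0" using \<open>coeff A 0 \<noteq> 0\<close> by (simp add: order_0I poly_0_coeff_0)
  moreover have "Polynomial.order 0 (A * B) = k"
    using \<open>c \<noteq> 0\<close> by (simp add: AB order_0_monom)
  ultimately have "Polynomial.order 0 B = k" using order_mult[OF nz, of 0] by simp
  then have "k \<le> degree B" using order_degree[OF \<open>B \<noteq> 0\<close>, of 0] by simp
  moreover have "degree A + degree B = k"
    using degree_mult_eq[OF \<open>A \<noteq> 0\<close> \<open>B \<noteq> 0\<close>] AB \<open>c \<noteq> 0\<close> by (simp add: degree_monom_eq)
  ultimately show ?thesis by simp
qed

lemma homogeneous_parts_sum: "poly (homogeneous_parts g) 1 = g"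
  by (induction g rule: cpoly_induct) (auto simp: homogeneous_parts_single homogeneous_parts_hom poly_monom)

lemma coeff_homogeneous_parts_0: "coeff (homogeneous_parts g) 0 = Const (peval g 0)"
proof (induction g rule: cpoly_ring_induct)
  case (mult g h)
  then show ?case
    by (simp add: homogeneous_parts_hom coeff_mult peval_eq_subst const.hom_mult del: peval.subst_single const.subst_single)
qed (auto simp: homogeneous_parts_hom peval_eq_subst single_add simp del: peval.subst_single)

lemma Const_eq_0_iff [simp]: "Const c = 0 \<longleftrightarrow> c = 0"
  by (metis lookup_single_eq lookup_zero single_zero)

text \<open>A factor of a form that does not vanish at the origin is a constant: apply \<open>monom_factor_degree_0\<close>
to the images under $x_i \mapsto x_i t$.\<close>

lemma factor_of_homogeneous_unit:
  assumes hq: "h * q = p" and p: "homogeneous k p" "p \<noteq> 0" and h0: "peval h 0 \<noteq> 0"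
  shows "h = Const (peval h 0)"
proof -
  obtain n where n: "k = int n" using homogeneous_cases[OF p(1)] p(2) by blast
  have "homogeneous_parts h * homogeneous_parts q = monom p n"
    using homogeneous_parts_homogeneous[of n p] p(1) by (simp add: n flip: homogeneous_parts_hom hq)
  then have "degree (homogeneous_parts h) = 0"
    by (rule monom_factor_degree_0) (use p h0 in \<open>auto simp: coeff_homogeneous_parts_0\<close>)
  then have "homogeneous_parts h = [:Const (peval h 0):]"
    by (metis coeff_homogeneous_parts_0 coeff_pCons_0 degree_eq_zeroE)
  then show ?thesis using homogeneous_parts_sum[of h] by simp
qed

lemma peval_0_homogeneous:
  assumes "homogeneous k g" "k > 0" shows "peval g 0 = 0"
proof -
  obtain n where "g = 0 \<or> k = int n" using homogeneous_cases[OF assms(1)] by blast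
  then show ?thesis
  proof
    assume "k = int n"
    then have "coeff (homogeneous_parts g) 0 = 0"
      using homogeneous_parts_homogeneous[of n g] assms by simp
    then show ?thesis using coeff_homogeneous_parts_0[of g] by simp
  qed (simp add: peval_eq_subst)
qed

lemma span_triple: "a \<in> pideal.span {F, G, H} \<longleftrightarrow> (\<exists>A B C. a = A * F + B * G + C * H)"
proof
  assume "a \<in> pideal.span {F, G, H}"
  then obtain A where "a - A * F \<in> pideal.span {G, H}"
    by (auto simp: pideal.span_insert[of F])
  then obtain B C where "a - A * F = B * G + C * H" by (auto simp: span_pair)
  then have "a = A * F + B * G + C * H" by (simp add: algebra_simps)
  then show "\<exists>A B C. a = A * F + B * G + C * H" by blast
next
  assume "\<exists>A B C. a = A * F + B * G + C * H"
  then obtain A B C where a: "a = A * F + B * G + C * H" by blast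
  show "a \<in> pideal.span {F, G, H}"
    unfolding a by (intro pideal.span_add pideal.span_scale pideal.span_base) simp_all
qed

text \<open>Let $h$ be the greatest common divisor of $p$ and $q$. The Nullstellensatz puts powers of the
variables into $(p,q,r)$ and hence into $(h,r)$, so $h$ and $r$ have no common factor. An ideal
generated by a regular pair is saturated, hence $1 \in (h,r)$. Evaluation at the origin, where $r$
vanishes, shows $h(0) \neq 0$. As a factor of a form, $h$ is then a constant.\<close>

theorem regular_pair_of_no_common_zero:
  assumes hom: "homogeneous kp p" "homogeneous kq q" "homogeneous kr r" and pos: "kr > 0"
    and Z: "\<And>v. v \<noteq> 0 \<Longrightarrow> peval p v = 0 \<Longrightarrow> peval q v = 0 \<Longrightarrow> peval r v \<noteq> 0"
  shows "regular_pair p q"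
proof -
  have "\<exists>h\<in>{p, q, r}. peval h v \<noteq> 0" if "v \<noteq> 0" for v using Z[OF that] by blast
  moreover have "\<exists>k. homogeneous k h" if "h \<in> {p, q, r}" for h using hom that by blast
  ultimately obtain N where N: "\<And>i. var i ^ N i \<in> pideal.span {p, q, r}"
    using projective_Nullstellensatz_var[of "{p, q, r}"] by metis
  obtain h p' q' where h: "p = h * p'" "q = h * q'" "regular_pair p' q'"
    using common_factor_decomposition by blast
  have hr: "var i ^ N i \<in> pideal.span {h, r}" for i
  proof -
    obtain A B C where "var i ^ N i = A * p + B * q + C * r"
      using N[of i] by (auto simp: span_triple)
    then have "var i ^ N i = (A * p' + B * q') * h + C * r" by (simp add: h algebra_simps)
    then show ?thesis by (auto simp: span_pair)
  qed
  obtain g h' r' where g: "h = g * h'" "r = g * r'" "regular_pair h' r'"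
    using common_factor_decomposition by blast
  have g_dvd: "g dvd var i ^ N i" for i
    using hr[of i] by (auto simp: span_pair g)
  have "g dvd 1" by (rule var_power_common_divisor[OF g_dvd g_dvd])
  then obtain u where "g * u = 1" by (metis dvdE)
  then have "regular_pair h r" using regular_pair_unit[OF g(3)] g by simp
  then have "1 \<in> pideal.span {h, r}"
    by (rule regular_pair_saturated[where N = N]) (simp add: hr)
  then obtain A B where AB: "1 = A * h + B * r" by (auto simp: span_pair)
  have "peval 1 0 = peval (A * h + B * r) 0" by (simp add: AB)
  then have "1 = peval A 0 * peval h 0"
    using peval_0_homogeneous[OF hom(3) pos] by (simp add: peval_eq_subst)
  then have h0: "peval h 0 \<noteq> 0" by auto
  then have "h \<noteq> 0" by (auto simp: peval_eq_subst)
  then have "p \<noteq> 0 \<or> q \<noteq> 0" using regular_pair_nonzero[OF h(3)] by (auto simp: h)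
  then have "h = Const (peval h 0)"
    using factor_of_homogeneous_unit[of h p' p kp] factor_of_homogeneous_unit[of h q' q kq] h hom h0 by auto
  then have "h * Const (1 / peval h 0) = 1"
    using h0 by (metis const.hom_mult nonzero_eq_divide_eq mult.commute single_one)
  then show ?thesis using regular_pair_unit[OF h(3)] h by simp
qed

section \<open>Vectors of polynomials\<close>

definition dot :: "cpoly ^ 3 \<Rightarrow> cpoly ^ 3 \<Rightarrow> cpoly" where
  "dot u v = u $ 1 * v $ 1 + u $ 2 * v $ 2 + u $ 3 * v $ 3"

definition position :: "cpoly ^ 3" where
  "position = (\<chi> i. var i)"

lemma position_nth [simp]: "position $ i = var i" by (simp add: position_def)
lemma dform_nth [simp]: "dform g $ i = pdiff i g" by (simp add: dform_def)

lemma wedge_nth [simp]: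
  "wedge a b $ 1 = a $ 2 * b $ 3 - a $ 3 * b $ 2"
  "wedge a b $ 2 = a $ 3 * b $ 1 - a $ 1 * b $ 3"
  "wedge a b $ 3 = a $ 1 * b $ 2 - a $ 2 * b $ 1"
  by (simp_all add: wedge_def)

lemma vec3_eqI: "u $ 1 = v $ 1 \<Longrightarrow> u $ 2 = v $ 2 \<Longrightarrow> u $ 3 = v $ 3 \<Longrightarrow> u = (v :: 'a ^ 3)"
  by (simp add: vec_eq_iff forall_3)

lemma vec3_exists: "(\<And>i. \<exists>x. P i x) \<Longrightarrow> \<exists>v :: 'a ^ 3. \<forall>i. P i (v $ i)"
  by (metis vec_lambda_beta)

lemma wedge_algebra:
  "wedge a (b + c) = wedge a b + wedge a c"
  "wedge (a + b) c = wedge a c + wedge b c"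
  "wedge a (b - c) = wedge a b - wedge a c"
  "wedge a (x *s b) = x *s wedge a b"
  "wedge (x *s a) b = x *s wedge a b"
  "wedge a (- b) = - wedge a b"
  "wedge a a = 0" "wedge a 0 = 0" "wedge 0 a = 0"
  by (auto intro!: vec3_eqI simp: algebra_simps)

lemma wedge_sum:
  "wedge a (\<Sum>x\<in>A. g x) = (\<Sum>x\<in>A. wedge a (g x))" "wedge (\<Sum>x\<in>A. g x) a = (\<Sum>x\<in>A. wedge (g x) a)"
  by (induction A rule: infinite_finite_induct) (auto simp: wedge_algebra)

lemma wedge_wedge: "wedge a (wedge b c) = dot a c *s b - dot a b *s c"
  by (rule vec3_eqI) (simp_all add: dot_def algebra_simps)

lemma dot_algebra:
  "dot a (b + c) = dot a b + dot a c" "dot a (x *s b) = x * dot a b" "dot a 0 = 0"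
  "dot a (wedge a b) = 0" "dot a (wedge b a) = 0"
  by (simp_all add: dot_def algebra_simps)

lemma dot_commute: "dot a b = dot b a"
  by (simp add: dot_def mult.commute)

lemma dot_sum: "dot a (\<Sum>x\<in>A. g x) = (\<Sum>x\<in>A. dot a (g x))"
  by (induction A rule: infinite_finite_induct) (auto simp: dot_algebra)

lemma scale_cancel: "(x *s u = x *s v) \<longleftrightarrow> x = 0 \<or> u = (v :: cpoly ^ 3)"
  by (auto simp: vec_eq_iff)

lemma scale_sum: "x *s (\<Sum>i\<in>A. g i) = (\<Sum>i\<in>A. x *s (g i :: cpoly ^ 3))"
  by (simp add: vec_eq_iff sum_distrib_left)

lemma Euler_dot:
  assumes "homogeneous k g" shows "dot position (dform g) = of_int k * g"
  using Euler_identity[OF assms] by (simp add: dot_def sum_3)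

text \<open>Cramer's rule for the matrix with rows $a, b, c$, in the form adj(M) (M u) = det(M) u.\<close>

lemma Cramer_identity:
  "u $ l * dot a (wedge b c)
      = dot u a * wedge b c $ l + dot u b * wedge c a $ l + dot u c * wedge a b $ l"
  using exhaust_3[of l] by (auto simp: dot_def algebra_simps)

text \<open>The same rule as adj(M) M = det(M) I.\<close>

lemma Cramer_identity':
  "wedge b c $ l * a $ k + wedge c a $ l * b $ k + wedge a b $ l * c $ k
      = (if k = l then dot a (wedge b c) else 0)"
  using exhaust_3[of l] exhaust_3[of k] by (auto simp: dot_def algebra_simps)

section \<open>The Koszul complex of three forms without common zero\<close>

text \<open>Three forms of the same positive degree without common zero, such as the partial derivatives of the
equation of a smooth curve of degree at least 2.\<close>

locale no_common_zero_vector =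
  fixes N :: "cpoly ^ 3" and k :: int
  assumes hom: "homogeneous k (N $ i)" and pos: "k > 0"
    and no_zero: "v \<noteq> 0 \<Longrightarrow> \<exists>i. peval (N $ i) v \<noteq> 0"
begin

lemma regular: "regular_pair (N $ 1) (N $ 2)"
  using no_zero by (intro regular_pair_of_no_common_zero[of k "N $ 1" k "N $ 2" k "N $ 3"] hom pos) (metis exhaust_3)

lemma nonzero: "N $ 1 \<noteq> 0 \<or> N $ 2 \<noteq> 0"
  using regular by (rule regular_pair_nonzero)

lemma koszul_dot:
  assumes "dot N v = 0" shows "\<exists>w. v = wedge N w"
proof -
  have "\<exists>x y z. v $ 1 = N $ 2 * z - N $ 3 * y \<and> v $ 2 = N $ 3 * x - N $ 1 * z \<and> v $ 3
      = N $ 1 * y - N $ 2 * x"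
  proof (rule koszul_exact[OF regular])
    fix c assume c: "N $ 3 * c \<in> pideal.span {N $ 1, N $ 2}"
    show "c \<in> pideal.span {N $ 1, N $ 2}"
    proof (rule saturated_wrt_no_common_zero[OF regular])
      show "\<exists>k. homogeneous k h" if "h \<in> range (($) N)" for h using that hom by auto
      show "\<exists>h\<in>range (($) N). peval h p \<noteq> 0" if "p \<noteq> 0" for p using no_zero[OF that] by auto
      fix h assume "h \<in> range (($) N)"
      then obtain i where i: "h = N $ i" by auto
      have "c * N $ 1 \<in> pideal.span {N $ 1, N $ 2}" "c * N $ 2 \<in> pideal.span {N $ 1, N $ 2}"
        by (intro pideal.span_scale pideal.span_base; simp)+
      then show "h * c \<in> pideal.span {N $ 1, N $ 2}"
        using exhaust_3[of i] c by (auto simp: i mult.commute)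
    qed
  qed (use assms in \<open>simp add: dot_def\<close>)
  then obtain x y z where "v $ 1 = N $ 2 * z - N $ 3 * y" "v $ 2 = N $ 3 * x - N $ 1 * z" "v $ 3
      = N $ 1 * y - N $ 2 * x"
    by blast
  then have "v = wedge N (vector [x, y, z])" by (intro vec3_eqI) simp_all
  then show ?thesis by blast
qed

text \<open>The first two entries of \<open>N\<close> are a regular pair and determine \<open>s\<close>; one of them is nonzero, and
comparison with it fixes the third coordinate.\<close>

lemma koszul_wedge:
  assumes "wedge N v = 0" shows "\<exists>s. v = s *s N"
proof -
  have eq: "N $ 1 * v $ 2 = N $ 2 * v $ 1" "N $ 1 * v $ 3 = N $ 3 * v $ 1" "N $ 2 * v $ 3
      = N $ 3 * v $ 2"
    using assms by (simp_all add: vec_eq_iff forall_3)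
  obtain s where s: "v $ 2 = N $ 2 * s" "v $ 1 = N $ 1 * s"
    using regular_pairD[OF regular eq(1)] by blast
  have "N $ 1 * v $ 3 = N $ 1 * (s * N $ 3)" "N $ 2 * v $ 3 = N $ 2 * (s * N $ 3)"
    using eq(2,3) by (simp_all only: s mult_ac)
  then have "v $ 3 = s * N $ 3" using nonzero mult_left_cancel by blast
  then have "v = s *s N" by (intro vec3_eqI) (simp_all add: s mult.commute)
  then show ?thesis by blast
qed

text \<open>Wedging with \<open>N\<close> shows that $b$ is a multiple of \<open>N\<close>; compare the factors.\<close>

lemma dvd_if_scale_dvd:
  assumes "c *s N = g *s b" and "g \<noteq> 0" shows "g dvd c"
proof -
  have "g *s wedge N b = c *s wedge N N"
    by (simp only: wedge_algebra(4)[symmetric] assms(1)[symmetric])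
  then have "wedge N b = 0"
    using assms(2) by (simp add: wedge_algebra)
  then obtain s where s: "b = s *s N" using koszul_wedge by blast
  have "c * N $ i = (g * s) * N $ i" for i
    using arg_cong[OF assms(1), of "\<lambda>v. v $ i"] by (simp add: s mult.assoc)
  then have "c = g * s" using nonzero mult_right_cancel by blast
  then show ?thesis by simp
qed

end

section \<open>Curves with normal crossings\<close>

text \<open>With at least three curves, any two of them are seen to have no common component by
\<open>regular_pair_of_no_common_zero\<close>: a third one is the additional form of positive degree.\<close>

locale normal_crossing_curves =
  fixes m :: nat and fs :: "nat \<Rightarrow> cpoly" and e :: "nat \<Rightarrow> nat"
  assumes m: "m \<ge> 3"
    and hom: "j \<in> {1..m} \<Longrightarrow> homogeneous (int (e j)) (fs j)"
    and smooth: "j \<in> {1..m} \<Longrightarrow> smooth_curve (fs j)"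
    and nc: "normal_crossing {1..m} fs"
    and e: "j \<in> {1..m} \<Longrightarrow> e j \<ge> 2"
begin

definition f where "f = (\<Prod>j\<in>{1..m}. fs j)"

definition d where "d = (\<Sum>j\<in>{1..m}. int (e j))"

text \<open>The product $f / f_j$ of the other equations.\<close>

definition cof where "cof j = (\<Prod>k\<in>{1..m} - {j}. fs k)"

lemma f_eq_cof: "j \<in> {1..m} \<Longrightarrow> f = fs j * cof j"
  by (simp add: f_def cof_def prod.remove)

lemma hom_pdiff: "j \<in> {1..m} \<Longrightarrow> homogeneous (int (e j) - 1) (pdiff i (fs j))"
  by (intro homogeneous_pdiff hom)

lemma hom_f: "homogeneous d f"
  unfolding d_def f_def by (rule homogeneous_prod) (rule hom)

lemma d_pos: "d > 0"
proof -
  have "d \<ge> int (e 1)" unfolding d_def using m by (intro member_le_sum) auto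
  then show ?thesis using e[of 1] m by simp
qed

lemma dform_f: "dform f = (\<Sum>j\<in>{1..m}. cof j *s dform (fs j))"
  by (simp add: vec_eq_iff f_def cof_def pdiff_prod)

lemma Euler_at_point:
  assumes "j \<in> {1..m}" "peval (fs j) p = 0"
  shows "peval (dot position (dform (fs j))) p = 0"
  using Euler_dot[OF hom[OF assms(1)]] assms(2) by (simp add: peval_eq_subst)

text \<open>A common zero of the partial derivatives of $f_j$ would be a zero of $f_j$ by Euler's identity, and
hence a singular point of the curve.\<close>

lemma gradient: "j \<in> {1..m} \<Longrightarrow> no_common_zero_vector (dform (fs j)) (int (e j) - 1)"
proof (unfold_locales)
  assume j: "j \<in> {1..m}"
  show "homogeneous (int (e j) - 1) (dform (fs j) $ i)" for i using hom_pdiff[OF j] by simp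
  show "int (e j) - 1 > 0" using e[OF j] by simp
  fix v :: "complex ^ 3" assume v: "v \<noteq> 0"
  show "\<exists>i. peval (dform (fs j) $ i) v \<noteq> 0"
  proof (rule ccontr)
    assume "\<not> ?thesis"
    then have z: "peval (pdiff i (fs j)) v = 0" for i by simp
    have "peval (of_int (int (e j)) * fs j) v = peval (dot position (dform (fs j))) v"
      by (simp only: Euler_dot[OF hom[OF j]])
    also have "\<dots> = 0" using z by (simp add: dot_def peval_eq_subst)
    finally have "peval (Const (of_nat (e j)) * fs j) v = 0" by simp
    then have "of_nat (e j) * peval (fs j) v = 0"
      by (simp only: peval_eq_subst peval.subst_mult peval.subst_Const)
    then have "v \<in> curve (fs j)" using v e[OF j] by (auto simp: curve_def)
    then have "grad_at (fs j) v \<noteq> 0" using smooth[OF j] by (auto simp: smooth_curve_def)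
    then show False using z by (simp add: grad_at_def vec_eq_iff)
  qed
qed

lemma fs_nonzero: "j \<in> {1..m} \<Longrightarrow> fs j \<noteq> 0"
proof
  assume j: "j \<in> {1..m}" and "fs j = 0"
  then show False using no_common_zero_vector.nonzero[OF gradient[OF j]] by simp
qed

lemma f_nonzero: "f \<noteq> 0"
  using fs_nonzero by (simp add: f_def)

lemma nc_subset:
  assumes "A \<subseteq> {1..m}" "p \<noteq> 0" "\<And>j. j \<in> A \<Longrightarrow> peval (fs j) p = 0"
    and 0: "\<And>k. (\<Sum>j\<in>A. c j * peval (pdiff k (fs j)) p) = 0" and "j \<in> A"
  shows "c j = 0"
proof -
  define c' where "c' j = (if j \<in> A then c j else 0)" for j
  let ?B = "{j \<in> {1..m}. p \<in> curve (fs j)}"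
  have AB: "A \<subseteq> ?B" using assms by (auto simp: curve_def)
  have "(\<Sum>j\<in>?B. c' j *s grad_at (fs j) p) = (\<Sum>j\<in>A. c j *s grad_at (fs j) p)"
    using AB by (intro sum.mono_neutral_cong_right) (auto simp: c'_def)
  also have "\<dots> = 0" using 0 by (simp add: vec_eq_iff grad_at_def)
  finally have "\<forall>j\<in>{1..m}. p \<in> curve (fs j) \<longrightarrow> c' j = 0"
    using nc assms(2) by (auto simp: normal_crossing_def)
  then have "c' j = 0" using AB assms(5) by blast
  then show ?thesis using assms(5) by (simp add: c'_def)
qed

text \<open>If all 2-minors of the two gradients vanished at a common point, the gradients would be linearly
dependent there. The coefficients of the dependence are the $k$-th entries of the gradients, for an
index $k$ where the first gradient is nonzero.\<close>

lemma transversal: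
  assumes ij: "i \<in> {1..m}" "j \<in> {1..m}" "i \<noteq> j"
    and p: "p \<noteq> 0" "peval (fs i) p = 0" "peval (fs j) p = 0"
  shows "\<exists>l. peval (wedge (dform (fs i)) (dform (fs j)) $ l) p \<noteq> 0"
proof (rule ccontr)
  assume "\<not> ?thesis"
  then have z: "peval (wedge (dform (fs i)) (dform (fs j)) $ l) p = 0" for l by simp
  let ?u = "\<lambda>k. peval (pdiff k (fs i)) p" and ?v = "\<lambda>k. peval (pdiff k (fs j)) p"
  have uv: "?u k * ?v l = ?u l * ?v k" for k l
    using z[of 1] z[of 2] z[of 3] exhaust_3[of k] exhaust_3[of l]
    by (auto simp: peval_eq_subst mult.commute)
  obtain k where k: "?u k \<noteq> 0"
    using no_common_zero_vector.no_zero[OF gradient[OF ij(1)] p(1)] by auto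
  define c where "c x = (if x = i then ?v k else - ?u k)" for x
  have "c j = 0"
  proof (rule nc_subset[of "{i, j}" p])
    show "(\<Sum>x\<in>{i, j}. c x * peval (pdiff l (fs x)) p) = 0" for l
      using ij(3) uv[of k l] by (simp add: c_def mult.commute)
  qed (use ij p in auto)
  then show False using k ij(3) by (simp add: c_def)
qed

text \<open>By Euler's identity the three gradients at a common point $p$ are all orthogonal to $p$, so their
determinant is 0 and they are linearly dependent, with minors as coefficients.\<close>

lemma no_triple_point:
  assumes ijk: "i \<in> {1..m}" "j \<in> {1..m}" "k \<in> {1..m}" "i \<noteq> j" "i \<noteq> k" "j \<noteq> k"
    and p: "p \<noteq> 0" "peval (fs i) p = 0" "peval (fs j) p = 0"
  shows "peval (fs k) p \<noteq> 0"
proof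
  assume pk: "peval (fs k) p = 0"
  let ?a = "dform (fs i)" and ?b = "dform (fs j)" and ?c = "dform (fs k)"
  obtain l where l: "p $ l \<noteq> 0" using p(1) by (auto simp: vec_eq_iff)
  have "peval (position $ l * dot ?a (wedge ?b ?c)) p = 0"
    unfolding Cramer_identity
    using Euler_at_point[OF ijk(1) p(2)] Euler_at_point[OF ijk(2) p(3)] Euler_at_point[OF ijk(3) pk]
    by (simp add: peval_eq_subst)
  then have D: "peval (dot ?a (wedge ?b ?c)) p = 0" using l by (simp add: peval_eq_subst)
  obtain l where l: "peval (wedge ?a ?b $ l) p \<noteq> 0"
    using transversal[OF ijk(1,2,4) p] by blast
  define c where "c x = (if x = i then peval (wedge ?b ?c $ l) p else if x = j then peval (wedge ?c ?a $ l) p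
      else peval (wedge ?a ?b $ l) p)" for x
  have "c k = 0"
  proof (rule nc_subset[of "{i, j, k}" p])
    fix n
    have "peval (wedge ?b ?c $ l * ?a $ n + wedge ?c ?a $ l * ?b $ n + wedge ?a ?b $ l * ?c $ n) p
        = 0"
      using D by (simp only: Cramer_identity') (simp add: peval_eq_subst)
    then show "(\<Sum>x\<in>{i, j, k}. c x * peval (pdiff n (fs x)) p) = 0"
      using ijk by (simp add: c_def peval_eq_subst add.assoc)
  qed (use ijk p pk in auto)
  then show False using l ijk by (simp add: c_def)
qed

lemma regular_pair_fs:
  assumes ij: "i \<in> {1..m}" "j \<in> {1..m}" "i \<noteq> j"
  shows "regular_pair (fs i) (fs j)"
proof -
  have "{1, 2, 3} \<subseteq> {1..m}" using m by auto
  moreover have "card {1, 2, 3::nat} = 3" by simp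
  moreover have "card {i, j} = 2" using ij by simp
  ultimately have "\<not> {1, 2, 3} \<subseteq> {i, j}" using card_mono[of "{i, j}" "{1, 2, 3}"] by auto
  then obtain k where "k \<in> {1, 2, 3}" "k \<noteq> i" "k \<noteq> j" by blast
  then have k: "k \<in> {1..m}" "k \<noteq> i" "k \<noteq> j" using m by auto
  have "int (e k) > 0" using e[OF k(1)] by simp
  then show ?thesis
    by (rule regular_pair_of_no_common_zero[OF hom[OF ij(1)] hom[OF ij(2)] hom[OF k(1)]])
       (use no_triple_point[of i j k] ij k in auto)
qed

lemma regular_pair_cof: "j \<in> {1..m} \<Longrightarrow> regular_pair (fs j) (cof j)"
  unfolding cof_def by (rule regular_pair_prod) (auto intro: regular_pair_fs)

text \<open>The factors are taken up one at a time: $f_a$ forms a regular pair with the product of the others.\<close>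

lemma prod_dvd:
  assumes "A \<subseteq> {1..m}" "\<And>j. j \<in> A \<Longrightarrow> fs j dvd x"
  shows "(\<Prod>j\<in>A. fs j) dvd x"
proof -
  have "finite A" using assms(1) by (rule finite_subset) simp
  then show ?thesis using assms
  proof (induction A)
    case (insert a A)
    then obtain y where y: "x = (\<Prod>j\<in>A. fs j) * y" by (auto elim: dvdE)
    obtain z where z: "x = fs a * z" using insert.prems by (auto elim: dvdE)
    have "regular_pair (fs a) (\<Prod>j\<in>A. fs j)"
      using insert.prems insert.hyps by (intro regular_pair_prod regular_pair_fs) auto
    then obtain c where "z = (\<Prod>j\<in>A. fs j) * c"
      using y z regular_pairD by metis
    then have "x = (\<Prod>j\<in>insert a A. fs j) * c" using insert.hyps z by (simp add: mult.assoc)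
    then show ?case by simp
  qed simp
qed

lemma fs_dvd_cof: "i \<in> {1..m} \<Longrightarrow> j \<noteq> i \<Longrightarrow> fs i dvd cof j"
  unfolding cof_def by (intro dvd_prodI) auto

lemma dvd_cof_cancel:
  assumes j: "j \<in> {1..m}" and dv: "fs j dvd cof j * x"
  shows "fs j dvd x"
proof -
  obtain y where "fs j * y = cof j * x" using dv by (metis dvdE)
  from regular_pairD[OF regular_pair_cof[OF j] this] show ?thesis by auto
qed

end

context normal_crossing_curves
begin

section \<open>Residues of logarithmic forms\<close>

text \<open>The ideal of the reduced intersection of two transversal curves: $f_i$, $f_j$ and the 2-minors of
their gradients have no common zero.\<close>

lemma crossing_saturated:
  assumes ij: "i \<in> {1..m}" "j \<in> {1..m}" "i \<noteq> j"
    and r: "\<And>l. wedge (dform (fs i)) (dform (fs j)) $ l * r \<in> pideal.span {fs i, fs j}"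
  shows "r \<in> pideal.span {fs i, fs j}"
proof (rule saturated_wrt_no_common_zero[OF regular_pair_fs[OF ij]])
  let ?H = "{fs i, fs j} \<union> range (($) (wedge (dform (fs i)) (dform (fs j))))"
  fix h assume "h \<in> ?H"
  then consider "h = fs i" | "h = fs j" | l where "h = wedge (dform (fs i)) (dform (fs j)) $ l"
    by auto
  then show "\<exists>k. homogeneous k h"
  proof cases
    case (3 l)
    have "\<exists>k. homogeneous k (pdiff a (fs i) * pdiff b (fs j) - pdiff a' (fs i) * pdiff b' (fs j))"
      for a b a' b'
      by (intro exI[of _ "(int (e i) - 1)
          + (int (e j) - 1)"] homogeneous_diff homogeneous_mult hom_pdiff ij)
    then show ?thesis using exhaust_3[of l] by (auto simp: 3)
  qed (use hom ij in blast)+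
  from \<open>h \<in> ?H\<close> consider "h = fs i" | "h = fs j" | l where "h
      = wedge (dform (fs i)) (dform (fs j)) $ l"
    by auto
  then show "h * r \<in> pideal.span {fs i, fs j}"
  proof cases
    case 1
    then show ?thesis by (subst mult.commute) (auto intro: pideal.span_scale pideal.span_base)
  next
    case 2
    then show ?thesis by (subst mult.commute) (auto intro: pideal.span_scale pideal.span_base)
  qed (use r in simp)
next
  fix p :: "complex ^ 3" assume "p \<noteq> 0"
  then show "\<exists>h\<in>{fs i, fs j} \<union> range (($) (wedge (dform (fs i)) (dform (fs j)))). peval h p \<noteq> 0"
    using transversal[OF ij, of p] by auto
qed

text \<open>A third curve avoids the intersection of the first two, hence its equation is a nonzerodivisor
modulo their ideal.\<close>

lemma triple_saturated:
  assumes ijk: "i \<in> {1..m}" "j \<in> {1..m}" "k \<in> {1..m}" "i \<noteq> j" "i \<noteq> k" "j \<noteq> k"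
    and c: "fs k * c \<in> pideal.span {fs i, fs j}"
  shows "c \<in> pideal.span {fs i, fs j}"
proof (rule saturated_wrt_no_common_zero[OF regular_pair_fs[OF ijk(1,2,4)]])
  fix h assume h: "h \<in> {fs i, fs j, fs k}"
  then show "\<exists>k. homogeneous k h" using hom ijk by blast
  have "c * fs i \<in> pideal.span {fs i, fs j}" "c * fs j \<in> pideal.span {fs i, fs j}"
    by (intro pideal.span_scale pideal.span_base; simp)+
  with h c show "h * c \<in> pideal.span {fs i, fs j}" by (auto simp: mult.commute)
next
  fix p :: "complex ^ 3" assume "p \<noteq> 0"
  then show "\<exists>h\<in>{fs i, fs j, fs k}. peval h p \<noteq> 0"
    using no_triple_point[OF ijk, of p] by auto
qed

lemma triple_saturated_prod:
  assumes ij: "i \<in> {1..m}" "j \<in> {1..m}" "i \<noteq> j" and A: "finite A" "A \<subseteq> {1..m} - {i, j}"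
    and c: "c * (\<Prod>k\<in>A. fs k) \<in> pideal.span {fs i, fs j}"
  shows "c \<in> pideal.span {fs i, fs j}"
  using A c
proof (induction A arbitrary: c)
  case (insert a A)
  have "c * fs a * (\<Prod>k\<in>A. fs k) \<in> pideal.span {fs i, fs j}"
    using insert by (simp add: mult.assoc)
  then have "c * fs a \<in> pideal.span {fs i, fs j}" using insert by blast
  then have "fs a * c \<in> pideal.span {fs i, fs j}" by (simp add: mult.commute)
  then show ?case using insert.prems ij by (intro triple_saturated[of i j a c]) auto
qed simp

text \<open>An induction over the curves: if $r = s \prod_{i \in A} f_i + t f_j$ lies also in $(f_a, f_j)$, then
the product over \<open>A\<close> can be cancelled modulo $(f_a, f_j)$, and $s \in (f_a, f_j)$.\<close>

lemma mem_span_prod: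
  assumes j: "j \<in> {1..m}" and A: "finite A" "A \<subseteq> {1..m} - {j}"
    and r: "\<And>i. i \<in> A \<Longrightarrow> r \<in> pideal.span {fs i, fs j}"
  shows "\<exists>s t. r = s * (\<Prod>i\<in>A. fs i) + t * fs j"
  using A r
proof (induction A)
  case empty
  have "r = r * (\<Prod>i\<in>{}. fs i) + 0 * fs j" by simp
  then show ?case by blast
next
  case (insert a A)
  then obtain s t where st: "r = s * (\<Prod>i\<in>A. fs i) + t * fs j" by auto
  have a: "a \<in> {1..m}" "a \<noteq> j" "A \<subseteq> {1..m} - {a, j}" using insert by auto
  have "s * (\<Prod>i\<in>A. fs i) = r - t * fs j" by (simp add: st)
  also have "\<dots> \<in> pideal.span {fs a, fs j}"
    using insert.prems by (intro pideal.span_diff pideal.span_scale[of "fs j"] pideal.span_base[of "fs j"]) auto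
  finally have "s \<in> pideal.span {fs a, fs j}"
    by (rule triple_saturated_prod[OF a(1) j a(2) insert.hyps(1) a(3)])
  then obtain u v where uv: "s = u * fs a + v * fs j" by (auto simp: span_pair)
  have "r = u * (fs a * (\<Prod>i\<in>A. fs i)) + (v * (\<Prod>i\<in>A. fs i) + t) * fs j"
    by (simp add: st uv algebra_simps)
  also have "fs a * (\<Prod>i\<in>A. fs i) = (\<Prod>i\<in>insert a A. fs i)"
    using insert.hyps by simp
  finally show ?case by blast
qed

text \<open>Modulo $f_j$ the form $\alpha$ is proportional to $df_j$. The two middle terms of the Koszul complex
of the partial derivatives are used in turn: $\gamma$ is orthogonal to $df_j$, hence
$\gamma = df_j \wedge \beta$, and then $df_j \wedge (\alpha - f_j \beta) = 0$.\<close>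

lemma residue:
  assumes "j \<in> {1..m}" and \<alpha>: "wedge (dform (fs j)) \<alpha> = fs j *s \<gamma>" and E: "dot position \<alpha> = 0"
  shows "\<exists>r \<beta>. \<alpha> = r *s dform (fs j) + fs j *s \<beta>"
proof -
  interpret G: no_common_zero_vector "dform (fs j)" "int (e j) - 1" by (rule gradient[OF assms(1)])
  have "fs j * dot (dform (fs j)) \<gamma> = dot (dform (fs j)) (wedge (dform (fs j)) \<alpha>)"
    by (simp only: \<alpha> dot_algebra(2))
  also have "\<dots> = 0" by (rule dot_algebra)
  finally have "dot (dform (fs j)) \<gamma> = 0" using fs_nonzero[OF assms(1)] by simp
  then obtain \<beta> where \<beta>: "\<gamma> = wedge (dform (fs j)) \<beta>" using G.koszul_dot by blast
  have "wedge (dform (fs j)) (\<alpha> - fs j *s \<beta>) = 0"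
    by (simp add: wedge_algebra \<alpha> \<beta>)
  then obtain r where "\<alpha> - fs j *s \<beta> = r *s dform (fs j)" using G.koszul_wedge by blast
  then have "\<alpha> = r *s dform (fs j) + fs j *s \<beta>" by (simp add: eq_diff_eq diff_eq_eq)
  then show ?thesis by blast
qed

text \<open>The residues $r_j$ extend to multiples of $F_j$. Wedging two local expressions of $\alpha$ with
$df_i$ shows that the minors of $df_i, df_j$ multiply $r_j$ into $(f_i, f_j)$.\<close>

lemma log_form_decomposition:
  assumes res: "\<And>j. j \<in> {1..m} \<Longrightarrow> \<exists>r \<beta>. \<alpha> = r *s dform (fs j) + fs j *s \<beta>"
  shows "\<exists>g \<beta>. \<alpha> = (\<Sum>j\<in>{1..m}. (g j * cof j) *s dform (fs j)) + f *s \<beta>"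
proof -
  from res have "\<forall>j\<in>{1..m}. \<exists>r \<beta>. \<alpha> = r *s dform (fs j) + fs j *s \<beta>" by blast
  then obtain r \<beta> where r\<beta>: "\<And>j. j \<in> {1..m} \<Longrightarrow> \<alpha> = r j *s dform (fs j) + fs j *s \<beta> j"
    by (metis (no_types))
  have r: "r j \<in> pideal.span {fs i, fs j}" if ij: "i \<in> {1..m}" "j \<in> {1..m}" "i \<noteq> j" for i j
  proof (rule crossing_saturated[OF ij])
    fix l
    let ?a = "dform (fs i)" and ?b = "dform (fs j)"
    have "r j *s wedge ?a ?b + fs j *s wedge ?a (\<beta> j) = wedge ?a \<alpha>"
      by (subst r\<beta>[OF ij(2)]) (simp add: wedge_algebra)
    also have "\<dots> = fs i *s wedge ?a (\<beta> i)"
      by (subst r\<beta>[OF ij(1)]) (simp add: wedge_algebra)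
    finally have "r j *s wedge ?a ?b + fs j *s wedge ?a (\<beta> j) = fs i *s wedge ?a (\<beta> i)" .
    from arg_cong[OF this, of "\<lambda>v. v $ l"]
    have "wedge ?a ?b $ l * r j = wedge ?a (\<beta> i) $ l * fs i + (- (wedge ?a (\<beta> j) $ l)) * fs j"
      by (simp add: algebra_simps)
    then show "wedge ?a ?b $ l * r j \<in> pideal.span {fs i, fs j}" unfolding span_pair by blast
  qed
  have "\<exists>s t. r j = s * cof j + t * fs j" if "j \<in> {1..m}" for j
    unfolding cof_def using that r by (intro mem_span_prod) auto
  then obtain g t where gt: "\<And>j. j \<in> {1..m} \<Longrightarrow> r j = g j * cof j + t j * fs j"
    by (metis (no_types))
  define \<rho> where "\<rho> = \<alpha> - (\<Sum>j\<in>{1..m}. (g j * cof j) *s dform (fs j))"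
  have "fs k dvd \<rho> $ l" if k: "k \<in> {1..m}" for k l
  proof -
    have "\<rho> $ l = (r k * pdiff l (fs k) + fs k * \<beta> k $ l)
        - (\<Sum>j\<in>{1..m}. g j * cof j * pdiff l (fs j))"
      unfolding \<rho>_def by (subst r\<beta>[OF k]) simp
    also have "(\<Sum>j\<in>{1..m}. g j * cof j * pdiff l (fs j)) =
        g k * cof k * pdiff l (fs k) + (\<Sum>j\<in>{1..m} - {k}. g j * cof j * pdiff l (fs j))"
      using k by (subst sum.remove[of _ k]) auto
    also have "(r k * pdiff l (fs k) + fs k * \<beta> k $ l) - \<dots> =
        fs k * (t k * pdiff l (fs k) + \<beta> k $ l) - (\<Sum>j\<in>{1..m} - {k}. g j * cof j * pdiff l (fs j))"
      by (simp add: gt[OF k] algebra_simps)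
    also have "fs k dvd \<dots>"
      using k by (intro dvd_diff dvd_sum dvd_mult2[of _ "_
          * cof _"] dvd_mult[of _ "cof _"] fs_dvd_cof) auto
    finally show ?thesis .
  qed
  then have "f dvd \<rho> $ l" for l unfolding f_def by (intro prod_dvd) auto
  then have "\<exists>\<beta>. \<forall>l. \<rho> $ l = f * \<beta> $ l" by (intro vec3_exists) (auto elim: dvdE)
  then obtain \<beta>' where "\<And>l. \<rho> $ l = f * \<beta>' $ l" by blast
  then have "\<rho> = f *s \<beta>'" by (simp add: vec_eq_iff)
  then have "\<alpha> = (\<Sum>j\<in>{1..m}. (g j * cof j) *s dform (fs j)) + f *s \<beta>'"
    by (simp add: \<rho>_def diff_eq_eq add.commute)
  then show ?thesis by blast
qed

section \<open>The syzygies $\omega_j$ and their relations\<close>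

text \<open>The identity $\omega_j = df \wedge df_j / f_j$ with the denominator cleared. It is also the relation
$\rho_j$, since $df \wedge df_j = \sum_k \partial_k f_j\, (df \wedge dx_k)$.\<close>

lemma wedge_dform_f:
  assumes j: "j \<in> {1..m}"
  shows "wedge (dform f) (dform (fs j)) = fs j *s omega m fs j"
proof -
  have "wedge (dform f) (dform (fs j)) = (\<Sum>i\<in>{1..m}. cof i *s wedge (dform (fs i)) (dform (fs j)))"
    by (simp add: dform_f wedge_sum wedge_algebra)
  also have "\<dots> = (\<Sum>i\<in>{1..m} - {j}. cof i *s wedge (dform (fs i)) (dform (fs j)))"
    using j by (subst sum.remove[of _ j]) (auto simp: wedge_algebra)
  also have "\<dots> = (\<Sum>i\<in>{1..m} - {j}. fs j *s ((\<Prod>k\<in>{1..m} - {i, j}. fs k) *s wedge (dform (fs i)) (dform (fs j))))"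
  proof (rule sum.cong[OF refl])
    fix i assume "i \<in> {1..m} - {j}"
    then have "cof i = fs j * (\<Prod>k\<in>{1..m} - {i} - {j}. fs k)"
      unfolding cof_def using j by (intro prod.remove) auto
    moreover have "{1..m} - {i} - {j} = {1..m} - {i, j}" by auto
    ultimately show "cof i *s wedge (dform (fs i)) (dform (fs j)) =
        fs j *s ((\<Prod>k\<in>{1..m} - {i, j}. fs k) *s wedge (dform (fs i)) (dform (fs j)))"
      by (simp only: vector_smult_assoc)
  qed
  also have "\<dots> = fs j *s omega m fs j"
    by (simp only: omega_def scale_sum)
  finally show ?thesis .
qed

lemma wedge_omega_var:
  "wedge (dform f) \<beta> = \<beta> $ 1 *s omega_var f 1 + \<beta> $ 2 *s omega_var f 2 + \<beta> $ 3 *s omega_var f 3"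
  by (rule vec3_eqI) (simp_all add: omega_var_def pdiff_var algebra_simps)

lemma rho_relation:
  assumes j: "j \<in> {1..m}"
  shows "fs j *s omega m fs j - (pdiff 1 (fs j) *s omega_var f 1 +
           pdiff 2 (fs j) *s omega_var f 2 + pdiff 3 (fs j) *s omega_var f 3) = 0"
  using wedge_dform_f[OF j] wedge_omega_var[of "dform (fs j)"] by simp

lemma sum_omega: "(\<Sum>j\<in>{1..m}. omega m fs j) = 0"
proof -
  have "f *s (\<Sum>j\<in>{1..m}. omega m fs j) = (\<Sum>j\<in>{1..m}. f *s omega m fs j)"
    by (simp add: vec_eq_iff sum_distrib_left)
  also have "\<dots> = (\<Sum>j\<in>{1..m}. cof j *s wedge (dform f) (dform (fs j)))"
  proof (rule sum.cong[OF refl])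
    fix j assume j: "j \<in> {1..m}"
    have "f *s omega m fs j = (cof j * fs j) *s omega m fs j"
      by (simp only: f_eq_cof[OF j] mult.commute)
    then show "f *s omega m fs j = cof j *s wedge (dform f) (dform (fs j))"
      by (simp only: wedge_dform_f[OF j] vector_smult_assoc)
  qed
  also have "\<dots> = wedge (dform f) (dform f)"
    by (subst (2) dform_f) (simp only: wedge_sum wedge_algebra(4))
  also have "\<dots> = f *s 0" by (simp add: wedge_algebra)
  finally show ?thesis using f_nonzero by (simp only: scale_cancel) simp
qed

lemma split_last: "(\<Sum>j\<in>{1..m}. G j) = (\<Sum>j\<in>{1..<m}. G j) + G m"
proof -
  have "{1..m} = insert m {1..<m}" using m by auto
  then show ?thesis by (simp add: add.commute)
qed

lemma omega_last: "omega m fs m = - (\<Sum>i=1..<m. omega m fs i)"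
  using sum_omega unfolding split_last[of "omega m fs"]
    by (simp add: eq_neg_iff_add_eq_0 add.commute)

lemma scale_of_int_d: "(of_int d :: cpoly) * Const (1 / of_int d) = 1"
proof -
  have "(of_int d :: cpoly) * Const (1 / of_int d) = Const (of_int d) * Const (1 / of_int d)"
    by simp
  also have "\<dots> = Const (of_int d * (1 / of_int d))" by (simp only: const.hom_mult)
  also have "\<dots> = 1" using d_pos by simp
  finally show ?thesis .
qed

text \<open>The coefficients $g_j - g_m$ come from eliminating $\omega_m = -\sum_{j<m} \omega_j$, and division by
$-\deg(f)$ is possible in characteristic 0.\<close>

theorem omega_generate:
  assumes \<theta>: "dot \<theta> (dform f) = 0"
  shows "\<exists>g \<beta>. \<theta> = (\<Sum>j\<in>{1..<m}. g j *s omega m fs j) + wedge (dform f) \<beta>"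
proof -
  define \<alpha> where "\<alpha> = wedge position \<theta>"
  \<comment> \<open>All summands of $\theta(f)$ except the one with index $j$ contain the factor $f_j$.\<close>
  have log: "fs j dvd dot \<theta> (dform (fs j))" if j: "j \<in> {1..m}" for j
  proof -
    have "0 = (\<Sum>i\<in>{1..m}. cof i * dot \<theta> (dform (fs i)))"
      using \<theta> by (simp add: dform_f dot_sum dot_algebra)
    also have "\<dots> = cof j * dot \<theta> (dform (fs j)) + (\<Sum>i\<in>{1..m} - {j}. cof i * dot \<theta> (dform (fs i)))"
      using j by (subst sum.remove[of _ j]) auto
    finally have "cof j * dot \<theta> (dform (fs j)) = - (\<Sum>i\<in>{1..m} - {j}. cof i * dot \<theta> (dform (fs i)))"
      by (simp add: eq_neg_iff_add_eq_0)
    also have "fs j dvd \<dots>"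
      using j fs_dvd_cof by (subst dvd_minus_iff, intro dvd_sum dvd_mult2) auto
    finally show ?thesis by (rule dvd_cof_cancel[OF j])
  qed
  have "\<exists>r \<beta>. \<alpha> = r *s dform (fs j) + fs j *s \<beta>" if j: "j \<in> {1..m}" for j
  proof -
    obtain h where h: "dot \<theta> (dform (fs j)) = fs j * h" using log[OF j] by (auto elim: dvdE)
    have "wedge (dform (fs j)) \<alpha> = fs j *s (h *s position - of_int (int (e j)) *s \<theta>)"
      using h Euler_dot[OF hom[OF j]]
      by (simp add: \<alpha>_def wedge_wedge dot_commute[of "dform (fs j)"] vec_eq_iff algebra_simps)
    then show ?thesis by (rule residue[OF j]) (simp add: \<alpha>_def dot_algebra)
  qed
  from log_form_decomposition[OF this] obtain g \<beta> where g\<beta>: "\<alpha>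
      = (\<Sum>j\<in>{1..m}. (g j * cof j) *s dform (fs j)) + f *s \<beta>"
    by blast
  have "f *s ((- of_int d) *s \<theta>) = wedge (dform f) \<alpha>"
    using \<theta> Euler_dot[OF hom_f]
    by (simp add: \<alpha>_def wedge_wedge dot_commute[of "dform f"] vec_eq_iff mult_ac)
  also have "\<dots> = (\<Sum>j\<in>{1..m}. (g j * cof j) *s (fs j *s omega m fs j)) + f *s wedge (dform f) \<beta>"
    unfolding g\<beta> by (simp add: wedge_algebra wedge_sum wedge_dform_f)
  also have "\<dots> = f *s ((\<Sum>j\<in>{1..m}. g j *s omega m fs j) + wedge (dform f) \<beta>)"
  proof -
    have "(\<Sum>j\<in>{1..m}. (g j * cof j) *s (fs j *s omega m fs j))
        = (\<Sum>j\<in>{1..m}. f *s (g j *s omega m fs j))"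
      by (rule sum.cong) (auto simp: f_eq_cof vector_smult_assoc mult_ac)
    then show ?thesis by (simp only: scale_sum vector_add_ldistrib)
  qed
  finally have "(- of_int d) *s \<theta> = (\<Sum>j\<in>{1..m}. g j *s omega m fs j) + wedge (dform f) \<beta>"
    using f_nonzero by (simp only: scale_cancel) simp
  also have "(\<Sum>j\<in>{1..m}. g j *s omega m fs j) = (\<Sum>j\<in>{1..<m}. (g j - g m) *s omega m fs j)"
    unfolding split_last omega_last
    by (simp add: vec_eq_iff sum_subtractf sum_distrib_left left_diff_distrib)
  finally have \<theta>': "(- of_int d) *s \<theta>
      = (\<Sum>j\<in>{1..<m}. (g j - g m) *s omega m fs j) + wedge (dform f) \<beta>" .
  let ?c = "- Const (1 / of_int d)"
  have "\<theta> = ?c *s ((- of_int d) *s \<theta>)"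
    using scale_of_int_d by (simp add: vec_eq_iff mult.commute flip: mult.assoc)
  also have "\<dots> = (\<Sum>j\<in>{1..<m}. (?c * (g j - g m)) *s omega m fs j) + wedge (dform f) (?c *s \<beta>)"
    unfolding \<theta>' wedge_algebra(4) by (simp add: vec_eq_iff sum_distrib_left algebra_simps sum_negf)
  finally show ?thesis by (intro exI)
qed

text \<open>The syzygies among the generators. The coefficient of $\omega_j$ is $t_j f_j - t_m f_m$ because
$\omega_m$ is eliminated from $\rho_m$.\<close>

theorem omega_relations:
  assumes rel: "(\<Sum>j\<in>{1..<m}. g j *s omega m fs j) + wedge (dform f) \<beta> = 0"
  shows "\<exists>t. (\<forall>j\<in>{1..<m}. g j = t j * fs j - t m * fs m) \<and> \<beta> = - (\<Sum>j\<in>{1..m}. t j *s dform (fs j))"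
proof -
  \<comment> \<open>All $m$ curves enter symmetrically if $\omega_m$ gets the coefficient 0.\<close>
  define g' where "g' j = (if j = m then 0 else g j)" for j
  define \<alpha> where "\<alpha> = (\<Sum>j\<in>{1..m}. (g' j * cof j) *s dform (fs j)) + f *s \<beta>"
  have "wedge (dform f) \<alpha> = (\<Sum>j\<in>{1..m}. f *s (g' j *s omega m fs j)) + f *s wedge (dform f) \<beta>"
  proof -
    have "(\<Sum>j\<in>{1..m}. (g' j * cof j) *s (fs j *s omega m fs j))
        = (\<Sum>j\<in>{1..m}. f *s (g' j *s omega m fs j))"
      by (rule sum.cong) (auto simp: f_eq_cof vector_smult_assoc mult_ac)
    then show ?thesis by (simp add: \<alpha>_def wedge_algebra wedge_sum wedge_dform_f)
  qed
  also have "\<dots> = f *s ((\<Sum>j\<in>{1..m}. g' j *s omega m fs j) + wedge (dform f) \<beta>)"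
    by (simp only: scale_sum vector_add_ldistrib)
  also have "(\<Sum>j\<in>{1..m}. g' j *s omega m fs j) = (\<Sum>j\<in>{1..<m}. g j *s omega m fs j)"
    unfolding split_last by (auto simp: g'_def intro!: sum.cong)
  finally have "wedge (dform f) \<alpha> = 0" unfolding rel by simp
  \<comment> \<open>Wedging with $E$ gives $(E \cdot \alpha)\, df = \deg(f)\, f\, \alpha$, so $\alpha$ is a multiple of $df$ once
    $f$ divides $E \cdot \alpha$.\<close>
  then have "wedge position (wedge (dform f) \<alpha>) = 0" by (simp add: wedge_algebra)
  then have \<alpha>f: "dot position \<alpha> *s dform f = (of_int d * f) *s \<alpha>"
    using Euler_dot[OF hom_f] by (simp add: wedge_wedge)
  have "fs j dvd dot position \<alpha>" if j: "j \<in> {1..m}" for j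
  proof -
    interpret G: no_common_zero_vector "dform (fs j)" "int (e j) - 1" by (rule gradient[OF j])
    have "fs j dvd dot position \<alpha> * pdiff l (fs j)" for l
    proof (rule dvd_cof_cancel[OF j])
      have "(of_int d * f) * \<alpha> $ l = dot position \<alpha> * (\<Sum>i\<in>{1..m}. cof i * pdiff l (fs i))"
        using arg_cong[OF \<alpha>f, of "\<lambda>v. v $ l"] by (simp add: dform_f)
      also have "\<dots> = dot position \<alpha> * (cof j * pdiff l (fs j))
          + dot position \<alpha> * (\<Sum>i\<in>{1..m} - {j}. cof i * pdiff l (fs i))"
        using j by (subst sum.remove[of _ j]) (auto simp: distrib_left)
      finally have "cof j * (dot position \<alpha> * pdiff l (fs j)) =
          f * (of_int d * \<alpha> $ l) - dot position \<alpha> * (\<Sum>i\<in>{1..m} - {j}. cof i * pdiff l (fs i))"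
        by (simp add: algebra_simps)
      also have "fs j dvd \<dots>"
        using j fs_dvd_cof f_eq_cof[OF j] by (intro dvd_diff dvd_mult2[of _ f] dvd_mult[of _ "sum _ _"] dvd_sum dvd_mult2[of _ "cof _"]) auto
      finally show "fs j dvd cof j * (dot position \<alpha> * pdiff l (fs j))" .
    qed
    then have "\<exists>b. \<forall>l. dot position \<alpha> * pdiff l (fs j) = fs j * b $ l"
      by (intro vec3_exists) (auto elim: dvdE)
    then obtain b where "\<And>l. dot position \<alpha> * pdiff l (fs j) = fs j * b $ l" by blast
    then have "dot position \<alpha> *s dform (fs j) = fs j *s b" by (simp add: vec_eq_iff)
    then show ?thesis using G.dvd_if_scale_dvd fs_nonzero[OF j] by blast
  qed
  then have "f dvd dot position \<alpha>" unfolding f_def by (intro prod_dvd) auto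
  then obtain s' where s': "dot position \<alpha> = f * s'" by (auto elim: dvdE)
  define s where "s = Const (1 / of_int d) * s'"
  have s: "dot position \<alpha> = of_int d * f * s"
    using scale_of_int_d by (simp add: s' s_def mult.left_commute mult.assoc)
  have "(of_int d * f) *s \<alpha> = (of_int d * f) *s (s *s dform f)"
    using \<alpha>f by (simp add: s vector_smult_assoc)
  moreover have "(of_int d :: cpoly) \<noteq> 0" using scale_of_int_d by auto
  ultimately have \<alpha>s: "\<alpha> = s *s dform f"
    using f_nonzero by (simp only: scale_cancel) simp
  have zero: "(\<Sum>j\<in>{1..m}. ((g' j - s) * cof j) *s dform (fs j)) + f *s \<beta> = 0"
  proof -
    have "(\<Sum>j\<in>{1..m}. ((g' j - s) * cof j) *s dform (fs j)) =
        (\<Sum>j\<in>{1..m}. (g' j * cof j) *s dform (fs j)) - s *s dform f"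
      by (simp add: dform_f vec_eq_iff left_diff_distrib sum_subtractf sum_distrib_left mult.assoc)
    also have "\<dots> = - (f *s \<beta>)" using \<alpha>s by (simp add: \<alpha>_def algebra_simps)
    finally show ?thesis by simp
  qed
  have dvd: "fs j dvd g' j - s" if j: "j \<in> {1..m}" for j
  proof -
    interpret G: no_common_zero_vector "dform (fs j)" "int (e j) - 1" by (rule gradient[OF j])
    have "fs j dvd (g' j - s) * pdiff l (fs j)" for l
    proof (rule dvd_cof_cancel[OF j])
      have "0 = (\<Sum>i\<in>{1..m}. (g' i - s) * cof i * pdiff l (fs i)) + f * \<beta> $ l"
        using arg_cong[OF zero, of "\<lambda>v. v $ l"] by simp
      also have "\<dots> = (g' j - s) * cof j * pdiff l (fs j)
          + (\<Sum>i\<in>{1..m} - {j}. (g' i - s) * cof i * pdiff l (fs i)) + f * \<beta> $ l"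
        using j by (subst sum.remove[of _ j]) auto
      finally have "(g' j - s) * cof j * pdiff l (fs j) =
          - ((\<Sum>i\<in>{1..m} - {j}. (g' i - s) * cof i * pdiff l (fs i)) + f * \<beta> $ l)"
        unfolding eq_neg_iff_add_eq_0 by (simp only: add.assoc)
      then have "cof j * ((g' j - s) * pdiff l (fs j)) =
          - ((\<Sum>i\<in>{1..m} - {j}. (g' i - s) * cof i * pdiff l (fs i)) + f * \<beta> $ l)"
        by (simp only: mult_ac)
      also have "fs j dvd \<dots>"
        using j fs_dvd_cof f_eq_cof[OF j]
        by (subst dvd_minus_iff, intro dvd_add dvd_sum dvd_mult2[of _ "_
            * cof _"] dvd_mult[of _ "cof _"] dvd_mult2[of _ f]) auto
      finally show "fs j dvd cof j * ((g' j - s) * pdiff l (fs j))" .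
    qed
    then have "\<exists>b. \<forall>l. (g' j - s) * pdiff l (fs j) = fs j * b $ l"
      by (intro vec3_exists) (auto elim: dvdE)
    then obtain b where "\<And>l. (g' j - s) * pdiff l (fs j) = fs j * b $ l" by blast
    then have "(g' j - s) *s dform (fs j) = fs j *s b"
      by (simp only: vec_eq_iff vector_smult_component dform_nth simp_thms)
    then show ?thesis using G.dvd_if_scale_dvd fs_nonzero[OF j] by blast
  qed
  have "\<forall>j\<in>{1..m}. \<exists>t. g' j - s = fs j * t" using dvd unfolding dvd_def by blast
  then obtain t where t: "\<And>j. j \<in> {1..m} \<Longrightarrow> g' j - s = fs j * t j" by metis
  have "(\<Sum>j\<in>{1..m}. ((g' j - s) * cof j) *s dform (fs j)) = (\<Sum>j\<in>{1..m}. f *s (t j *s dform (fs j)))"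
    by (rule sum.cong) (auto simp: t f_eq_cof vector_smult_assoc mult_ac)
  then have "f *s ((\<Sum>j\<in>{1..m}. t j *s dform (fs j)) + \<beta>) = f *s 0"
    using zero by (simp only: scale_sum vector_add_ldistrib) simp
  then have "(\<Sum>j\<in>{1..m}. t j *s dform (fs j)) + \<beta> = 0"
    using f_nonzero by (simp only: scale_cancel) simp
  then have "\<beta> = - (\<Sum>j\<in>{1..m}. t j *s dform (fs j))" by (simp add: eq_neg_iff_add_eq_0 add.commute)
  moreover have "s = - (fs m * t m)"
    using t[of m] m by (simp add: g'_def) (metis minus_minus)
  then have "g j = t j * fs j - t m * fs m" if "j \<in> {1..<m}" for j
    using t[of j] that by (simp add: g'_def algebra_simps)
  ultimately show ?thesis by blast
qed

text \<open>The hypotheses say that the combination of the $\rho_j$ with coefficients $t_j$ is zero,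
coordinate by coordinate.\<close>

theorem rho_independent:
  assumes eq: "\<And>j. j \<in> {1..<m} \<Longrightarrow> t j * fs j = t m * fs m"
    and 0: "(\<Sum>j\<in>{1..m}. t j *s dform (fs j)) = 0" and j: "j \<in> {1..m}"
  shows "t j = 0"
proof -
  have eq': "t i * fs i = t m * fs m" if "i \<in> {1..m}" for i
    using eq[of i] that by (cases "i = m") auto
  have "0 = (\<Sum>i\<in>{1..m}. t i * dot position (dform (fs i)))"
    using arg_cong[OF 0, of "dot position"] by (simp add: dot_sum dot_algebra)
  also have "\<dots> = (\<Sum>i\<in>{1..m}. of_int (int (e i)) * (t m * fs m))"
  proof (rule sum.cong[OF refl])
    fix i assume i: "i \<in> {1..m}"
    show "t i * dot position (dform (fs i)) = of_int (int (e i)) * (t m * fs m)"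
      unfolding eq'[OF i, symmetric] Euler_dot[OF hom[OF i]] by (rule mult.left_commute)
  qed
  also have "\<dots> = of_int d * (t m * fs m)"
    by (simp add: d_def sum_distrib_right)
  finally have "of_int d * (t m * fs m) = 0" by simp
  moreover have "(of_int d :: cpoly) \<noteq> 0" using scale_of_int_d by auto
  ultimately have "t j * fs j = 0" using eq'[OF j] by simp
  then show ?thesis using fs_nonzero[OF j] by simp
qed

end

section \<open>Ideals of S\<close>

text \<open>The link between ideals of the ring record and those of the type class.\<close>

lemma ideal_Sring_iff: "Ideal.ideal I Sring \<longleftrightarrow> pideal.subspace I"
proof
  assume "Ideal.ideal I Sring"
  then interpret I: Ideal.ideal I Sring .
  show "pideal.subspace I"
  proof (rule pideal.subspaceI)
    show "0 \<in> I" using additive_subgroup.zero_closed[OF I.additive_subgroup_axioms]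
      by (simp add: Sring_def)
    show "x + y \<in> I" if "x \<in> I" "y \<in> I" for x y
      using additive_subgroup.a_closed[OF I.additive_subgroup_axioms that] by (simp add: Sring_def)
    show "c * x \<in> I" if "x \<in> I" for c x
      using I.I_l_closed[OF that, of c] by (simp add: Sring_def)
  qed
next
  assume I: "pideal.subspace I"
  interpret S: cring Sring by (rule cring_Sring)
  have inv: "inv\<^bsub>add_monoid Sring\<^esub> x = - x" for x
    using S.minus_equality[of "- x" x] by (simp add: a_inv_def Sring_def)
  show "Ideal.ideal I Sring"
  proof (rule idealI)
    show "ring Sring" by (rule S.ring_axioms)
    show "subgroup I (add_monoid Sring)"
    proof (unfold_locales)
      show "inv\<^bsub>add_monoid Sring\<^esub> x \<in> I" if "x \<in> I" for x
        unfolding inv by (rule pideal.subspace_neg[OF I that])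
    qed (use pideal.subspace_0[OF I] pideal.subspace_add[OF I] in \<open>auto simp: Sring_def\<close>)
  qed (use pideal.subspace_scale[OF I] in \<open>auto simp: Sring_def mult.commute\<close>)
qed

lemma genideal_Sring: "genideal Sring X = pideal.span X"
  unfolding genideal_def ideal_Sring_iff pideal.span_def hull_def by (rule refl)

text \<open>Euler's identity exhibits $g$ as a combination of the variables.\<close>

lemma homogeneous_in_irrelevant_ideal:
  assumes "homogeneous k g" "k > 0" shows "g \<in> irrelevant_ideal"
proof -
  have "(\<Sum>i\<in>UNIV. Const (1 / of_int k) * pdiff i g * var i)
      = Const (1 / of_int k) * (\<Sum>i\<in>UNIV. var i * pdiff i g)"
    by (simp add: sum_distrib_left mult_ac)
  also have "\<dots> = Const (1 / of_int k) * (Const (of_int k) * g)"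
    by (simp add: Euler_identity[OF assms(1)])
  also have "\<dots> = Const (1 / of_int k * of_int k) * g"
    by (simp only: const.hom_mult mult.assoc)
  also have "\<dots> = g" using assms(2) by simp
  finally have g: "g = (\<Sum>i\<in>UNIV. Const (1 / of_int k) * pdiff i g * var i)" ..
  have "var i \<in> {var 1, var 2, var 3}" for i using exhaust_3[of i] by auto
  then show ?thesis
    unfolding irrelevant_ideal_def genideal_Sring
    by (subst g) (intro pideal.span_sum pideal.span_scale pideal.span_base)
qed

lemma irrelevant_ideal_subspace: "pideal.subspace irrelevant_ideal"
  by (simp add: irrelevant_ideal_def genideal_Sring)

lemma irrelevant_ideal_mult: "a \<in> irrelevant_ideal \<Longrightarrow> b * a \<in> irrelevant_ideal"
  by (rule pideal.subspace_scale[OF irrelevant_ideal_subspace])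

lemmas irrelevant_ideal_closed =
  pideal.subspace_0[OF irrelevant_ideal_subspace] pideal.subspace_add[OF irrelevant_ideal_subspace]
  pideal.subspace_diff[OF irrelevant_ideal_subspace] pideal.subspace_sum[OF irrelevant_ideal_subspace]

section \<open>Graded free modules\<close>

abbreviation coord :: "fvec \<Rightarrow> nat \<Rightarrow> cpoly" where "coord \<equiv> Poly_Mapping.lookup"

lemma free_module_simps:
  "u \<in> carrier (free_module as) \<longleftrightarrow> (\<forall>i\<ge>length as. coord u i = 0)"
  "u \<oplus>\<^bsub>free_module as\<^esub> v = u + v" "s \<odot>\<^bsub>free_module as\<^esub> u = fscale s u" "\<zero>\<^bsub>free_module as\<^esub> = 0"
  "u \<in> grade (free_module as) k
      \<longleftrightarrow> (\<forall>i\<ge>length as. coord u i = 0) \<and> (\<forall>i<length as. homogeneous (as ! i + k) (coord u i))"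
proof -
  have "Poly_Mapping.keys u \<subseteq> {..<length as} \<longleftrightarrow> (\<forall>i\<ge>length as. coord u i = 0)"
    by (auto simp: subset_iff in_keys_iff not_less) (meson leI)
  then show "u \<in> carrier (free_module as) \<longleftrightarrow> (\<forall>i\<ge>length as. coord u i = 0)"
    "u \<in> grade (free_module as) k
        \<longleftrightarrow> (\<forall>i\<ge>length as. coord u i = 0) \<and> (\<forall>i<length as. homogeneous (as ! i + k) (coord u i))"
    by (simp_all add: free_module_def)
qed (simp_all add: free_module_def)

lemma free_module_Nil: "u \<in> carrier (free_module []) \<longleftrightarrow> u = 0"
  by (auto simp: free_module_simps poly_mapping_eq_iff fun_eq_iff)

lemma fscale_0 [simp]: "fscale s 0 = 0"
  by (rule poly_mapping_eqI) simp

lemma graded_hom_zero: "graded_hom (free_module as) (free_module bs) (\<lambda>_. 0)"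
  by (auto simp: graded_hom_def free_module_simps)

lemma D0_simps:
  "v \<in> carrier (D0 f) \<longleftrightarrow> dot v (dform f) = 0" "u \<oplus>\<^bsub>D0 f\<^esub> v = u + v" "s \<odot>\<^bsub>D0 f\<^esub> v = s *s v" "\<zero>\<^bsub>D0 f\<^esub>
      = 0"
  "v \<in> grade (D0 f) k \<longleftrightarrow> dot v (dform f) = 0 \<and> (\<forall>i. homogeneous k (v $ i))"
  by (simp_all add: D0_def dot_def)

lemma coord_basis: "coord (basis i) n = (if n = i then 1 else 0)"
  by (simp add: basis_def lookup_single when_def)

lemma vector3_nth:
  "homogeneous k a \<Longrightarrow> homogeneous k b \<Longrightarrow> homogeneous k c \<Longrightarrow> homogeneous k (vector [a, b, c] $ (i::3))"
  using exhaust_3[of i] by auto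

lemma homogeneous_wedge:
  assumes a: "\<And>i. homogeneous k (a $ i)" and b: "\<And>i. homogeneous l (b $ i)"
  shows "homogeneous (k + l) (wedge a b $ n)"
proof -
  have "homogeneous (k + l) (a $ i * b $ j - a $ i' * b $ j')" for i j i' j'
    by (intro homogeneous_diff homogeneous_mult a b)
  then show ?thesis using exhaust_3[of n] by auto
qed

section \<open>The Jacobian algebra as a graded module\<close>

lemma jacobian_algebra_simps:
  fixes f :: cpoly
  defines "J \<equiv> jacobian_ideal f" and "\<pi> \<equiv> \<lambda>g. jacobian_ideal f +>\<^bsub>Sring\<^esub> g"
  shows "carrier (jacobian_algebra f) = range \<pi>"
    "\<pi> a \<oplus>\<^bsub>jacobian_algebra f\<^esub> \<pi> b = \<pi> (a + b)"
    "s \<odot>\<^bsub>jacobian_algebra f\<^esub> \<pi> a = \<pi> (s * a)"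
    "\<pi> a = \<zero>\<^bsub>jacobian_algebra f\<^esub> \<longleftrightarrow> a \<in> pideal.span {pdiff 1 f, pdiff 2 f, pdiff 3 f}"
    "grade (jacobian_algebra f) k = \<pi> ` {g. homogeneous k g}"
proof -
  interpret S: cring Sring by (rule cring_Sring)
  have J: "J = pideal.span {pdiff 1 f, pdiff 2 f, pdiff 3 f}"
    by (simp add: J_def jacobian_ideal_def genideal_Sring)
  interpret I: Ideal.ideal J Sring
    unfolding ideal_Sring_iff J by simp
  interpret h: ring_hom_ring Sring "Sring Quot J" \<pi>
    using I.rcos_ring_hom_ring by (simp add: \<pi>_def J_def)
  show "carrier (jacobian_algebra f) = range \<pi>"
    by (auto simp: jacobian_algebra_def Let_def FactRing_def A_RCOSETS_def' \<pi>_def Sring_def)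
  show "\<pi> a \<oplus>\<^bsub>jacobian_algebra f\<^esub> \<pi> b = \<pi> (a + b)"
    using h.hom_add[of a b] by (simp add: jacobian_algebra_def Let_def J_def Sring_def)
  show "s \<odot>\<^bsub>jacobian_algebra f\<^esub> \<pi> a = \<pi> (s * a)"
    using h.hom_mult[of s a] by (simp add: jacobian_algebra_def Let_def J_def \<pi>_def Sring_def)
  have z: "\<zero>\<^bsub>jacobian_algebra f\<^esub> = J"
    by (simp add: jacobian_algebra_def Let_def FactRing_def J_def)
  show "\<pi> a = \<zero>\<^bsub>jacobian_algebra f\<^esub> \<longleftrightarrow> a \<in> pideal.span {pdiff 1 f, pdiff 2 f, pdiff 3 f}"
    unfolding z J[symmetric] \<pi>_def J_def[symmetric]
  proof
    assume "J +>\<^bsub>Sring\<^esub> a = J"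
    moreover have "a \<in> carrier Sring" by (simp add: Sring_def)
    ultimately show "a \<in> J" by (intro I.rcos_const_imp_mem)
  next
    assume "a \<in> J"
    then show "J +>\<^bsub>Sring\<^esub> a = J" by (rule S.a_rcos_zero[OF I.ideal_axioms])
  qed
  show "grade (jacobian_algebra f) k = \<pi> ` {g. homogeneous k g}"
    by (auto simp: jacobian_algebra_def Let_def \<pi>_def)
qed

section \<open>The two maps of the resolution\<close>

context normal_crossing_curves
begin

(* Keeps the index shifts $j - 1$ in the form in which they occur in the definition of $\rho_j$. *)
declare One_nat_def [simp del]

text \<open>The augmentation that sends the basis to $\omega_1, \dots, \omega_{m-1}, \omega^x, \omega^y,
\omega^z$; the last three coordinates are collected in a 1-form that is wedged with $df$.\<close>

definition gen_map :: "fvec \<Rightarrow> cpoly ^ 3" where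
  "gen_map u = (\<Sum>j\<in>{1..<m}. coord u (j - 1) *s omega m fs j)
     + wedge (dform f) (vector [coord u (m - 1), coord u m, coord u (m + 1)])"

definition rel_map :: "fvec \<Rightarrow> fvec" where
  "rel_map t = (\<Sum>j\<in>{1..m}. fscale (coord t (j - 1)) (rho m fs j))"

text \<open>Both resolutions contain these twists, with different shifts \<open>a\<close>.\<close>

abbreviation "gen_twists a \<equiv> replicate (m - 1) a @ replicate 3 (a - 1 :: int)"
abbreviation "rel_twists a \<equiv> map (\<lambda>j. a - int (e j)) [1..<m + 1]"

lemma coord_sum: "coord (\<Sum>x\<in>A. G x) n = (\<Sum>x\<in>A. coord (G x) n)"
  by (rule lookup_sum)

text \<open>The condition $j = n + 1$ rather than $n = j - 1$ lets sums over $j$ be evaluated at a single index.\<close>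

lemma coord_omega_sym:
  assumes "j \<in> {1..m}"
  shows "coord (omega_sym m j) n =
    (if j = m then (if n < m - 1 then - 1 else 0) else if j = n + 1 then 1 else 0)"
proof -
  have "(\<Sum>i\<in>{1..<m}. if n = i - 1 then 1 else 0 :: cpoly)
      = (\<Sum>i\<in>{1..<m}. if i = n + 1 then 1 else 0)"
    by (rule sum.cong) auto
  also have "\<dots> = (if n < m - 1 then 1 else 0)" by auto
  finally show ?thesis using assms by (auto simp: omega_sym_def coord_sum coord_basis)
qed

lemma coord_rho:
  assumes "j \<in> {1..m}"
  shows "coord (rho m fs j) n = fs j * coord (omega_sym m j) n -
     ((if n = m - 1 then pdiff 1 (fs j) else 0) + (if n = m then pdiff 2 (fs j) else 0)
       + (if n = m + 1 then pdiff 3 (fs j) else 0))"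
  by (simp add: rho_def lookup_minus lookup_add coord_basis)

lemma coord_rel_map_omega:
  assumes "n < m - 1"
  shows "coord (rel_map t) n = coord t n * fs (n + 1) - coord t (m - 1) * fs m"
proof -
  have "coord (rel_map t) n = (\<Sum>j\<in>{1..m}. coord t (j - 1) * (fs j * coord (omega_sym m j) n))"
    using assms by (auto simp: rel_map_def coord_sum coord_rho intro!: sum.cong)
  also have "\<dots> = (\<Sum>j\<in>{1..<m}. coord t (j - 1) * (fs j * coord (omega_sym m j) n))
      + coord t (m - 1) * (fs m * coord (omega_sym m m) n)"
    by (rule split_last)
  also have "(\<Sum>j\<in>{1..<m}. coord t (j - 1) * (fs j * coord (omega_sym m j) n))
      = (\<Sum>j\<in>{1..<m}. if j = n + 1 then coord t n * fs (n + 1) else 0)"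
    by (intro sum.cong) (auto simp: coord_omega_sym)
  also have "\<dots> = coord t n * fs (n + 1)" using assms by auto
  also have "coord (omega_sym m m) n = - 1" using assms m by (simp add: coord_omega_sym)
  finally show ?thesis by simp
qed

lemma coord_rel_map_var:
  "coord (rel_map t) (m - 1) = - (\<Sum>j\<in>{1..m}. coord t (j - 1) * pdiff 1 (fs j))"
  "coord (rel_map t) m = - (\<Sum>j\<in>{1..m}. coord t (j - 1) * pdiff 2 (fs j))"
  "coord (rel_map t) (m + 1) = - (\<Sum>j\<in>{1..m}. coord t (j - 1) * pdiff 3 (fs j))"
proof -
  have sym: "coord (omega_sym m j) n = 0" if "j \<in> {1..m}" "n \<ge> m - 1" for j n
    using that by (auto simp: coord_omega_sym)
  show "coord (rel_map t) (m - 1) = - (\<Sum>j\<in>{1..m}. coord t (j - 1) * pdiff 1 (fs j))"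
    "coord (rel_map t) m = - (\<Sum>j\<in>{1..m}. coord t (j - 1) * pdiff 2 (fs j))"
    "coord (rel_map t) (m + 1) = - (\<Sum>j\<in>{1..m}. coord t (j - 1) * pdiff 3 (fs j))"
    using m by (auto simp: rel_map_def coord_sum coord_rho sym sum_negf[symmetric] intro!: sum.cong)
qed

lemma coord_rel_map_out:
  assumes "n \<ge> m + 2" shows "coord (rel_map t) n = 0"
  using assms by (auto simp: rel_map_def coord_sum coord_rho coord_omega_sym intro!: sum.neutral)

lemma gen_map_linear:
  "gen_map (u + v) = gen_map u + gen_map v" "gen_map (fscale s u) = s *s gen_map u"
proof -
  have "(vector [a + a', b + b', c + c'] :: cpoly ^ 3) = vector [a, b, c] + vector [a', b', c']"
    for a b c a' b' c'
    by (rule vec3_eqI) simp_all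
  then show "gen_map (u + v) = gen_map u + gen_map v"
    by (simp add: gen_map_def lookup_add wedge_algebra sum.distrib vector_sadd_rdistrib)
  have "(vector [s * a, s * b, s * c] :: cpoly ^ 3) = s *s vector [a, b, c]" for a b c
    by (rule vec3_eqI) simp_all
  then show "gen_map (fscale s u) = s *s gen_map u"
    by (simp add: gen_map_def wedge_algebra scale_sum vector_add_ldistrib vector_smult_assoc)
qed

lemma rel_map_linear:
  "rel_map (u + v) = rel_map u + rel_map v" "rel_map (fscale s u) = fscale s (rel_map u)"
  by (auto intro!: poly_mapping_eqI simp: rel_map_def coord_sum lookup_add sum.distrib distrib_right sum_distrib_left mult.assoc)

lemma gen_map_0: "gen_map 0 = 0"
  using gen_map_linear(1)[of 0 0] by simp

lemma gen_map_sum: "gen_map (\<Sum>j\<in>A. G j) = (\<Sum>j\<in>A. gen_map (G j))"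
  by (induction A rule: infinite_finite_induct) (auto simp: gen_map_linear gen_map_0)

lemma gen_map_basis:
  "i \<in> {1..<m} \<Longrightarrow> gen_map (basis (i - 1)) = omega m fs i"
  "gen_map (basis (m - 1)) = omega_var f 1" "gen_map (basis m)
      = omega_var f 2" "gen_map (basis (m + 1)) = omega_var f 3"
proof -
  have z: "(\<Sum>j\<in>{1..<m}. (if j - 1 = n then 1 else 0) *s omega m fs j) = 0" if "n \<ge> m - 1" for n
    using that by (intro sum.neutral) auto
  show "gen_map (basis (m - 1)) = omega_var f 1" "gen_map (basis m)
      = omega_var f 2" "gen_map (basis (m + 1)) = omega_var f 3"
    using m z by (auto simp: gen_map_def coord_basis wedge_omega_var)
  assume i: "i \<in> {1..<m}"
  have "(\<Sum>j\<in>{1..<m}. (if j - 1 = i - 1 then 1 else 0) *s omega m fs j)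
      = (\<Sum>j\<in>{1..<m}. if j = i then omega m fs i else 0)"
    using i by (intro sum.cong) auto
  also have "\<dots> = omega m fs i" using i by simp
  finally show "gen_map (basis (i - 1)) = omega m fs i"
    using i by (auto simp: gen_map_def coord_basis wedge_omega_var)
qed

lemma rel_map_basis:
  assumes "j \<in> {1..m}" shows "rel_map (basis (j - 1)) = rho m fs j"
proof -
  have "rel_map (basis (j - 1)) = (\<Sum>i\<in>{1..m}. if i = j then rho m fs j else 0)"
    unfolding rel_map_def using assms
    by (intro sum.cong) (auto simp: coord_basis intro!: poly_mapping_eqI)
  then show ?thesis using assms by simp
qed

lemma gen_map_closed: "dot (gen_map u) (dform f) = 0"
proof -
  have "dot (dform f) (omega m fs j) = 0" if j: "j \<in> {1..m}" for j
  proof -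
    have "fs j * dot (dform f) (omega m fs j) = dot (dform f) (wedge (dform f) (dform (fs j)))"
      by (simp only: wedge_dform_f[OF j] dot_algebra(2))
    also have "\<dots> = 0" by (rule dot_algebra)
    finally show ?thesis using fs_nonzero[OF j] by simp
  qed
  then show ?thesis
    by (subst dot_commute) (simp add: gen_map_def dot_algebra dot_sum)
qed

lemma gen_map_surj:
  assumes "dot v (dform f) = 0"
  shows "\<exists>u. (\<forall>n\<ge>m + 2. coord u n = 0) \<and> gen_map u = v"
proof -
  obtain g \<beta> where v: "v = (\<Sum>j\<in>{1..<m}. g j *s omega m fs j) + wedge (dform f) \<beta>"
    using omega_generate[OF assms] by blast
  define u where "u = (\<Sum>j\<in>{1..<m}. fscale (g j) (basis (j - 1))) + fscale (\<beta> $ 1) (basis (m - 1))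
    + fscale (\<beta> $ 2) (basis m) + fscale (\<beta> $ 3) (basis (m + 1))"
  have "gen_map (\<Sum>j\<in>{1..<m}. fscale (g j) (basis (j - 1))) = (\<Sum>j\<in>{1..<m}. g j *s omega m fs j)"
    by (simp add: gen_map_sum gen_map_linear gen_map_basis(1) cong: sum.cong_simp)
  then have "gen_map u = v"
    by (simp add: u_def v gen_map_linear gen_map_basis(2-4) wedge_omega_var[of \<beta>] add.assoc)
  moreover have "\<forall>n\<ge>m + 2. coord u n = 0"
    by (auto simp: u_def lookup_add coord_sum coord_basis intro!: sum.neutral)
  ultimately show ?thesis by blast
qed

lemma gen_map_rel_map: "gen_map (rel_map t) = 0"
proof -
  have v: "vector [coord (rel_map t) (m - 1), coord (rel_map t) m, coord (rel_map t) (m + 1)]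
      = - (\<Sum>j\<in>{1..m}. coord t (j - 1) *s dform (fs j))"
    by (rule vec3_eqI) (simp_all add: coord_rel_map_var)
  have "(\<Sum>j\<in>{1..<m}. coord (rel_map t) (j - 1) *s omega m fs j)
      = (\<Sum>j\<in>{1..<m}. (coord t (j - 1) * fs j) *s omega m fs j - (coord t (m - 1) * fs m) *s omega m fs j)"
    by (rule sum.cong) (auto simp: coord_rel_map_omega vector_sub_rdistrib)
  also have "\<dots> = (\<Sum>j\<in>{1..m}. (coord t (j - 1) * fs j) *s omega m fs j)"
    unfolding split_last omega_last by (simp add: sum_subtractf scale_sum)
  also have "\<dots> = wedge (dform f) (\<Sum>j\<in>{1..m}. coord t (j - 1) *s dform (fs j))"
    by (simp add: wedge_sum wedge_algebra wedge_dform_f vector_smult_assoc)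
  finally show ?thesis by (simp add: gen_map_def v wedge_algebra)
qed

lemma gen_map_kernel:
  assumes u: "\<forall>n\<ge>m + 2. coord u n = 0" and 0: "gen_map u = 0"
  shows "\<exists>t. (\<forall>n\<ge>m. coord t n = 0) \<and> rel_map t = u"
proof -
  obtain t where t: "\<And>j. j \<in> {1..<m} \<Longrightarrow> coord u (j - 1) = t j * fs j - t m * fs m"
    and \<beta>: "vector [coord u (m - 1), coord u m, coord u (m + 1)]
        = - (\<Sum>j\<in>{1..m}. t j *s dform (fs j))"
    using omega_relations[OF 0[unfolded gen_map_def]] by blast
  define t' where "t' = (\<Sum>j\<in>{1..m}. fscale (t j) (basis (j - 1)))"
  have t': "coord t' (j - 1) = t j" if "j \<in> {1..m}" for j
  proof -
    have "coord t' (j - 1) = (\<Sum>i\<in>{1..m}. if i = j then t j else 0)"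
      unfolding t'_def coord_sum using that by (intro sum.cong) (auto simp: coord_basis)
    then show ?thesis using that by simp
  qed
  have "rel_map t' = u"
  proof (rule poly_mapping_eqI)
    fix n
    have \<beta>': "- (\<Sum>j\<in>{1..m}. coord t' (j - 1) * pdiff i (fs j))
        = vector [coord u (m - 1), coord u m, coord u (m + 1)] $ i"
      for i
      unfolding \<beta> by (simp add: t' cong: sum.cong_simp)
    consider "n < m - 1" | "n = m - 1" | "n = m" | "n = m + 1" | "n \<ge> m + 2" by linarith
    then show "coord (rel_map t') n = coord u n"
    proof cases
      case 1
      then show ?thesis using t[of "n + 1"] t'[of "n + 1"] t'[of m] m
        by (simp add: coord_rel_map_omega)
    next
      case 2
      then show ?thesis using \<beta>'[of 1] by (simp only: coord_rel_map_var) simp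
    next
      case 3
      then show ?thesis using \<beta>'[of 2] by (simp only: coord_rel_map_var) simp
    next
      case 4
      then show ?thesis using \<beta>'[of 3] by (simp only: coord_rel_map_var) simp
    next
      case 5
      then show ?thesis using u by (simp add: coord_rel_map_out)
    qed
  qed
  moreover have "\<forall>n\<ge>m. coord t' n = 0"
    by (auto simp: t'_def coord_sum coord_basis intro!: sum.neutral)
  ultimately show ?thesis by blast
qed

lemma rel_map_inj:
  assumes t: "\<forall>n\<ge>m. coord t n = 0" and 0: "rel_map t = 0"
  shows "t = 0"
proof (rule poly_mapping_eqI)
  fix n
  have "coord t (j - 1) = 0" if "j \<in> {1..m}" for j
  proof (rule rho_independent[of "\<lambda>j. coord t (j - 1)", OF _ _ that])
    show "coord t (i - 1) * fs i = coord t (m - 1) * fs m" if "i \<in> {1..<m}" for i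
      using coord_rel_map_omega[of "i - 1" t] that by (auto simp: 0)
    show "(\<Sum>j\<in>{1..m}. coord t (j - 1) *s dform (fs j)) = 0"
      using coord_rel_map_var[of t] by (intro vec3_eqI) (simp_all add: 0)
  qed
  from this[of "n + 1"] show "coord t n = coord 0 n" using t by (cases "n < m") auto
qed

section \<open>Degrees and minimality\<close>

lemma d_ge: "d > 2"
proof -
  have "(\<Sum>j\<in>{1..m}. 2) \<le> d" unfolding d_def using e by (intro sum_mono) auto
  then show ?thesis using m by simp
qed

lemma hom_omega:
  assumes j: "j \<in> {1..m}" shows "homogeneous (d - 2) (omega m fs j $ l)"
proof -
  have w: "homogeneous ((int (e i) - 1) + (int (e j) - 1)) (wedge (dform (fs i)) (dform (fs j)) $ l)"
    if "i \<in> {1..m}" for i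
    using that j by (intro homogeneous_wedge) (auto intro: hom_pdiff)
  have "homogeneous (d - 2) ((\<Prod>k\<in>{1..m} - {i, j}. fs k) * wedge (dform (fs i)) (dform (fs j)) $ l)"
    if i: "i \<in> {1..m} - {j}" for i
  proof -
    have "d = (\<Sum>k\<in>{1..m} - {i, j}. int (e k)) + (\<Sum>k\<in>{i, j}. int (e k))"
      unfolding d_def using i j by (intro sum.subset_diff) auto
    then have eq: "d - 2 = (\<Sum>k\<in>{1..m} - {i, j}. int (e k)) + ((int (e i) - 1) + (int (e j) - 1))"
      using i by simp
    have "homogeneous (\<Sum>k\<in>{1..m} - {i, j}. int (e k)) (\<Prod>k\<in>{1..m} - {i, j}. fs k)"
      by (rule homogeneous_prod) (auto intro: hom)
    then show ?thesis unfolding eq using w i by (intro homogeneous_mult) auto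
  qed
  then have "homogeneous (d - 2) (\<Sum>i\<in>{1..m} - {j}. (\<Prod>k\<in>{1..m} - {i, j}. fs k) * wedge (dform (fs i)) (dform (fs j)) $ l)"
    by (rule homogeneous_sum)
  then show ?thesis by (simp add: omega_def)
qed

lemma hom_wedge_dform_f:
  assumes "\<And>i. homogeneous k (\<beta> $ i)" shows "homogeneous (d - 1 + k) (wedge (dform f) \<beta> $ l)"
  using assms by (intro homogeneous_wedge) (auto intro: homogeneous_pdiff hom_f)

lemma nth_gen_twists:
  "n < m - 1 \<Longrightarrow> gen_twists a ! n = a"
  "gen_twists a ! (m - 1) = a - 1" "gen_twists a ! m = a - 1" "gen_twists a ! (m + 1) = a - 1"
proof -
  have "gen_twists a ! n = a - 1" if "n \<ge> m - 1" "n - (m - 1) < 3" for n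
    using that by (simp add: nth_append)
  then show "gen_twists a ! (m - 1) = a - 1" "gen_twists a ! m = a - 1" "gen_twists a ! (m + 1)
      = a - 1"
    using m by simp_all
qed (simp add: nth_append)

lemma nth_rel_twists: "i < m \<Longrightarrow> rel_twists a ! i = a - int (e (i + 1))"
  by (simp add: add.commute del: upt_Suc)

lemma hom_gen_map:
  assumes "\<And>i. i < m + 2 \<Longrightarrow> homogeneous (gen_twists a ! i + k) (coord u i)"
  shows "homogeneous (a + d - 2 + k) (gen_map u $ l)"
proof -
  have 1: "homogeneous (a + k) (coord u (j - 1))" if "j \<in> {1..<m}" for j
  proof -
    have "j - 1 < m + 2" "j - 1 < m - 1" using that by auto
    then show ?thesis using assms[of "j - 1"] by (simp only: nth_gen_twists)
  qed
  have 2: "homogeneous (a - 1 + k) (coord u (m - 1))" "homogeneous (a - 1 + k) (coord u m)" "homogeneous (a - 1 + k) (coord u (m + 1))"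
    using assms[of "m - 1"] assms[of m] assms[of "m + 1"] m by (simp_all only: nth_gen_twists)
  have "homogeneous (d - 1 + (a - 1 + k)) (wedge (dform f) (vector [coord u (m - 1), coord u m, coord u (m + 1)]) $ l)"
    by (intro hom_wedge_dform_f vector3_nth 2)
  then have 3: "homogeneous (a + d - 2 + k) (wedge (dform f) (vector [coord u (m - 1), coord u m, coord u (m + 1)]) $ l)"
    by (simp add: algebra_simps)
  have "homogeneous ((a + k) + (d - 2)) (coord u (j - 1) * omega m fs j $ l)" if "j \<in> {1..<m}" for j
    using that by (intro homogeneous_mult 1 hom_omega) auto
  then have "homogeneous (a + d - 2 + k) (\<Sum>j\<in>{1..<m}. coord u (j - 1) * omega m fs j $ l)"
    by (intro homogeneous_sum) (simp add: algebra_simps)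
  with 3 show ?thesis by (simp add: gen_map_def homogeneous_add)
qed

lemma hom_rel_map:
  assumes t: "\<And>i. i < m \<Longrightarrow> homogeneous (rel_twists a ! i + k) (coord t i)" and n: "n < m + 2"
  shows "homogeneous (gen_twists a ! n + k) (coord (rel_map t) n)"
proof -
  have t': "homogeneous (a - int (e j) + k) (coord t (j - 1))" if "j \<in> {1..m}" for j
  proof -
    have "j - 1 < m" "j - 1 + 1 = j" using that by auto
    then show ?thesis using t[of "j - 1"] by (simp only: nth_rel_twists)
  qed
  have p: "homogeneous (a + k - 1) (- (\<Sum>j\<in>{1..m}. coord t (j - 1) * pdiff i (fs j)))" for i
  proof (intro homogeneous_uminus homogeneous_sum)
    fix j assume "j \<in> {1..m}"
    then have "homogeneous ((a - int (e j) + k) + (int (e j) - 1)) (coord t (j - 1) * pdiff i (fs j))"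
      by (intro homogeneous_mult t' hom_pdiff)
    then show "homogeneous (a + k - 1) (coord t (j - 1) * pdiff i (fs j))"
      by (simp add: algebra_simps)
  qed
  have q: "homogeneous (a + k) (coord t (j - 1) * fs j)" if "j \<in> {1..m}" for j
  proof -
    have "homogeneous ((a - int (e j) + k) + int (e j)) (coord t (j - 1) * fs j)"
      using that by (intro homogeneous_mult t' hom)
    then show ?thesis by (simp add: algebra_simps)
  qed
  consider "n < m - 1" | "n = m - 1" | "n = m" | "n = m + 1" using n by linarith
  then show ?thesis
  proof cases
    case 1
    then have "homogeneous (a + k) (coord t n * fs (n + 1) - coord t (m - 1) * fs m)"
      using q[of "n + 1"] q[of m] m by (intro homogeneous_diff) auto
    then show ?thesis using 1 by (simp only: coord_rel_map_omega nth_gen_twists)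
  next
    case 2
    then show ?thesis using p[of 1] by (simp only: coord_rel_map_var nth_gen_twists) (simp add: algebra_simps)
  next
    case 3
    then show ?thesis using p[of 2] by (simp only: coord_rel_map_var nth_gen_twists) (simp add: algebra_simps)
  next
    case 4
    then show ?thesis using p[of 3] by (simp only: coord_rel_map_var nth_gen_twists) (simp add: algebra_simps)
  qed
qed

lemma rel_map_minimal: "coord (rel_map t) n \<in> irrelevant_ideal"
proof -
  have fs: "fs j \<in> irrelevant_ideal" if "j \<in> {1..m}" for j
    using hom[OF that] e[OF that] by (intro homogeneous_in_irrelevant_ideal) auto
  have pd: "pdiff i (fs j) \<in> irrelevant_ideal" if "j \<in> {1..m}" for i j
    using hom_pdiff[OF that] e[OF that] by (intro homogeneous_in_irrelevant_ideal) auto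
  have "coord (rho m fs j) n \<in> irrelevant_ideal" if "j \<in> {1..m}" for j
  proof -
    have "fs j * coord (omega_sym m j) n \<in> irrelevant_ideal"
      by (subst mult.commute) (rule irrelevant_ideal_mult[OF fs[OF that]])
    then show ?thesis
      unfolding coord_rho[OF that]
      by (intro irrelevant_ideal_closed) (simp_all add: pd[OF that] irrelevant_ideal_closed(1))
  qed
  then show ?thesis
    unfolding rel_map_def coord_sum lookup_fscale by (intro irrelevant_ideal_closed irrelevant_ideal_mult)
qed

lemma gen_map_minimal: "gen_map u $ l \<in> irrelevant_ideal"
proof -
  have om: "omega m fs j $ l \<in> irrelevant_ideal" if "j \<in> {1..<m}" for j
    using hom_omega[of j l] that d_ge by (intro homogeneous_in_irrelevant_ideal) auto
  have pd: "pdiff i f \<in> irrelevant_ideal" for i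
    using homogeneous_pdiff[OF hom_f] d_ge by (intro homogeneous_in_irrelevant_ideal) auto
  have "pdiff i f * b - pdiff j f * c \<in> irrelevant_ideal" for i j b c
    by (subst (1 2) mult.commute) (intro irrelevant_ideal_closed irrelevant_ideal_mult pd)
  then have w: "wedge (dform f) \<beta> $ l \<in> irrelevant_ideal" for \<beta>
    using exhaust_3[of l] by auto
  show ?thesis
    unfolding gen_map_def vector_add_component sum_component vector_smult_component
    by (intro irrelevant_ideal_closed irrelevant_ideal_mult om w)
qed

section \<open>The resolutions\<close>

lemma carrier_gens: "u \<in> carrier (free_module (gen_twists a)) \<longleftrightarrow> (\<forall>n\<ge>m + 2. coord u n = 0)"
  and carrier_rels: "u \<in> carrier (free_module (rel_twists a)) \<longleftrightarrow> (\<forall>n\<ge>m. coord u n = 0)"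
proof -
  have "length (gen_twists a) = m + 2" "length (rel_twists a) = m" using m by simp_all
  then show "u \<in> carrier (free_module (gen_twists a)) \<longleftrightarrow> (\<forall>n\<ge>m + 2. coord u n = 0)"
    "u \<in> carrier (free_module (rel_twists a)) \<longleftrightarrow> (\<forall>n\<ge>m. coord u n = 0)"
    by (simp_all only: free_module_simps)
qed

lemma graded_hom_rel_map:
  "graded_hom (free_module (rel_twists a)) (free_module (gen_twists a)) rel_map"
  unfolding graded_hom_def
proof (intro conjI allI)
  show "rel_map ` grade (free_module (rel_twists a)) k \<subseteq> grade (free_module (gen_twists a)) k" for k
    using hom_rel_map[of a k] m by (auto simp: free_module_simps coord_rel_map_out)
qed (use m in \<open>auto simp: free_module_simps coord_rel_map_out rel_map_linear\<close>)

lemma kernel_gen_map: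
  "{u \<in> carrier (free_module (gen_twists a)). gen_map u = 0}
      = rel_map ` carrier (free_module (rel_twists b))"
proof (intro equalityI subsetI)
  fix u assume "u \<in> {u \<in> carrier (free_module (gen_twists a)). gen_map u = 0}"
  then have "\<forall>n\<ge>m + 2. coord u n = 0" "gen_map u = 0" unfolding carrier_gens by blast+
  from gen_map_kernel[OF this] show "u \<in> rel_map ` carrier (free_module (rel_twists b))"
    unfolding image_iff Bex_def carrier_rels by blast
next
  fix u assume "u \<in> rel_map ` carrier (free_module (rel_twists b))"
  then show "u \<in> {u \<in> carrier (free_module (gen_twists a)). gen_map u = 0}"
    unfolding mem_Collect_eq carrier_gens using coord_rel_map_out gen_map_rel_map by blast
qed

lemma kernel_rel_map: "{t \<in> carrier (free_module (rel_twists a)). rel_map t = 0} = {0}"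
proof -
  have "rel_map 0 = 0" using rel_map_linear(1)[of 0 0] by simp
  then show ?thesis using rel_map_inj unfolding carrier_rels by auto
qed

lemma image_gen_map: "gen_map ` carrier (free_module (gen_twists a)) = {v. dot v (dform f) = 0}"
proof (intro equalityI subsetI)
  fix v assume "v \<in> {v. dot v (dform f) = 0}"
  then show "v \<in> gen_map ` carrier (free_module (gen_twists a))"
    using gen_map_surj[of v] unfolding image_iff Bex_def carrier_gens by blast
qed (auto simp: gen_map_closed)

lemma graded_hom_gen_map: "graded_hom (free_module (gen_twists (2 - d))) (D0 f) gen_map"
  unfolding graded_hom_def
proof (intro conjI allI)
  fix k
  show "gen_map ` grade (free_module (gen_twists (2 - d))) k \<subseteq> grade (D0 f) k"
  proof (intro image_subsetI)
    fix u assume "u \<in> grade (free_module (gen_twists (2 - d))) k"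
    then have "homogeneous (gen_twists (2 - d) ! i + k) (coord u i)" if "i < m + 2" for i
      using that m by (auto simp only: free_module_simps length_append length_replicate)
    then have "homogeneous (2 - d + d - 2 + k) (gen_map u $ l)" for l by (rule hom_gen_map)
    then show "gen_map u \<in> grade (D0 f) k" by (simp add: D0_simps gen_map_closed)
  qed
qed (simp_all add: free_module_simps(2,3) D0_simps gen_map_linear gen_map_closed)

theorem resolution_D0:
  "minimal_graded_free_resolution [gen_twists (2 - d), rel_twists (2 - d)] gen_map
     (\<lambda>k. if k = 0 then rel_map else (\<lambda>_. 0)) (D0 f)"
    (is "minimal_graded_free_resolution ?As _ ?\<delta> _")
proof -
  have R: "res_term ?As 0 = free_module (gen_twists (2 - d))" "res_term ?As 1
      = free_module (rel_twists (2 - d))"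
    "res_term ?As (Suc 0) = free_module (rel_twists (2 - d))" "res_term ?As (Suc (Suc k))
        = free_module []"
      for k
    by (simp_all add: res_term_def)
  show ?thesis
    unfolding minimal_graded_free_resolution_def
  proof (intro conjI allI ballI)
    show "graded_hom (res_term ?As 0) (D0 f) gen_map"
      unfolding R by (rule graded_hom_gen_map)
    show "graded_hom (res_term ?As (Suc k)) (res_term ?As k) (?\<delta> k)" for k
    proof (cases k)
      case 0
      then show ?thesis by (simp only: R if_True simp_thms) (rule graded_hom_rel_map)
    next
      case (Suc n)
      then show ?thesis by (simp only: R nat.distinct if_False) (simp only: res_term_def graded_hom_zero)
    qed
    show "gen_map ` carrier (res_term ?As 0) = carrier (D0 f)"
      unfolding R image_gen_map by (auto simp: D0_simps)
    show "a_kernel (res_term ?As 0) (D0 f) gen_map = ?\<delta> 0 ` carrier (res_term ?As 1)"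
      by (simp only: R a_kernel_def' D0_simps kernel_gen_map if_True simp_thms)
    show "a_kernel (res_term ?As (Suc k)) (res_term ?As k) (?\<delta> k)
        = ?\<delta> (Suc k) ` carrier (res_term ?As (Suc (Suc k)))"
      for k
    proof (cases k)
      case 0
      then show ?thesis
        by (simp only: R a_kernel_def' free_module_simps(4) kernel_rel_map if_True nat.distinct if_False simp_thms)
           (auto simp: free_module_Nil)
    next
      case (Suc n)
      then show ?thesis
        by (simp only: R a_kernel_def' nat.distinct if_False)
           (auto simp: free_module_Nil res_term_def free_module_simps(4))
    qed
    show "coord (?\<delta> k u) i \<in> irrelevant_ideal" for k u i
      by (simp add: rel_map_minimal irrelevant_ideal_closed(1))
  qed
qed

definition fvec_of :: "cpoly ^ 3 \<Rightarrow> fvec" where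
  "fvec_of v = fscale (v $ 1) (basis 0) + fscale (v $ 2) (basis 1) + fscale (v $ 3) (basis 2)"

definition grad_map :: "fvec \<Rightarrow> fvec" where
  "grad_map u = fscale (dot (vector [coord u 0, coord u 1, coord u 2]) (dform f)) (basis 0)"

lemma coord_fvec_of:
  "coord (fvec_of v) n = (if n = 0 then v $ 1 else if n = 1 then v $ 2 else if n = 2 then v $ 3 else 0)"
  by (simp add: fvec_of_def lookup_add coord_basis)

lemma coord_grad_map:
  "coord (grad_map u) n = (if n = 0 then dot (vector [coord u 0, coord u 1, coord u 2]) (dform f) else 0)"
  by (simp add: grad_map_def coord_basis)

lemma fvec_of_eq_0: "fvec_of v = 0 \<longleftrightarrow> v = 0"
proof
  assume "fvec_of v = 0"
  then have "coord (fvec_of v) n = 0" for n by simp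
  from this[of 0] this[of 1] this[of 2] show "v = 0"
    by (intro vec3_eqI) (simp_all add: coord_fvec_of)
qed (auto intro!: poly_mapping_eqI simp: coord_fvec_of)

lemma graded_hom_grad_map:
  "graded_hom (free_module (replicate 3 (1 - d))) (free_module [0]) grad_map"
  unfolding graded_hom_def
proof (intro conjI allI)
  fix k
  show "grad_map ` grade (free_module (replicate 3 (1 - d))) k \<subseteq> grade (free_module [0]) k"
  proof (intro image_subsetI)
    fix u assume "u \<in> grade (free_module (replicate 3 (1 - d))) k"
    then have u: "homogeneous (1 - d + k) (coord u i)" if "i < 3" for i
      using that by (simp add: free_module_simps)
    have "homogeneous ((1 - d + k) + (d - 1)) (dot (vector [coord u 0, coord u 1, coord u 2]) (dform f))"
      unfolding dot_def by (intro homogeneous_add homogeneous_mult) (simp_all add: u homogeneous_pdiff[OF hom_f])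
    then show "grad_map u \<in> grade (free_module [0]) k"
      by (simp add: free_module_simps coord_grad_map)
  qed
qed (auto simp: free_module_simps coord_grad_map dot_def lookup_add algebra_simps intro!: poly_mapping_eqI)

lemma graded_hom_fvec_of_gen_map:
  "graded_hom (free_module (gen_twists (3 - 2 * d))) (free_module (replicate 3 (1 - d))) (\<lambda>u. fvec_of (gen_map u))"
  unfolding graded_hom_def
proof (intro conjI allI)
  fix k
  show "(\<lambda>u. fvec_of (gen_map u)) ` grade (free_module (gen_twists (3 - 2 * d))) k
      \<subseteq> grade (free_module (replicate 3 (1 - d))) k"
  proof (intro image_subsetI)
    fix u assume "u \<in> grade (free_module (gen_twists (3 - 2 * d))) k"
    then have "homogeneous (gen_twists (3 - 2 * d) ! i + k) (coord u i)" if "i < m + 2" for i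
      using that m by (auto simp only: free_module_simps length_append length_replicate)
    then have "homogeneous (3 - 2 * d + d - 2 + k) (gen_map u $ l)" for l by (rule hom_gen_map)
    then show "fvec_of (gen_map u) \<in> grade (free_module (replicate 3 (1 - d))) k"
      by (simp add: free_module_simps coord_fvec_of)
  qed
qed (auto simp: free_module_simps(1,2,3) coord_fvec_of gen_map_linear lookup_add intro!: poly_mapping_eqI)

text \<open>The place where the two resolutions are spliced: the kernel of the gradient map is $D_0(f)$, which
is the image of \<open>gen_map\<close>.\<close>

lemma kernel_grad_map:
  "{u \<in> carrier (free_module (replicate 3 (1 - d))). grad_map u = 0}
    = (\<lambda>u. fvec_of (gen_map u)) ` carrier (free_module (gen_twists a))"
proof (intro equalityI subsetI)
  fix u assume "u \<in> {u \<in> carrier (free_module (replicate 3 (1 - d))). grad_map u = 0}"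
  then have u: "\<forall>i\<ge>3. coord u i = 0" "grad_map u = 0" by (auto simp: free_module_simps)
  let ?v = "vector [coord u 0, coord u 1, coord u 2] :: cpoly ^ 3"
  have "dot ?v (dform f) = 0" using coord_grad_map[of u 0] u(2) by simp
  then obtain w where w: "\<forall>n\<ge>m + 2. coord w n = 0" "gen_map w = ?v" using gen_map_surj by blast
  have "u = fvec_of (gen_map w)"
    using u(1) by (intro poly_mapping_eqI) (auto simp: w(2) coord_fvec_of)
  then show "u \<in> (\<lambda>u. fvec_of (gen_map u)) ` carrier (free_module (gen_twists a))"
    using w(1) unfolding image_iff Bex_def carrier_gens by blast
next
  fix u assume "u \<in> (\<lambda>u. fvec_of (gen_map u)) ` carrier (free_module (gen_twists a))"
  then obtain w where w: "u = fvec_of (gen_map w)" by blast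
  have "grad_map u = 0"
    using gen_map_closed[of w] by (intro poly_mapping_eqI) (simp add: w coord_grad_map coord_fvec_of dot_def)
  then show "u \<in> {u \<in> carrier (free_module (replicate 3 (1 - d))). grad_map u = 0}"
    by (auto simp: w free_module_simps coord_fvec_of)
qed

lemma grad_map_cokernel:
  "{u \<in> carrier (free_module [0]). coord u 0 \<in> pideal.span {pdiff 1 f, pdiff 2 f, pdiff 3 f}}
    = grad_map ` carrier (free_module (replicate 3 a))"
proof (intro equalityI subsetI)
  fix u assume "u \<in> {u \<in> carrier (free_module [0]). coord u 0 \<in> pideal.span {pdiff 1 f, pdiff 2 f, pdiff 3 f}}"
  then have u: "\<forall>i\<ge>1. coord u i = 0" "coord u 0 \<in> pideal.span {pdiff 1 f, pdiff 2 f, pdiff 3 f}"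
    by (auto simp: free_module_simps One_nat_def)
  then obtain A B C where "coord u 0 = A * pdiff 1 f + B * pdiff 2 f + C * pdiff 3 f"
    by (auto simp: span_triple)
  then have "u = grad_map (fvec_of (vector [A, B, C]))"
    using u(1) by (intro poly_mapping_eqI) (auto simp: coord_grad_map coord_fvec_of dot_def)
  moreover have "fvec_of (vector [A, B, C]) \<in> carrier (free_module (replicate 3 a))"
    by (simp add: free_module_simps coord_fvec_of)
  ultimately show "u \<in> grad_map ` carrier (free_module (replicate 3 a))" by blast
next
  fix u assume "u \<in> grad_map ` carrier (free_module (replicate 3 a))"
  then obtain v where v: "u = grad_map v" by blast
  have "coord u 0 \<in> pideal.span {pdiff 1 f, pdiff 2 f, pdiff 3 f}"
    unfolding span_triple by (auto simp: v coord_grad_map dot_def)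
  then show "u \<in> {u \<in> carrier (free_module [0]). coord u 0 \<in> pideal.span {pdiff 1 f, pdiff 2 f, pdiff 3 f}}"
    by (auto simp: v free_module_simps coord_grad_map)
qed

lemma coord_0_surj: "(\<lambda>u. coord u 0) ` carrier (free_module [a]) = UNIV"
proof (intro equalityI subsetI)
  fix g :: cpoly
  have "fscale g (basis 0) \<in> carrier (free_module [a])" "g = coord (fscale g (basis 0)) 0"
    by (simp_all add: free_module_simps coord_basis)
  then show "g \<in> (\<lambda>u. coord u 0) ` carrier (free_module [a])" by blast
qed simp

lemma graded_hom_quotient:
  "graded_hom (free_module [0]) (jacobian_algebra g) (\<lambda>u. jacobian_ideal g +>\<^bsub>Sring\<^esub> coord u 0)"
  unfolding graded_hom_def
  by (auto simp: free_module_simps jacobian_algebra_simps lookup_add)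

theorem resolution_jacobian_algebra:
  "minimal_graded_free_resolution
     [[0], replicate 3 (1 - d), gen_twists (3 - 2 * d), rel_twists (3 - 2 * d)]
     (\<lambda>u. jacobian_ideal f +>\<^bsub>Sring\<^esub> coord u 0)
     (\<lambda>k. if k = 0 then grad_map else if k = Suc 0 then (\<lambda>u. fvec_of (gen_map u))
       else if k = Suc (Suc 0) then rel_map else (\<lambda>_. 0))
     (jacobian_algebra f)" (is "minimal_graded_free_resolution ?As ?\<epsilon> ?\<delta> _")
proof -
  have R: "res_term ?As 0 = free_module [0]" "res_term ?As 1 = free_module (replicate 3 (1 - d))"
    "res_term ?As (Suc 0) = free_module (replicate 3 (1 - d))"
    "res_term ?As (Suc (Suc 0)) = free_module (gen_twists (3 - 2 * d))"
    "res_term ?As (Suc (Suc (Suc 0))) = free_module (rel_twists (3 - 2 * d))"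
    "res_term ?As (Suc (Suc (Suc (Suc k)))) = free_module []" for k
    by (simp_all add: res_term_def)
  have \<delta>: "?\<delta> 0 = grad_map" "?\<delta> (Suc 0) = (\<lambda>u. fvec_of (gen_map u))" "?\<delta> (Suc (Suc 0)) = rel_map"
    "?\<delta> (Suc (Suc (Suc k))) = (\<lambda>_. 0)" for k
    by simp_all
  have cases4: "k = 0 \<or> k = Suc 0 \<or> k = Suc (Suc 0) \<or> (\<exists>n. k = Suc (Suc (Suc n)))" for k :: nat
    by (metis not0_implies_Suc)
  have pd: "pdiff i f \<in> irrelevant_ideal" for i
    using homogeneous_pdiff[OF hom_f] d_ge by (intro homogeneous_in_irrelevant_ideal) auto
  have zero: "graded_hom (free_module as) (res_term ?As k) (\<lambda>_. 0)" for as k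
    unfolding res_term_def by (rule graded_hom_zero)
  show ?thesis
    unfolding minimal_graded_free_resolution_def
  proof (intro conjI allI ballI)
    show "graded_hom (res_term ?As 0) (jacobian_algebra f) ?\<epsilon>"
      unfolding R by (rule graded_hom_quotient)
    show "graded_hom (res_term ?As (Suc k)) (res_term ?As k) (?\<delta> k)" for k
    proof -
      consider "k = 0" | "k = Suc 0" | "k = Suc (Suc 0)" | n where "k = Suc (Suc (Suc n))"
        using cases4[of k] by blast
      then show ?thesis
      proof cases
        case 1
        show ?thesis unfolding 1 R \<delta> by (rule graded_hom_grad_map)
      next
        case 2
        show ?thesis unfolding 2 R \<delta> by (rule graded_hom_fvec_of_gen_map)
      next
        case 3
        show ?thesis unfolding 3 R \<delta> by (rule graded_hom_rel_map)
      next
        case 4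
        show ?thesis unfolding 4 R(6) \<delta> by (rule zero)
      qed
    qed
    show "?\<epsilon> ` carrier (res_term ?As 0) = carrier (jacobian_algebra f)"
      unfolding R jacobian_algebra_simps
      by (subst coord_0_surj[of 0, symmetric]) (simp only: image_image)
    show "a_kernel (res_term ?As 0) (jacobian_algebra f) ?\<epsilon> = ?\<delta> 0 ` carrier (res_term ?As 1)"
      unfolding R \<delta> a_kernel_def' jacobian_algebra_simps(4) by (rule grad_map_cokernel)
    show "a_kernel (res_term ?As (Suc k)) (res_term ?As k) (?\<delta> k)
        = ?\<delta> (Suc k) ` carrier (res_term ?As (Suc (Suc k)))"
      for k
    proof -
      have z: "\<zero>\<^bsub>res_term ?As k\<^esub> = 0" by (simp add: res_term_def free_module_simps(4))
      consider "k = 0" | "k = Suc 0" | "k = Suc (Suc 0)" | n where "k = Suc (Suc (Suc n))"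
        using cases4[of k] by blast
      then show ?thesis
      proof cases
        case 1
        show ?thesis unfolding a_kernel_def' z unfolding 1 R \<delta> by (rule kernel_grad_map)
      next
        case 2
        show ?thesis unfolding a_kernel_def' z unfolding 2 R \<delta> fvec_of_eq_0 by (rule kernel_gen_map)
      next
        case 3
        show ?thesis unfolding a_kernel_def' z unfolding 3 R \<delta> kernel_rel_map by (auto simp: free_module_Nil)
      next
        case 4
        show ?thesis unfolding a_kernel_def' z unfolding 4 R(6) \<delta> by (auto simp: free_module_Nil)
      qed
    qed
    show "coord (?\<delta> k u) i \<in> irrelevant_ideal" for k u i
    proof -
      have "coord (grad_map u) i \<in> irrelevant_ideal"
        unfolding coord_grad_map dot_def
        by (simp add: irrelevant_ideal_closed(1)) (intro impI irrelevant_ideal_closed irrelevant_ideal_mult pd)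
      then show ?thesis
        by (simp add: rel_map_minimal gen_map_minimal coord_fvec_of irrelevant_ideal_closed(1))
    qed
  qed
qed

end

theorem theorem1p3:
  fixes m :: nat and fs :: "nat \<Rightarrow> cpoly" and e :: "nat \<Rightarrow> nat" and f :: cpoly and d :: int
  assumes "m \<ge> 4"
    and "\<And>j. j \<in> {1..m} \<Longrightarrow> homogeneous (int (e j)) (fs j)"
    and "\<And>j. j \<in> {1..m} \<Longrightarrow> irreducible (fs j)"
    and "inj_on (\<lambda>j. curve (fs j)) {1..m}"
    and "\<And>j. j \<in> {1..m} \<Longrightarrow> smooth_curve (fs j)"
    and "normal_crossing {1..m} fs"
    and "\<And>j. j \<in> {1..m} \<Longrightarrow> e j \<ge> 2"
    and "f = (\<Prod>j=1..m. fs j)"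
    and "d = (\<Sum>j=1..m. int (e j))"
  shows
    "(\<exists>\<epsilon> \<delta>.
        minimal_graded_free_resolution
          [replicate (m - 1) (- d + 2) @ replicate 3 (- d + 1),
           map (\<lambda>j. - d + 2 - int (e j)) [1..<m + 1]]
          \<epsilon> \<delta> (D0 f) \<and>
        (\<forall>i\<in>{1..<m}. \<epsilon> (basis (i - 1)) = omega m fs i) \<and>
        \<epsilon> (basis (m - 1)) = omega_var f 1 \<and>
        \<epsilon> (basis m) = omega_var f 2 \<and>
        \<epsilon> (basis (m + 1)) = omega_var f 3 \<and>
        (\<forall>j\<in>{1..m}. \<delta> 0 (basis (j - 1)) = rho m fs j)) \<and>
     (\<exists>\<epsilon> \<delta>.
        minimal_graded_free_resolution
          [[0],
           replicate 3 (- d + 1),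
           replicate (m - 1) (- 2 * d + 3) @ replicate 3 (- 2 * d + 2),
           map (\<lambda>j. - 2 * d + 3 - int (e j)) [1..<m + 1]]
          \<epsilon> \<delta> (jacobian_algebra f)) \<and>
     omega m fs m = - (\<Sum>i=1..<m. omega m fs i) \<and>
     (\<forall>j\<in>{1..m}.
        fs j *s omega m fs j -
          (pdiff 1 (fs j) *s omega_var f 1 +
           pdiff 2 (fs j) *s omega_var f 2 +
           pdiff 3 (fs j) *s omega_var f 3) = 0)"
proof -
  interpret C: normal_crossing_curves m fs e
    using assms by unfold_locales auto
  have f: "f = C.f" and d: "d = C.d" using assms by (simp_all add: C.f_def C.d_def)
  have tw: "- C.d + 2 = 2 - C.d" "- C.d + 1 = 2 - C.d - 1" "- C.d + 1 = 1 - C.d"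
    "- 2 * C.d + 3 = 3 - 2 * C.d" "- 2 * C.d + 2 = 3 - 2 * C.d - 1" by simp_all
  show ?thesis
    unfolding f d
  proof (intro conjI)
    show "\<exists>\<epsilon> \<delta>. minimal_graded_free_resolution
          [replicate (m - 1) (- C.d + 2) @ replicate 3 (- C.d + 1),
           map (\<lambda>j. - C.d + 2 - int (e j)) [1..<m + 1]]
          \<epsilon> \<delta> (D0 C.f) \<and>
        (\<forall>i\<in>{1..<m}. \<epsilon> (basis (i - 1)) = omega m fs i) \<and>
        \<epsilon> (basis (m - 1)) = omega_var C.f 1 \<and>
        \<epsilon> (basis m) = omega_var C.f 2 \<and>
        \<epsilon> (basis (m + 1)) = omega_var C.f 3 \<and>
        (\<forall>j\<in>{1..m}. \<delta> 0 (basis (j - 1)) = rho m fs j)"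
      unfolding tw(1,2)
      by (intro exI conjI ballI) (rule C.resolution_D0 C.gen_map_basis | simp add: C.rel_map_basis)+
    show "\<exists>\<epsilon> \<delta>. minimal_graded_free_resolution
          [[0], replicate 3 (- C.d + 1),
           replicate (m - 1) (- 2 * C.d + 3) @ replicate 3 (- 2 * C.d + 2),
           map (\<lambda>j. - 2 * C.d + 3 - int (e j)) [1..<m + 1]]
          \<epsilon> \<delta> (jacobian_algebra C.f)"
      unfolding tw(3,4,5) by (intro exI) (rule C.resolution_jacobian_algebra)
    show "omega m fs m = - (\<Sum>i=1..<m. omega m fs i)" by (rule C.omega_last)
    show "\<forall>j\<in>{1..m}. fs j *s omega m fs j -
          (pdiff 1 (fs j) *s omega_var C.f 1 + pdiff 2 (fs j) *s omega_var C.f 2 +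
           pdiff 3 (fs j) *s omega_var C.f 3) = 0"
      using C.rho_relation by blast
  qed
qed

end
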